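(* Let $0<r<n\le 2r$ be integers, let $\alpha,\beta\in\mathbb{C}$, $C\in M_{r,n-r}$, $D\in M_{n-r,r}$, and let $$A=\begin{bmatrix}\alpha I_r & C\\ D&\beta I_{n-r}\end{bmatrix}\in M_n .$$ Suppose that $Z=DC$ is normal and commutes with $H=C^*C+DD^*$, and let $z_j$ and $h_j$, $j=1,\dots,n-r$, be the eigenvalues of $Z$ and $H$ labeled according to a simultaneous unitary diagonalization: there is a unitary $U\in M_{n-r}$ with $U^*ZU=\mathrm{diag}(z_1,\dots,z_{n-r})$ and $U^*HU=\mathrm{diag}(h_1,\dots,h_{n-r})$. For $j=1,\dots,n-r$ let $\Delta_j=(\alpha-\beta)^2+4z_j$ and let $\hat{\mathcal E}_j$ be the ellipse with foci at $\frac12(\alpha+\beta)\pm\frac12\sqrt{\Delta_j}$ and with major and minor axes of length $$\sqrt{\tfrac12|\alpha-\beta|^2+h_j+\tfrac12|\Delta_j|}\qquad\text{and}\qquad \sqrt{\tfrac12|\alpha-\beta|^2+h_j-\tfrac12|\Delta_j|},$$ respectively. Then the following hold. (a) The boundary generating curve of $W(A)$ is $$C(A)=\begin{cases}\hat{\mathcal E}_1\cup\dots\cup\hat{\mathcal E}_{n-r}\cup\{\alpha\}, & \text{if } n<2r,\\ \hat{\mathcal E}_1\cup\dots\cup\hat{\mathcal E}_{n/2}, & \text{if } n=2r,\end{cases}$$ and $W(A)$ is the convex hull of $\hat{\mathcal E}_1,\dots,\hat{\mathcal E}_{n-r}$. (b) For $1\le k\le n-r$, $$\Lambda_k(A)=\bigcap_{1\le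 j_1<\cdots<j_{n-r-k+1}\le n-r}\mathrm{conv}\,\{\hat{\mathcal E}_{j_1},\dots,\hat{\mathcal E}_{j_{n-r-k+1}}\}.$$ Moreover, if $n<2r$, then $\Lambda_k(A)=\{\alpha\}$ for $n-r<k\le r$ and $\Lambda_k(A)=\emptyset$ for $r<k\le n$; if $n=2r$, then $\Lambda_k(A)=\emptyset$ for $n/2<k\le n$.
   Context: $M_{m,n}$ is the set of $m\times n$ complex matrices and $M_n=M_{n,n}$. For $A\in M_n$ and $1\le k\le n$, the rank-$k$ numerical range is $$\Lambda_k(A)=\{\lambda\in\mathbb{C}: X^*AX=\lambda I_k \text{ for some } X\in M_{n,k}\text{ with }X^*X=I_k\},$$ and $W(A)=\Lambda_1(A)=\{x^*Ax: x\in\mathbb{C}^n,\ x^*x=1\}$ is the numerical range. Let $\Re(A)=(A+A^* )/2$ and $\Im(A)=(A-A^* )/(2i)$. For $\theta\in[0,2\pi)$ let $\lambda_1(\theta)\ge\dots\ge\lambda_n(\theta)$ be the eigenvalues of $\Re(e^{-i\theta}A)=\Re(A)\cos\theta+\Im(A)\sin\theta$. The boundary generating curve (Kippenhahn curve) $C(A)$ is the envelope of the family of lines $\{z\in\mathbb{C}:\Re(e^{-i\theta}z)=\lambda_k(\theta)\}$, $\theta\in[0,2\pi)$, $k=1,\dots,n$; equivalently, it is the set of real affine points of the dual of the algebraic curve $\det(x\Re(A)+y\Im(A)+tI_n)=0$, with $\mathbb{C}$ identified with $\mathbb{R}^2$ (a linear factor of this polynomial contributes a single point). "Length of the major/minor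 axis" is the full length of the axis. An ellipse may be degenerate: if the minor axis has length $0$, it degenerates to its two foci (as a component of $C(A)$), and its convex hull is the line segment joining the foci, or a single point if the foci coincide. $\mathrm{conv}\{S_1,\dots,S_q\}$ denotes the convex hull of $S_1\cup\dots\cup S_q$.
   Formalization: In (b), emptiness of Λ_k(A) for k>r is claimed, when α=β, only if fewer than k−r of the h_j are zero; otherwise it is false (for α=β, C=D=0 one has A=αI_n and Λ_k(A)={α} for all k≤n). *)

theory Defs
  imports "HOL-Analysis.Convex" "Jordan_Normal_Form.Schur_Decomposition"
begin

definition normal_mat :: "complex mat \<Rightarrow> bool" where
  "normal_mat M \<longleftrightarrow> square_mat M \<and> M * mat_adjoint M = mat_adjoint M * M"

definition unitary_mat :: "nat \<Rightarrow> complex mat \<Rightarrow> bool" where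
  "unitary_mat m U \<longleftrightarrow> U \<in> carrier_mat m m \<and> mat_adjoint U * U = 1\<^sub>m m"

definition hermitian_part :: "complex mat \<Rightarrow> complex mat" where
  "hermitian_part M = (1 / 2) \<cdot>\<^sub>m (M + mat_adjoint M)"

definition rank_numerical_range :: "nat \<Rightarrow> complex mat \<Rightarrow> complex set" where
  "rank_numerical_range k M =
     {w. \<exists>X \<in> carrier_mat (dim_row M) k.
            mat_adjoint X * X = 1\<^sub>m k \<and> mat_adjoint X * M * X = w \<cdot>\<^sub>m 1\<^sub>m k}"

definition numerical_range :: "complex mat \<Rightarrow> complex set" where
  "numerical_range M =
     {(M *\<^sub>v x) \<bullet>c x |x. x \<in> carrier_vec (dim_row M) \<and> x \<bullet>c x = 1}"

text \<open>
  The Kippenhahn curve is the envelope of the lines \<open>F(w,t) = Re (e^(-it) w) - \<mu>(t) = 0\<close>, where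
  \<open>\<mu>(t)\<close> runs through the eigenvalues of the Hermitian part of \<open>e^(-it) M\<close>: the point \<open>w\<close> lies on it
  iff \<open>F = 0\<close> and \<open>dF/dt = 0\<close> at \<open>w\<close> for some \<open>t\<close>.

  The derivative is taken along differentiable eigenvalue branches, not along the eigenvalues
  in decreasing order: the latter need not be differentiable where two branches cross, and the
  points of tangency to a line common to two components would be lost. By Rellich's theorem the
  eigenvalues form \<open>n\<close> real-analytic branches, and any selection of eigenvalues that is
  differentiable at \<open>\<theta>\<close> has the same value and derivative there as one of these, so the set below
  is the union of the envelopes of the analytic branches. A branch \<open>Re (e^(-it) p)\<close>, all of whose
  lines pass through \<open>p\<close>, contributes just the point \<open>p\<close>. By periodicity it makes no difference
  that \<open>\<theta>\<close> is not confined to \<open>[0, 2 pi)\<close>.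
\<close>

definition kippenhahn_curve :: "complex mat \<Rightarrow> complex set" where
  "kippenhahn_curve M =
     {w. \<exists>(\<theta>::real) (\<mu> :: real \<Rightarrow> real).
           (\<forall>\<^sub>F t in nhds \<theta>. eigenvalue (hermitian_part (cis (- t) \<cdot>\<^sub>m M)) (complex_of_real (\<mu> t))) \<and>
           Re (cis (- \<theta>) * w) = \<mu> \<theta> \<and>
           ((\<lambda>t. Re (cis (- t) * w) - \<mu> t) has_real_derivative 0) (at \<theta>)}"

text \<open>
  \<open>ellipse f\<^sub>1 f\<^sub>2 a b\<close> is the ellipse (as a curve) with foci \<open>f\<^sub>1, f\<^sub>2\<close> and full axis lengths \<open>a\<close> (major)
  and \<open>b\<close> (minor). These data belong to an ellipse only if \<open>a\<^sup>2 = b\<^sup>2 + |f\<^sub>1 - f\<^sub>2|\<^sup>2\<close>; otherwise the set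
  is empty. A degenerate ellipse consists of its two foci only, not of the segment between them.
\<close>

definition ellipse :: "complex \<Rightarrow> complex \<Rightarrow> real \<Rightarrow> real \<Rightarrow> complex set" where
  "ellipse f\<^sub>1 f\<^sub>2 a b =
     {w. 0 \<le> a \<and> 0 \<le> b \<and> a\<^sup>2 = b\<^sup>2 + (cmod (f\<^sub>1 - f\<^sub>2))\<^sup>2 \<and>
         (if b = 0 then w \<in> {f\<^sub>1, f\<^sub>2} else cmod (w - f\<^sub>1) + cmod (w - f\<^sub>2) = a)}"

end

theory Submission
  imports Defs "HOL-Analysis.Convex_Euclidean_Space"
begin

text \<open>
  Let \<open>s = n - r\<close>. The off-diagonal block \<open>B\<close> of \<open>e A + (e A)\<^sup>*\<close> satisfies
  \<open>B\<^sup>* B = |e|\<^sup>2 H + 2 Re (e\<^sup>2 Z)\<close>, which is diagonal in the basis given by \<open>U\<close>. Although \<open>A\<close> need not be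
  unitarily equivalent to a direct sum of \<open>2 \<times> 2\<close> matrices, its Hermitian parts therefore have the
  eigenvalues of such a sum: differentiable branches whose envelopes are the ellipses. Completing the
  square gives the inclusion of \<open>\<Lambda>\<^sub>k(A)\<close> in the intersection of convex hulls.

  Conversely let \<open>w \<noteq> \<alpha>\<close> lie in this intersection and put \<open>e = \<i> / (\<alpha> - w)\<close>. A congruence turns
  \<open>e (A - w)\<close> into a direct sum of \<open>2 \<times> 2\<close> forms. The slopes of the half-planes that separate the
  \<open>j\<close>-th ellipse from \<open>w\<close> form an interval \<open>(a\<^sub>j, b\<^sub>j)\<close>, in whose end points the \<open>j\<close>-th form is
  diagonal with entries proportional to \<open>-(1 + \<i> a\<^sub>j)\<close> and \<open>1 + \<i> b\<^sub>j\<close>. At most \<open>s - k\<close> of the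
  intervals overlap, so they can be coloured with \<open>s - k\<close> colours. In a colour class
  \<open>a\<^sub>1 < b\<^sub>1 \<le> a\<^sub>2 < \<dots> < b\<^sub>q\<close> the divided difference at \<open>b\<^sub>1, a\<^sub>2, b\<^sub>2, \<dots>, a\<^sub>q, b\<^sub>q\<close> annihilates all
  polynomials of degree at most \<open>2 q - 3\<close>, and its weights alternate in sign; hence the polynomials of
  degree at most \<open>q - 2\<close> yield a \<open>(q - 1)\<close>-dimensional subspace on which the form vanishes. Together
  these subspaces have dimension at least \<open>k\<close>.
\<close>

text \<open>That w belongs to the rank-k numerical range only requires the form of A - w to vanish
  on some k-dimensional subspace, since an orthonormal basis can be chosen afterwards. This
  condition survives every congruence, whereas unitary similarity need not split A. The congruence
  eliminates the lower left block against the upper left one, which is why w \<noteq> \<alpha> is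
  required; the factor e turns the upper left block into \<i> times the identity.

  A single block has no isotropic vector when w lies outside the hull of its ellipse, so vectors
  must be spread over several blocks. Of the 2 q end points of a chain, 2 q - 1 are used: a product
  of two polynomials of degree at most q - 2, times the factor 1 + \<i> x of the diagonal entries,
  has degree at most 2 q - 3, just what a divided difference at 2 q - 1 nodes annihilates. Its
  weight at a node is the reciprocal of the product of the differences to the other nodes, so the
  signs alternate like those at right and left end points. Each chain loses one dimension, and s - k
  chains leave k out of s.\<close>

hide_const (open) Finite_Cartesian_Product.vec Finite_Cartesian_Product.mat
hide_type (open) Finite_Cartesian_Product.vec
unbundle no vec_syntax

section \<open>Ellipses and their support functions\<close>

text \<open>Support function of the centred ellipse: the maximum of Re (e * w) over it, for an
  arbitrary complex e. F is the square of half the vector between the foci, and K is the sum of the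
  squared semi-axes (K + |F|) / 2 and (K - |F|) / 2. The squared support function is a real
  quadratic form in e, the shape in which the eigenvalues will produce it.\<close>

definition ellipse_support :: "real \<Rightarrow> complex \<Rightarrow> complex \<Rightarrow> real" where
  "ellipse_support K F e = sqrt ((K * (cmod e)\<^sup>2 + Re (e\<^sup>2 * F)) / 2)"

lemma Re_sq: "(Re u)\<^sup>2 = ((cmod u)\<^sup>2 + Re (u\<^sup>2)) / 2"
  unfolding cmod_power2 by (simp add: power2_eq_square)

text \<open>Parallelogram law together with |w - f| |w + f| = |w^2 - f^2|. The foci enter only
  through f^2, so the choice of the square root is immaterial.\<close>

lemma sum_focal_distances_sq:
  fixes w f :: complex
  shows "(cmod (w - f) + cmod (w + f))\<^sup>2 = 2 * (cmod w)\<^sup>2 + 2 * (cmod f)\<^sup>2 + 2 * cmod (w\<^sup>2 - f\<^sup>2)"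
proof -
  have "cmod (w - f) * cmod (w + f) = cmod (w\<^sup>2 - f\<^sup>2)"
    by (simp add: norm_mult[symmetric] power2_eq_square algebra_simps)
  moreover have "(cmod (w - f))\<^sup>2 + (cmod (w + f))\<^sup>2 = 2 * (cmod w)\<^sup>2 + 2 * (cmod f)\<^sup>2"
    unfolding cmod_power2 by (simp add: power2_eq_square algebra_simps)
  ultimately show ?thesis by (simp add: power2_sum)
qed

context
  fixes K :: real and F f c :: complex
  assumes FK: "cmod F \<le> K" and fF: "f\<^sup>2 = F"
begin

abbreviation "Ell \<equiv> ellipse (c + f) (c - f) (sqrt (2 * K + 2 * cmod F)) (sqrt (2 * K - 2 * cmod F))"

lemma norm_f_sq: "(cmod f)\<^sup>2 = cmod F"
  using fF by (metis norm_power)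

lemma K_nonneg: "0 \<le> K"
  using FK norm_ge_zero order_trans by blast

lemma ellipse_compatible: "(sqrt (2 * K + 2 * cmod F))\<^sup>2 = (sqrt (2 * K - 2 * cmod F))\<^sup>2 + (cmod (c + f - (c - f)))\<^sup>2"
proof -
  have "(cmod (c + f - (c - f)))\<^sup>2 = 4 * cmod F"
    using norm_f_sq by (simp add: norm_mult power_mult_distrib flip: mult_2)
  then show ?thesis using FK K_nonneg by simp
qed

lemma degenerate_ellipse_eq:
  assumes "cmod F = K"
  shows "Ell = {c + f, c - f}"
  using ellipse_compatible assms unfolding ellipse_def by auto

text \<open>Squaring the focal condition removes the square roots. For |F| = K the same equation
  would describe the whole segment between the foci, while the degenerate curve consists of the foci
  alone; only the implication \<open>mem_ellipse_imp\<close> covers both cases.\<close>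

lemma mem_ellipse_nondegenerate:
  assumes "cmod F < K"
  shows "w \<in> Ell \<longleftrightarrow> cmod ((w - c)\<^sup>2 - F) = K - (cmod (w - c))\<^sup>2"
proof -
  have nz: "sqrt (2 * K - 2 * cmod F) \<noteq> 0" using assms by simp
  have "w \<in> Ell \<longleftrightarrow> cmod (w - c - f) + cmod (w - c + f) = sqrt (2 * K + 2 * cmod F)"
    unfolding ellipse_def using ellipse_compatible nz assms K_nonneg FK
    by (simp add: diff_diff_eq algebra_simps)
  also have "\<dots> \<longleftrightarrow> (cmod (w - c - f) + cmod (w - c + f))\<^sup>2 = 2 * K + 2 * cmod F"
    using K_nonneg by (subst power2_eq_iff_nonneg[symmetric]) auto
  also have "\<dots> \<longleftrightarrow> cmod ((w - c)\<^sup>2 - F) = K - (cmod (w - c))\<^sup>2"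
    unfolding sum_focal_distances_sq norm_f_sq fF by auto
  finally show ?thesis .
qed

lemma support_radicand: "\<bar>Re (e\<^sup>2 * F)\<bar> \<le> K * (cmod e)\<^sup>2"
proof -
  have "\<bar>Re (e\<^sup>2 * F)\<bar> \<le> cmod (e\<^sup>2 * F)" by (rule abs_Re_le_cmod)
  also have "\<dots> = (cmod e)\<^sup>2 * cmod F" by (simp add: norm_mult norm_power)
  also have "\<dots> \<le> K * (cmod e)\<^sup>2" using FK by (simp add: mult_right_mono mult.commute)
  finally show ?thesis .
qed

lemma ellipse_support_sq: "(ellipse_support K F e)\<^sup>2 = (K * (cmod e)\<^sup>2 + Re (e\<^sup>2 * F)) / 2"
  unfolding ellipse_support_def using support_radicand[of e] by simp

lemma mem_ellipse_imp: "w \<in> Ell \<Longrightarrow> cmod ((w - c)\<^sup>2 - F) = K - (cmod (w - c))\<^sup>2"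
proof (cases "cmod F = K")
  case True
  assume "w \<in> Ell"
  then have "w - c = f \<or> w - c = - f" using degenerate_ellipse_eq[OF True] by auto
  then have "(w - c)\<^sup>2 = F" "(cmod (w - c))\<^sup>2 = K" using fF norm_f_sq True by auto
  then show ?thesis by simp
next
  case False
  then show "w \<in> Ell \<Longrightarrow> ?thesis" using mem_ellipse_nondegenerate FK by simp
qed

lemma ellipse_below_support:
  assumes "w \<in> Ell"
  shows "Re (e * (w - c)) \<le> ellipse_support K F e"
proof -
  have "(Re (e * (w - c)))\<^sup>2 = ((cmod e)\<^sup>2 * (cmod (w - c))\<^sup>2 + Re (e\<^sup>2 * (w - c)\<^sup>2)) / 2"
    by (simp only: Re_sq norm_mult power_mult_distrib)
  moreover have "Re (e\<^sup>2 * ((w - c)\<^sup>2 - F)) \<le> (cmod e)\<^sup>2 * (K - (cmod (w - c))\<^sup>2)"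
    using complex_Re_le_cmod[of "e\<^sup>2 * ((w - c)\<^sup>2 - F)"] mem_ellipse_imp[OF assms]
    by (simp add: norm_mult norm_power)
  ultimately have "(Re (e * (w - c)))\<^sup>2 \<le> (K * (cmod e)\<^sup>2 + Re (e\<^sup>2 * F)) / 2"
    by (simp add: algebra_simps)
  then show ?thesis unfolding ellipse_support_def by (rule real_le_rsqrt)
qed

lemma ellipse_support_nonneg: "ellipse_support K F e \<ge> 0"
proof -
  have "\<bar>x\<bar> \<le> y \<Longrightarrow> 0 \<le> (y + x) / 2" for x y :: real by simp
  then show ?thesis unfolding ellipse_support_def using support_radicand[of e] by (intro real_sqrt_ge_zero)
qed

text \<open>Classical parametrisation of an envelope: in the frame turned by e =
  \<open>cis (- \<theta>)\<close> the point of contact has as coordinates p and the derivative of p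
  with respect to \<theta>. As p^2 = (K + Re (e^2 F)) / 2, this derivative is Im (e^2 F) / (2
  p).\<close>

lemma tangent_point_mem_ellipse:
  assumes nd: "cmod F < K" and e: "cmod e = 1"
  defines "p \<equiv> ellipse_support K F e"
  shows "p > 0" and "c + Complex p (Im (e\<^sup>2 * F) / (2 * p)) / e \<in> Ell"
proof -
  define G where "G = e\<^sup>2 * F"
  define q where "q = Im G / (2 * p)"
  have nG: "cmod G = cmod F" unfolding G_def using e by (simp add: norm_mult norm_power)
  have p2: "p\<^sup>2 = (K + Re G) / 2" unfolding p_def ellipse_support_sq G_def using e by simp
  have KG: "K + Re G > 0" using abs_Re_le_cmod[of G] nG nd by linarith
  have "p \<ge> 0" unfolding p_def by (rule ellipse_support_nonneg)
  moreover have "p \<noteq> 0" using p2 KG by auto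
  ultimately show p0: "p > 0" by simp
  have pq: "2 * p * q = Im G" unfolding q_def using p0 by simp
  have "q\<^sup>2 \<le> K - p\<^sup>2"
  proof -
    have "q\<^sup>2 * (4 * p\<^sup>2) = (Im G)\<^sup>2" unfolding pq[symmetric] by (simp add: power_mult_distrib)
    also have "\<dots> = (cmod G)\<^sup>2 - (Re G)\<^sup>2" by (simp add: cmod_power2)
    also have "\<dots> \<le> K\<^sup>2 - (Re G)\<^sup>2" using nG nd by (simp add: power_mono)
    also have "\<dots> = (K - p\<^sup>2) * (4 * p\<^sup>2)" unfolding p2 by (simp add: power2_eq_square field_simps)
    finally show ?thesis using p0 by (simp add: mult_le_cancel_right)
  qed
  define u where "u = Complex p q"
  \<comment> \<open>The choice of q makes the imaginary part vanish and that of p gives the real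
    part, so the equation of the ellipse reduces to the sign of K - p^2 - q^2.\<close>
  have u2: "u\<^sup>2 - G = of_real (K - p\<^sup>2 - q\<^sup>2)"
  proof (rule complex_eqI)
    show "Re (u\<^sup>2 - G) = Re (of_real (K - p\<^sup>2 - q\<^sup>2))"
      unfolding u_def using p2 by (simp add: power2_eq_square algebra_simps)
    show "Im (u\<^sup>2 - G) = Im (of_real (K - p\<^sup>2 - q\<^sup>2))"
      unfolding u_def using pq by (simp add: power2_eq_square algebra_simps)
  qed
  define w where "w = c + u / e"
  have e0: "e \<noteq> 0" using e by auto
  have "cmod ((w - c)\<^sup>2 - F) = cmod (e\<^sup>2 * ((w - c)\<^sup>2 - F))" using e by (simp add: norm_mult norm_power)
  also have "e\<^sup>2 * ((w - c)\<^sup>2 - F) = u\<^sup>2 - G"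
    unfolding w_def G_def using e0 by (simp add: field_simps)
  also have "cmod \<dots> = K - p\<^sup>2 - q\<^sup>2" unfolding u2 using \<open>q\<^sup>2 \<le> K - p\<^sup>2\<close> by (simp only: norm_of_real)
  also have "\<dots> = K - (cmod (w - c))\<^sup>2" unfolding w_def u_def using e by (simp add: norm_divide cmod_power2)
  finally have "w \<in> Ell" using mem_ellipse_nondegenerate[OF nd] by simp
  then show "c + Complex p (Im (e\<^sup>2 * F) / (2 * p)) / e \<in> Ell" unfolding w_def u_def q_def G_def .
qed

lemma degenerate_support_sq: "cmod F = K \<Longrightarrow> (ellipse_support K F e)\<^sup>2 = (Re (e * f))\<^sup>2"
  unfolding ellipse_support_sq Re_sq using norm_f_sq fF
  by (simp add: norm_mult power_mult_distrib algebra_simps)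

lemma ellipse_support_attained_unit:
  assumes e: "cmod e = 1"
  shows "\<exists>w \<in> Ell. Re (e * (w - c)) = ellipse_support K F e"
proof (cases "cmod F = K")
  case True
  have "Re (e * f) = ellipse_support K F e \<or> Re (e * (-f)) = ellipse_support K F e"
    using degenerate_support_sq[OF True, of e] unfolding power2_eq_iff by auto
  then show ?thesis unfolding degenerate_ellipse_eq[OF True] by auto
next
  case False
  then have nd: "cmod F < K" using FK by simp
  have "e \<noteq> 0" using e by auto
  then show ?thesis using tangent_point_mem_ellipse(2)[OF nd e] by (intro bexI) auto
qed

lemma ellipse_support_scale: "ellipse_support K F (of_real t * e) = \<bar>t\<bar> * ellipse_support K F e"
proof -
  have "(K * (cmod (of_real t * e))\<^sup>2 + Re ((of_real t * e)\<^sup>2 * F)) / 2 = t\<^sup>2 * ((K * (cmod e)\<^sup>2 + Re (e\<^sup>2 * F)) / 2)"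
    by (simp add: norm_mult power_mult_distrib mult.assoc distrib_left flip: of_real_power)
  then show ?thesis unfolding ellipse_support_def by (simp only: real_sqrt_mult real_sqrt_abs)
qed

lemma ellipse_support_attained: "\<exists>w \<in> Ell. Re (e * (w - c)) = ellipse_support K F e"
proof (cases "e = 0")
  case True
  obtain w where "w \<in> Ell" using ellipse_support_attained_unit[of 1] by auto
  then show ?thesis using True by (auto simp: ellipse_support_def)
next
  case False
  define t where "t = cmod e"
  have t: "t > 0" using False t_def by simp
  have e: "e = of_real t * (e / of_real t)" using t by simp
  obtain w where w: "w \<in> Ell" "Re ((e / of_real t) * (w - c)) = ellipse_support K F (e / of_real t)"
    using ellipse_support_attained_unit[of "e / of_real t"] t t_def by (auto simp: norm_divide)
  have "Re (e * (w - c)) = t * Re ((e / of_real t) * (w - c))"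
    using t by (simp add: field_simps)
  also have "\<dots> = ellipse_support K F e"
    using w(2) t by (subst (2) e) (simp only: ellipse_support_scale abs_of_pos)
  finally show ?thesis using w(1) by blast
qed

lemma compact_ellipse: "compact Ell"
proof (cases "cmod F = K")
  case True
  show ?thesis unfolding degenerate_ellipse_eq[OF True] by simp
next
  case False
  then have "Ell = {w. cmod ((w - c)\<^sup>2 - F) = K - (cmod (w - c))\<^sup>2}"
    using mem_ellipse_nondegenerate FK by auto
  moreover have "closed {w. cmod ((w - c)\<^sup>2 - F) = K - (cmod (w - c))\<^sup>2}"
    by (intro closed_Collect_eq continuous_intros)
  moreover have "bounded Ell"
  proof (rule boundedI)
    fix w assume "w \<in> Ell"
    then have "(cmod (w - c))\<^sup>2 \<le> K" using mem_ellipse_imp[of w] norm_ge_zero[of "(w - c)\<^sup>2 - F"] by linarith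
    then have "cmod (w - c) \<le> sqrt K" by (rule real_le_rsqrt)
    then show "cmod w \<le> sqrt K + cmod c" using norm_triangle_ineq[of "w - c" c] by simp
  qed
  ultimately show ?thesis by (simp add: compact_eq_bounded_closed)
qed

end

text \<open>The support function of the hull of a finite union is the maximum of the support
  functions, and a compact convex set is the intersection of its supporting half-planes. Letting e
  range over all complex numbers avoids normalising directions; e = 0 imposes no condition.\<close>

lemma mem_convex_hull_ellipses:
  fixes K :: "'a \<Rightarrow> real" and F f :: "'a \<Rightarrow> complex" and c :: complex
  assumes fin: "finite J" "J \<noteq> {}"
    and FK: "\<And>j. j \<in> J \<Longrightarrow> cmod (F j) \<le> K j" and fF: "\<And>j. j \<in> J \<Longrightarrow> (f j)\<^sup>2 = F j"
  defines "E \<equiv> \<lambda>j. ellipse (c + f j) (c - f j) (sqrt (2 * K j + 2 * cmod (F j))) (sqrt (2 * K j - 2 * cmod (F j)))"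
  shows "w \<in> convex hull (\<Union>j\<in>J. E j) \<longleftrightarrow> (\<forall>e. \<exists>j\<in>J. Re (e * (w - c)) \<le> ellipse_support (K j) (F j) e)"
proof
  assume w: "w \<in> convex hull (\<Union>j\<in>J. E j)"
  show "\<forall>e. \<exists>j\<in>J. Re (e * (w - c)) \<le> ellipse_support (K j) (F j) e"
  proof
    fix e
    define M where "M = Max ((\<lambda>j. ellipse_support (K j) (F j) e) ` J)"
    have "convex {x. Re (e * (x - c)) \<le> M}"
    proof -
      have "{x. Re (e * (x - c)) \<le> M} = {x. inner (cnj e) x \<le> M + Re (e * c)}"
        by (auto simp: inner_complex_def algebra_simps)
      then show ?thesis by (simp only: convex_halfspace_le)
    qed
    moreover have "(\<Union>j\<in>J. E j) \<subseteq> {x. Re (e * (x - c)) \<le> M}"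
    proof safe
      fix j x assume j: "j \<in> J" "x \<in> E j"
      then have "Re (e * (x - c)) \<le> ellipse_support (K j) (F j) e"
        using ellipse_below_support[OF FK fF] unfolding E_def by blast
      also have "\<dots> \<le> M" unfolding M_def using fin j by simp
      finally show "Re (e * (x - c)) \<le> M" .
    qed
    ultimately have "Re (e * (w - c)) \<le> M" using w hull_minimal[of "\<Union>j\<in>J. E j" _ convex] by blast
    moreover have "M \<in> (\<lambda>j. ellipse_support (K j) (F j) e) ` J" unfolding M_def using fin by (intro Max_in) auto
    ultimately show "\<exists>j\<in>J. Re (e * (w - c)) \<le> ellipse_support (K j) (F j) e" by auto
  qed
next
  assume *: "\<forall>e. \<exists>j\<in>J. Re (e * (w - c)) \<le> ellipse_support (K j) (F j) e"
  show "w \<in> convex hull (\<Union>j\<in>J. E j)"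
  proof (rule ccontr)
    assume nin: "w \<notin> convex hull (\<Union>j\<in>J. E j)"
    have "compact (\<Union>j\<in>J. E j)"
      unfolding E_def using fin compact_ellipse[OF FK fF] by (intro compact_UN) auto
    then have "closed (convex hull (\<Union>j\<in>J. E j))" by (intro compact_imp_closed compact_convex_hull)
    then obtain a b where ab: "inner a w < b" "\<And>x. x \<in> convex hull (\<Union>j\<in>J. E j) \<Longrightarrow> inner a x > b"
      using separating_hyperplane_closed_point[OF convex_convex_hull _ nin] by blast
    \<comment> \<open>\<open>inner a x\<close> is Re (cnj a * x) and is larger on the hull than at
      w, so the violated direction is e = - cnj a.\<close>
    obtain j where j: "j \<in> J" "Re (- cnj a * (w - c)) \<le> ellipse_support (K j) (F j) (- cnj a)" using * by blast
    obtain x where x: "x \<in> E j" "Re (- cnj a * (x - c)) = ellipse_support (K j) (F j) (- cnj a)"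
      using ellipse_support_attained[OF FK fF] j(1) unfolding E_def by blast
    have "x \<in> convex hull (\<Union>j\<in>J. E j)" using x j by (meson UN_I hull_inc)
    then have "inner a x > inner a w" using ab by fastforce
    then show False using j(2) x(2) by (simp add: inner_complex_def algebra_simps)
  qed
qed

section \<open>Isotropic families of diagonal forms\<close>

lemma sum_lessThan_add:
  fixes f :: "nat \<Rightarrow> 'b::comm_monoid_add"
  shows "sum f {..<m + n} = sum f {..<m} + (\<Sum>i<n. f (m + i))"
  by (induction n) (auto simp: add.assoc)

text \<open>The functions \<open>\<Phi> i\<close> span a d-dimensional space on which the diagonal
  form with entries \<nu> vanishes. They are real, so that the bilinear and the sesquilinear form
  agree on them, but they are independent over the complex numbers. Vanishing outside S makes
  families on disjoint sets orthogonal to each other.\<close>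

definition isotropic_system :: "('a \<Rightarrow> complex) \<Rightarrow> 'a set \<Rightarrow> nat \<Rightarrow> (nat \<Rightarrow> 'a \<Rightarrow> real) \<Rightarrow> bool" where
  "isotropic_system \<nu> S d \<Phi> \<longleftrightarrow>
     (\<forall>i<d. \<forall>x. x \<notin> S \<longrightarrow> \<Phi> i x = 0) \<and>
     (\<forall>i<d. \<forall>j<d. (\<Sum>x\<in>S. \<nu> x * of_real (\<Phi> i x * \<Phi> j x)) = 0) \<and>
     (\<forall>c :: nat \<Rightarrow> complex. (\<forall>x\<in>S. (\<Sum>i<d. c i * of_real (\<Phi> i x)) = 0) \<longrightarrow> (\<forall>i<d. c i = 0))"

definition isotropic_family :: "('a \<Rightarrow> complex) \<Rightarrow> 'a set \<Rightarrow> nat \<Rightarrow> bool" where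
  "isotropic_family \<nu> S d \<longleftrightarrow> (\<exists>\<Phi>. isotropic_system \<nu> S d \<Phi>)"

lemma isotropic_familyI:
  assumes "\<And>i x. i < d \<Longrightarrow> x \<notin> S \<Longrightarrow> \<Phi> i x = 0"
    and "\<And>i j. i < d \<Longrightarrow> j < d \<Longrightarrow> (\<Sum>x\<in>S. \<nu> x * of_real (\<Phi> i x * \<Phi> j x)) = 0"
    and "\<And>(c :: nat \<Rightarrow> complex) i. (\<And>x. x \<in> S \<Longrightarrow> (\<Sum>i<d. c i * of_real (\<Phi> i x)) = 0) \<Longrightarrow> i < d \<Longrightarrow> c i = 0"
  shows "isotropic_family \<nu> S d"
  unfolding isotropic_family_def isotropic_system_def
  using assms by (intro exI[of _ \<Phi>] conjI allI impI) blast+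

lemma isotropic_systemD:
  assumes "isotropic_system \<nu> S d \<Phi>"
  shows "\<And>i x. i < d \<Longrightarrow> x \<notin> S \<Longrightarrow> \<Phi> i x = 0"
    and "\<And>i j. i < d \<Longrightarrow> j < d \<Longrightarrow> (\<Sum>x\<in>S. \<nu> x * of_real (\<Phi> i x * \<Phi> j x)) = 0"
    and "\<And>(c :: nat \<Rightarrow> complex) i. (\<And>x. x \<in> S \<Longrightarrow> (\<Sum>i<d. c i * of_real (\<Phi> i x)) = 0) \<Longrightarrow> i < d \<Longrightarrow> c i = 0"
  using assms unfolding isotropic_system_def by (simp, simp, blast)

lemma isotropic_family_0: "isotropic_family \<nu> S 0"
  unfolding isotropic_family_def isotropic_system_def by auto

lemma isotropic_family_less:
  assumes "isotropic_family \<nu> S d" "d' \<le> d"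
  shows "isotropic_family \<nu> S d'"
proof -
  obtain \<Phi> where "isotropic_system \<nu> S d \<Phi>" using assms(1) unfolding isotropic_family_def by blast
  note P = isotropic_systemD[OF this]
  show ?thesis
  proof (rule isotropic_familyI[of _ _ \<Phi>])
    fix c :: "nat \<Rightarrow> complex" and i
    assume c: "\<And>x. x \<in> S \<Longrightarrow> (\<Sum>i<d'. c i * of_real (\<Phi> i x)) = 0" and i: "i < d'"
    define c' where "c' = (\<lambda>i. if i < d' then c i else 0)"
    have "(\<Sum>i<d. c' i * of_real (\<Phi> i x)) = (\<Sum>i<d'. c i * of_real (\<Phi> i x))" for x
      using assms(2) by (intro sum.mono_neutral_cong_right) (auto simp: c'_def)
    then have "c' i = 0" using c i assms(2) P(3)[of c' i] by auto
    then show "c i = 0" using i unfolding c'_def by simp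
  next
    fix i j assume "i < d'" "j < d'"
    then show "(\<Sum>x\<in>S. \<nu> x * of_real (\<Phi> i x * \<Phi> j x)) = 0" using assms(2) by (intro P(2)) auto
  next
    fix i x assume "i < d'" "x \<notin> S"
    then show "\<Phi> i x = 0" using assms(2) by (intro P(1)) auto
  qed
qed

lemma isotropic_family_superset:
  assumes "isotropic_family \<nu> S d" "S \<subseteq> S'" "finite S'"
  shows "isotropic_family \<nu> S' d"
proof -
  obtain \<Phi> where "isotropic_system \<nu> S d \<Phi>" using assms(1) unfolding isotropic_family_def by blast
  note P = isotropic_systemD[OF this]
  show ?thesis
  proof (rule isotropic_familyI[of _ _ \<Phi>])
    fix i j assume ij: "i < d" "j < d"
    have "(\<Sum>x\<in>S'. \<nu> x * of_real (\<Phi> i x * \<Phi> j x)) = (\<Sum>x\<in>S. \<nu> x * of_real (\<Phi> i x * \<Phi> j x))"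
      using assms P(1) ij by (intro sum.mono_neutral_right) auto
    then show "(\<Sum>x\<in>S'. \<nu> x * of_real (\<Phi> i x * \<Phi> j x)) = 0" using P(2) ij by simp
  next
    fix c :: "nat \<Rightarrow> complex" and i
    assume "\<And>x. x \<in> S' \<Longrightarrow> (\<Sum>i<d. c i * of_real (\<Phi> i x)) = 0" "i < d"
    then show "c i = 0" using assms(2) P(3)[of c i] by blast
  next
    fix i x assume "i < d" "x \<notin> S'"
    then show "\<Phi> i x = 0" using assms(2) by (intro P(1)) auto
  qed
qed

lemma isotropic_family_Un:
  assumes 1: "isotropic_family \<nu> S d" and 2: "isotropic_family \<nu> S' d'" and dj: "S \<inter> S' = {}"
    and fin: "finite S" "finite S'"
  shows "isotropic_family \<nu> (S \<union> S') (d + d')"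
proof -
  obtain \<Phi> where "isotropic_system \<nu> S d \<Phi>" using 1 unfolding isotropic_family_def by blast
  note P = isotropic_systemD[OF this]
  obtain \<Psi> where "isotropic_system \<nu> S' d' \<Psi>" using 2 unfolding isotropic_family_def by blast
  note Q = isotropic_systemD[OF this]
  define \<Theta> where "\<Theta> = (\<lambda>i. if i < d then \<Phi> i else \<Psi> (i - d))"
  have T1: "\<Theta> i x = (if i < d then \<Phi> i x else 0)" if "x \<in> S" "i < d + d'" for i x
  proof -
    have "x \<notin> S'" "i - d < d' \<or> i < d" using that dj by auto
    then show ?thesis using Q(1)[of "i - d" x] unfolding \<Theta>_def by auto
  qed
  have T2: "\<Theta> i x = (if i < d then 0 else \<Psi> (i - d) x)" if "x \<in> S'" "i < d + d'" for i x
  proof -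
    have "x \<notin> S" using that dj by auto
    then show ?thesis using P(1)[of i x] unfolding \<Theta>_def by auto
  qed
  show ?thesis
  proof (rule isotropic_familyI[of _ _ \<Theta>])
    fix i x assume "i < d + d'" "x \<notin> S \<union> S'"
    then show "\<Theta> i x = 0" unfolding \<Theta>_def using P(1) Q(1)[of "i - d"] by auto
  next
    fix i j assume ij: "i < d + d'" "j < d + d'"
    have "(\<Sum>x\<in>S. \<nu> x * of_real (\<Theta> i x * \<Theta> j x)) = 0"
      using ij P(2)[of i j] by (cases "i < d \<and> j < d") (auto simp: T1 cong: sum.cong)
    moreover have "(\<Sum>x\<in>S'. \<nu> x * of_real (\<Theta> i x * \<Theta> j x)) = 0"
      using ij Q(2)[of "i - d" "j - d"] by (cases "i < d \<or> j < d") (auto simp: T2 cong: sum.cong)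
    ultimately show "(\<Sum>x\<in>S \<union> S'. \<nu> x * of_real (\<Theta> i x * \<Theta> j x)) = 0"
      using fin dj by (simp add: sum.union_disjoint)
  next
    fix c :: "nat \<Rightarrow> complex" and i
    assume c: "\<And>x. x \<in> S \<union> S' \<Longrightarrow> (\<Sum>i<d + d'. c i * of_real (\<Theta> i x)) = 0" and i: "i < d + d'"
    have 1: "c i = 0" if "i < d" for i
    proof (rule P(3)[OF _ that])
      fix x assume "x \<in> S"
      then show "(\<Sum>i<d. c i * of_real (\<Phi> i x)) = 0"
        using c[of x] by (simp add: sum_lessThan_add T1)
    qed
    have 2: "c (d + i) = 0" if "i < d'" for i
    proof (rule Q(3)[OF _ that, of "\<lambda>i. c (d + i)"])
      fix x assume "x \<in> S'"
      then show "(\<Sum>i<d'. c (d + i) * of_real (\<Psi> i x)) = 0"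
        using c[of x] by (simp add: sum_lessThan_add T2)
    qed
    show "c i = 0" using 1 2[of "i - d"] i by (cases "i < d") auto
  qed
qed

lemma isotropic_family_UN:
  assumes "finite T" "\<And>t. t \<in> T \<Longrightarrow> isotropic_family \<nu> (S t) (d t)" "\<And>t. t \<in> T \<Longrightarrow> finite (S t)"
    and "\<And>t u. t \<in> T \<Longrightarrow> u \<in> T \<Longrightarrow> t \<noteq> u \<Longrightarrow> S t \<inter> S u = {}"
  shows "isotropic_family \<nu> (\<Union>t\<in>T. S t) (\<Sum>t\<in>T. d t)"
  using assms
proof (induction T rule: finite_induct)
  case empty
  then show ?case by (simp add: isotropic_family_0)
next
  case (insert t T)
  have "isotropic_family \<nu> (S t \<union> (\<Union>t\<in>T. S t)) (d t + (\<Sum>t\<in>T. d t))"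
  proof (rule isotropic_family_Un)
    show "S t \<inter> (\<Union>t\<in>T. S t) = {}" using insert.prems(3) insert.hyps(2) by fastforce
  qed (use insert in auto)
  then show ?case using insert.hyps by simp
qed

lemma isotropic_family_null:
  assumes "finite S" "\<And>x. x \<in> S \<Longrightarrow> \<nu> x = 0"
  shows "isotropic_family \<nu> S (card S)"
proof -
  have "isotropic_family \<nu> {x} 1" if "x \<in> S" for x
    by (rule isotropic_familyI[of _ _ "\<lambda>_ y. if y = x then 1 else 0"]) (use assms that in auto)
  from isotropic_family_UN[of S \<nu> "\<lambda>x. {x}" "\<lambda>_. 1", OF assms(1) this] show ?thesis by simp
qed

lemma isotropic_family_reindex:
  assumes "isotropic_family (\<nu> \<circ> \<pi>) S d" "inj_on \<pi> S"
  shows "isotropic_family \<nu> (\<pi> ` S) d"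
proof -
  obtain \<Phi> where "isotropic_system (\<nu> \<circ> \<pi>) S d \<Phi>" using assms(1) unfolding isotropic_family_def by blast
  note P = isotropic_systemD[OF this]
  define \<Psi> where "\<Psi> = (\<lambda>i y. if y \<in> \<pi> ` S then \<Phi> i (the_inv_into S \<pi> y) else 0)"
  have \<Psi>: "\<Psi> i (\<pi> x) = \<Phi> i x" if "x \<in> S" for i x
    using that assms(2) unfolding \<Psi>_def by (simp add: the_inv_into_f_f)
  show ?thesis
  proof (rule isotropic_familyI[of _ _ \<Psi>])
    fix i j assume "i < d" "j < d"
    then show "(\<Sum>x\<in>\<pi> ` S. \<nu> x * of_real (\<Psi> i x * \<Psi> j x)) = 0"
      using P(2)[of i j] assms(2) by (simp add: sum.reindex \<Psi> cong: sum.cong)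
  next
    fix c :: "nat \<Rightarrow> complex" and i
    assume c: "\<And>x. x \<in> \<pi> ` S \<Longrightarrow> (\<Sum>i<d. c i * of_real (\<Psi> i x)) = 0" and i: "i < d"
    show "c i = 0"
    proof (rule P(3)[OF _ i])
      fix x assume "x \<in> S"
      then show "(\<Sum>i<d. c i * of_real (\<Phi> i x)) = 0" using c[of "\<pi> x"] by (simp add: \<Psi>)
    qed
  qed (auto simp: \<Psi>_def)
qed

section \<open>Divided differences and alternating weights\<close>

text \<open>Lagrange interpolation at N nodes reproduces the monomial of degree l < N. Comparing the
  coefficients of degree N - 1 yields the sum on one side and, because l < N - 1, zero on the
  other.\<close>

lemma divided_difference_power:
  fixes x :: "nat \<Rightarrow> real"
  assumes inj: "inj_on x {..<N}" and l: "l + 2 \<le> N"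
  shows "(\<Sum>i<N. x i ^ l / (\<Prod>j\<in>{..<N} - {i}. x i - x j)) = 0"
proof -
  define L where "L = (\<lambda>i. \<Prod>j\<in>{..<N} - {i}. [:- x j, 1:])"
  define w where "w = (\<lambda>i. \<Prod>j\<in>{..<N} - {i}. x i - x j)"
  define q where "q = (\<Sum>i<N. smult (x i ^ l / w i) (L i)) - monom 1 l"
  have dL: "degree (L i) = N - 1" if "i < N" for i
    unfolding L_def using that by (subst degree_prod_eq_sum_degree) auto
  have cL: "coeff (L i) (N - 1) = 1" if "i < N" for i
    using lead_coeff_prod[of "\<lambda>j. [:- x j, 1:]" "{..<N} - {i}"] dL[OF that] unfolding L_def by simp
  have wn: "w i \<noteq> 0" if "i < N" for i
    unfolding w_def using that inj by (auto simp: inj_on_def)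
  have pL: "poly (L i) (x k) = (if i = k then w i else 0)" if "i < N" "k < N" for i k
  proof (cases "i = k")
    case True
    then show ?thesis unfolding L_def w_def by (simp add: poly_prod)
  next
    case False
    then show ?thesis unfolding L_def using that by (auto simp: poly_prod intro!: prod_zero)
  qed
  have root: "poly q (x k) = 0" if "k < N" for k
  proof -
    have "poly q (x k) = (\<Sum>i<N. x i ^ l / w i * (if i = k then w i else 0)) - x k ^ l"
      unfolding q_def using pL[OF _ that] by (simp add: poly_sum poly_monom cong: sum.cong_simp)
    also have "(\<Sum>i<N. x i ^ l / w i * (if i = k then w i else 0)) = (\<Sum>i<N. if i = k then x k ^ l else 0)"
      by (rule sum.cong) (use wn in auto)
    finally show ?thesis using that by simp
  qed
  have "degree q \<le> N - 1"
    unfolding q_def using l dL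
    by (intro degree_diff_le degree_sum_le) (auto intro: order_trans[OF degree_smult_le] order_trans[OF degree_monom_le])
  have "q = 0"
  proof (rule ccontr)
    assume "q \<noteq> 0"
    then have "card {y. poly q y = 0} \<le> degree q" by (rule card_poly_roots_bound)
    moreover have "x ` {..<N} \<subseteq> {y. poly q y = 0}" using root by auto
    moreover have "finite {y. poly q y = 0}" using \<open>q \<noteq> 0\<close> by (rule poly_roots_finite)
    ultimately have "card (x ` {..<N}) \<le> degree q" by (meson card_mono le_trans)
    then show False using inj \<open>degree q \<le> N - 1\<close> l by (simp add: card_image)
  qed
  then have "coeff q (N - 1) = 0" by simp
  moreover have "coeff q (N - 1) = (\<Sum>i<N. x i ^ l / w i)"
  proof -
    have "coeff q (N - 1) = (\<Sum>i<N. x i ^ l / w i * coeff (L i) (N - 1))"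
      unfolding q_def using l by (simp add: coeff_sum)
    also have "\<dots> = (\<Sum>i<N. x i ^ l / w i)" using cL by (intro sum.cong) auto
    finally show ?thesis .
  qed
  ultimately show ?thesis unfolding w_def by simp
qed

text \<open>
  The weights of the divided difference alternate in sign just as \<open>\<nu>\<close> does, so that powers of degree
  less than \<open>d\<close>, scaled by the square roots of the weights, are isotropic.
\<close>

lemma isotropic_family_strict_alternating:
  fixes x c :: "nat \<Rightarrow> real"
  assumes mono: "\<And>i j. i < j \<Longrightarrow> j < 2 * d + 1 \<Longrightarrow> x i < x j"
    and \<nu>: "\<And>i. i < 2 * d + 1 \<Longrightarrow> \<nu> i = of_real (c i * (-1) ^ i) * (1 + \<i> * of_real (x i))"
    and c: "\<And>i. i < 2 * d + 1 \<Longrightarrow> c i > 0"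
  shows "isotropic_family \<nu> {..<2 * d + 1} d"
proof -
  \<comment> \<open>Pairing two powers of degree less than d against the factor 1 + \<i> x gives
    exponents up to 2 d - 1 = N - 2, the last one annihilated by a divided difference at N nodes.
    Since N is odd, \<open>w i\<close> has the sign of (-1)^i.\<close>
  define N where "N = 2 * d + 1"
  have inj: "inj_on x {..<N}"
    using mono unfolding N_def inj_on_def by (metis lessThan_iff linorder_neqE_nat order_less_irrefl)
  define w where "w = (\<lambda>i. 1 / (\<Prod>j\<in>{..<N} - {i}. x i - x j))"
  have sgn_w: "w i * (-1) ^ i > 0" if i: "i < N" for i
  proof -
    have split: "{..<N} - {i} = {..<i} \<union> {i<..<N}" using i by auto
    have "(\<Prod>j\<in>{i<..<N}. x i - x j) = (\<Prod>j\<in>{i<..<N}. (-1) * (x j - x i))" by simp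
    also have "\<dots> = (-1) ^ (N - Suc i) * (\<Prod>j\<in>{i<..<N}. x j - x i)"
      by (simp only: prod.distrib prod_constant card_greaterThanLessThan)
    also have "(-1::real) ^ (N - Suc i) = (-1) ^ i"
      using i unfolding N_def by (simp add: minus_one_power_iff)
    finally have "(\<Prod>j\<in>{..<N} - {i}. x i - x j) = (-1) ^ i * ((\<Prod>j\<in>{i<..<N}. x j - x i) * (\<Prod>j<i. x i - x j))"
      unfolding split by (subst prod.union_disjoint) auto
    moreover have "(\<Prod>j\<in>{i<..<N}. x j - x i) * (\<Prod>j<i. x i - x j) > 0"
      using mono i unfolding N_def by (intro mult_pos_pos prod_pos) auto
    ultimately show ?thesis unfolding w_def by (cases "even i") auto
  qed
  have absw: "(-1) ^ i * \<bar>w i\<bar> = w i" if "i < N" for i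
    using sgn_w[OF that] by (cases "even i") auto
  \<comment> \<open>The square root replaces the factor \<open>c i\<close> by the modulus of
    \<open>w i\<close>. As both carry the sign (-1)^i, the entry \<open>\<nu> i\<close> turns into
    \<open>w i\<close> times 1 + \<i> x.\<close>
  define \<Phi> where "\<Phi> = (\<lambda>l i. if i < N then sqrt (\<bar>w i\<bar> / c i) * x i ^ l else 0)"
  have "isotropic_family \<nu> {..<N} d"
  proof (rule isotropic_familyI[of _ _ \<Phi>])
    fix l m assume lm: "l < d" "m < d"
    have "\<nu> i * of_real (\<Phi> l i * \<Phi> m i) = of_real (x i ^ (l + m) * w i) + \<i> * of_real (x i ^ (l + m + 1) * w i)"
      if i: "i < N" for i
    proof -
      have "\<Phi> l i * \<Phi> m i = (sqrt (\<bar>w i\<bar> / c i))\<^sup>2 * x i ^ (l + m)"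
        unfolding \<Phi>_def using i by (simp add: power_add power2_eq_square algebra_simps)
      also have "\<dots> = \<bar>w i\<bar> / c i * x i ^ (l + m)" using c[of i] i unfolding N_def by simp
      finally have "c i * (-1) ^ i * (\<Phi> l i * \<Phi> m i) = ((-1) ^ i * \<bar>w i\<bar>) * x i ^ (l + m)"
        using c[of i] i unfolding N_def by simp
      then have "of_real (c i * (-1) ^ i) * of_real (\<Phi> l i * \<Phi> m i) = complex_of_real (w i * x i ^ (l + m))"
        unfolding absw[OF i] by (metis of_real_mult)
      moreover have "\<nu> i * of_real (\<Phi> l i * \<Phi> m i) = (of_real (c i * (-1) ^ i) * of_real (\<Phi> l i * \<Phi> m i)) * (1 + \<i> * of_real (x i))"
        using \<nu>[of i] i unfolding N_def by simp
      ultimately show ?thesis by (simp add: algebra_simps)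
    qed
    then have "(\<Sum>i<N. \<nu> i * of_real (\<Phi> l i * \<Phi> m i)) =
        (\<Sum>i<N. of_real (x i ^ (l + m) * w i) + \<i> * of_real (x i ^ (l + m + 1) * w i))"
      by (intro sum.cong) auto
    also have "\<dots> = of_real (\<Sum>i<N. x i ^ (l + m) * w i) + \<i> * of_real (\<Sum>i<N. x i ^ (l + m + 1) * w i)"
      by (simp only: sum.distrib sum_distrib_left of_real_sum)
    also have "\<dots> = 0"
      using divided_difference_power[OF inj, of "l + m"] divided_difference_power[OF inj, of "l + m + 1"] lm
      unfolding w_def N_def by simp
    finally show "(\<Sum>i<N. \<nu> i * of_real (\<Phi> l i * \<Phi> m i)) = 0" .
  next
    fix a :: "nat \<Rightarrow> complex" and l
    assume a: "\<And>i. i \<in> {..<N} \<Longrightarrow> (\<Sum>l<d. a l * of_real (\<Phi> l i)) = 0" and l: "l < d"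
    \<comment> \<open>A linear relation among the vectors is a polynomial of degree less than d that
      vanishes at all N nodes.\<close>
    define p where "p = (\<Sum>l<d. monom (a l) l)"
    have pr: "poly p (of_real (x i)) = 0" if i: "i < N" for i
    proof -
      have s: "sqrt (\<bar>w i\<bar> / c i) \<noteq> 0" using sgn_w[OF i] c[of i] i unfolding N_def by auto
      have "of_real (sqrt (\<bar>w i\<bar> / c i)) * poly p (of_real (x i)) = (\<Sum>l<d. a l * of_real (\<Phi> l i))"
        unfolding p_def \<Phi>_def using i by (simp add: poly_sum poly_monom sum_distrib_left mult_ac)
      then show ?thesis using a[of i] i s by simp
    qed
    have "degree p < d" unfolding p_def using l
      by (intro degree_sum_less) (auto intro: le_less_trans[OF degree_monom_le])
    have "p = 0"
    proof (rule ccontr)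
      assume "p \<noteq> 0"
      then have "card {y. poly p y = 0} \<le> degree p" by (rule card_poly_roots_bound)
      moreover have "(\<lambda>i. complex_of_real (x i)) ` {..<N} \<subseteq> {y. poly p y = 0}" using pr by auto
      moreover have "finite {y. poly p y = 0}" using \<open>p \<noteq> 0\<close> by (rule poly_roots_finite)
      ultimately have "card ((\<lambda>i. complex_of_real (x i)) ` {..<N}) \<le> degree p" by (meson card_mono le_trans)
      moreover have "inj_on (\<lambda>i. complex_of_real (x i)) {..<N}" using inj by (auto simp: inj_on_def)
      ultimately show False using \<open>degree p < d\<close> unfolding N_def by (simp add: card_image)
    qed
    then have "coeff p l = 0" by simp
    then show "a l = 0" unfolding p_def using l by (simp add: coeff_sum)
  qed (auto simp: \<Phi>_def)
  then show ?thesis unfolding N_def .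
qed

text \<open>Adjacent intervals may share an end point, whereas a divided difference needs distinct
  nodes. Deleting a pair of equal neighbours shifts the later indices by two, so the signs keep
  alternating, and lowers d by one; the pair itself supplies the missing vector.\<close>

lemma isotropic_family_alternating:
  fixes x c :: "nat \<Rightarrow> real"
  assumes "\<And>i j. i < j \<Longrightarrow> j < 2 * d + 1 \<Longrightarrow> x i \<le> x j"
    and "\<And>i. i < 2 * d + 1 \<Longrightarrow> \<nu> i = of_real (c i * (-1) ^ i) * (1 + \<i> * of_real (x i))"
    and "\<And>i. i < 2 * d + 1 \<Longrightarrow> c i > 0"
  shows "isotropic_family \<nu> {..<2 * d + 1} d"
  using assms
proof (induction d arbitrary: \<nu> x c)
  case 0
  then show ?case by (simp add: isotropic_family_0)
next
  case (Suc d)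
  show ?case
  proof (cases "\<forall>i<2 * Suc d. x i < x (Suc i)")
    case True
    have "x i < x j" if "i < j" "j < 2 * Suc d + 1" for i j
      using that
    proof (induction j)
      case (Suc j)
      have "j < 2 * Suc d" using Suc.prems by linarith
      then have "x j < x (Suc j)" using True by blast
      then show ?case using Suc.IH Suc.prems by (cases "i = j") auto
    qed simp
    then show ?thesis using Suc.prems by (intro isotropic_family_strict_alternating) auto
  next
    case False
    then obtain i where i: "i < 2 * Suc d" "\<not> x i < x (Suc i)" by blast
    have "x i \<le> x (Suc i)" using Suc.prems(1) i(1) by simp
    with i have i: "i < 2 * Suc d" "x i = x (Suc i)" by auto
    \<comment> \<open>Two equal neighbouring nodes have opposite signs and combine to an isotropic vector of their own.\<close>
    define k where "k = (\<lambda>l. if l < i then l else l + 2)"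
    have IH: "isotropic_family (\<nu> \<circ> k) {..<2 * d + 1} d"
    proof (rule Suc.IH[of "x \<circ> k" _ "c \<circ> k"])
      fix l m assume "l < m" "m < 2 * d + 1"
      then show "(x \<circ> k) l \<le> (x \<circ> k) m" using Suc.prems(1)[of "k l" "k m"] unfolding k_def by auto
    next
      fix l assume l: "l < 2 * d + 1"
      then have "k l < 2 * Suc d + 1" unfolding k_def by auto
      moreover have "(-1::real) ^ k l = (-1) ^ l" unfolding k_def by simp
      ultimately show "(\<nu> \<circ> k) l = of_real ((c \<circ> k) l * (-1) ^ l) * (1 + \<i> * of_real ((x \<circ> k) l))"
        and "(c \<circ> k) l > 0"
        using Suc.prems(2)[of "k l"] Suc.prems(3)[of "k l"] by auto
    qed
    have "inj_on k {..<2 * d + 1}" unfolding k_def inj_on_def by auto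
    with IH have 1: "isotropic_family \<nu> (k ` {..<2 * d + 1}) d" by (rule isotropic_family_reindex)
    have 2: "isotropic_family \<nu> {i, Suc i} 1"
    proof (rule isotropic_familyI[of _ _ "\<lambda>_ l. if l = i \<or> l = Suc i then 1 / sqrt (c l) else 0"])
      have cpos: "c i > 0" "c (Suc i) > 0" using Suc.prems(3) i by auto
      have scale: "complex_of_real (u * v) * y * of_real (1 / sqrt u * (1 / sqrt u)) = of_real v * y"
        if "u > 0" for u v :: real and y :: complex
      proof -
        have "u * v * (1 / sqrt u * (1 / sqrt u)) = v" using that by (simp add: field_simps)
        then show ?thesis by (metis (no_types, opaque_lifting) mult.commute mult.assoc of_real_mult)
      qed
      have "\<nu> i * of_real (1 / sqrt (c i) * (1 / sqrt (c i))) = (-1) ^ i * (1 + \<i> * of_real (x i))"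
        and "\<nu> (Suc i) * of_real (1 / sqrt (c (Suc i)) * (1 / sqrt (c (Suc i)))) = - ((-1) ^ i * (1 + \<i> * of_real (x i)))"
        using Suc.prems(2)[of i] Suc.prems(2)[of "Suc i"] i cpos scale by (simp_all only:) simp_all
      then show "(\<Sum>l\<in>{i, Suc i}. \<nu> l * of_real ((if l = i \<or> l = Suc i then 1 / sqrt (c l) else 0) *
          (if l = i \<or> l = Suc i then 1 / sqrt (c l) else 0))) = 0" by simp
    next
      fix a :: "nat \<Rightarrow> complex" and j :: nat
      assume a: "\<And>l. l \<in> {i, Suc i} \<Longrightarrow> (\<Sum>j<1. a j * of_real (if l = i \<or> l = Suc i then 1 / sqrt (c l) else 0)) = 0" "j < 1"
      have "c i > 0" using Suc.prems(3) i by auto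
      then show "a j = 0" using a(1)[of i] a(2) by simp
    qed auto
    have "k ` {..<2 * d + 1} \<union> {i, Suc i} = {..<2 * Suc d + 1}"
    proof (intro equalityI subsetI)
      fix l assume "l \<in> {..<2 * Suc d + 1}"
      then have "l < i \<or> l = i \<or> l = Suc i \<or> \<not> l - 2 < i \<and> 2 \<le> l \<and> l - 2 < 2 * d + 1" by auto
      moreover have "l \<in> k ` {..<2 * d + 1}" if "l < i"
        using that i(1) by (intro image_eqI[of _ _ l]) (auto simp: k_def)
      moreover have "l \<in> k ` {..<2 * d + 1}" if "\<not> l - 2 < i" "2 \<le> l" "l - 2 < 2 * d + 1"
        using that by (intro image_eqI[of _ _ "l - 2"]) (auto simp: k_def)
      ultimately show "l \<in> k ` {..<2 * d + 1} \<union> {i, Suc i}" by blast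
    qed (use i(1) in \<open>auto simp: k_def\<close>)
    moreover have "isotropic_family \<nu> (k ` {..<2 * d + 1} \<union> {i, Suc i}) (d + 1)"
      using 1 2 by (rule isotropic_family_Un) (auto simp: k_def split: if_splits)
    ultimately show ?thesis by simp
  qed
qed

section \<open>Colouring of intervals and assembly of chains\<close>

text \<open>Greedy colouring by increasing left end points. If every colour were blocked for the new
  interval j, one interval of each colour would start no later than \<open>a j\<close> and end after
  it; together with j these would be m + 1 intervals that contain a common point just to the right
  of \<open>a j\<close>.\<close>

lemma interval_coloring:
  fixes a b :: "'a \<Rightarrow> real"
  assumes "finite I" "\<And>i. i \<in> I \<Longrightarrow> a i < b i"
    and "\<And>x. card {i\<in>I. a i < x \<and> x < b i} \<le> m"
  shows "\<exists>col. (\<forall>i\<in>I. col i < m) \<and> (\<forall>i\<in>I. \<forall>j\<in>I. i \<noteq> j \<and> col i = col j \<longrightarrow> b i \<le> a j \<or> b j \<le> a i)"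
  using assms
proof (induction I rule: finite_ranking_induct[where f = a])
  case empty
  then show ?case by auto
next
  case (insert j S)
  show ?case
  proof (cases "j \<in> S")
    case True
    then show ?thesis using insert by (simp add: insert_absorb)
  next
    case jS: False
    have "\<exists>col. (\<forall>i\<in>S. col i < m) \<and> (\<forall>i\<in>S. \<forall>j\<in>S. i \<noteq> j \<and> col i = col j \<longrightarrow> b i \<le> a j \<or> b j \<le> a i)"
    proof (rule insert.IH)
      fix x
      have "card {i \<in> S. a i < x \<and> x < b i} \<le> card {i \<in> insert j S. a i < x \<and> x < b i}"
        using insert.hyps(1) by (intro card_mono) auto
      then show "card {i \<in> S. a i < x \<and> x < b i} \<le> m" using insert.prems(2)[of x] by linarith
    next
      fix i assume "i \<in> S"
      then show "a i < b i" by (intro insert.prems(1)) simp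
    qed
    then obtain col where col: "\<forall>i\<in>S. col i < m" "\<forall>i\<in>S. \<forall>j\<in>S. i \<noteq> j \<and> col i = col j \<longrightarrow> b i \<le> a j \<or> b j \<le> a i"
      by (elim exE conjE) (rule that)
    have "\<exists>t<m. \<forall>i\<in>S. col i = t \<longrightarrow> b i \<le> a j"
    proof (rule ccontr)
      assume "\<not> ?thesis"
      then have "\<forall>t\<in>{..<m}. \<exists>i. i \<in> S \<and> col i = t \<and> a j < b i" by (simp add: not_le) blast
      then obtain g where "\<forall>t\<in>{..<m}. g t \<in> S \<and> col (g t) = t \<and> a j < b (g t)"
        by (rule bchoice[THEN exE])
      then have g: "g t \<in> S" "col (g t) = t" "a j < b (g t)" if "t < m" for t using that by auto
      define B where "B = insert (b j) ((\<lambda>t. b (g t)) ` {..<m})"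
      have "finite B" "B \<noteq> {}" unfolding B_def by auto
      then have "a j < Min B" unfolding B_def using g(3) insert.prems(1)[of j] by (subst Min_gr_iff) auto
      define x where "x = (a j + Min B) / 2"
      have x: "a j < x" "x < Min B" unfolding x_def using \<open>a j < Min B\<close> by auto
      have xb: "x < y" if "y \<in> B" for y using x(2) Min_le[OF \<open>finite B\<close> that] by simp
      have "insert j (g ` {..<m}) \<subseteq> {i \<in> insert j S. a i < x \<and> x < b i}"
      proof
        fix i assume "i \<in> insert j (g ` {..<m})"
        then consider "i = j" | t where "t < m" "i = g t" by auto
        then show "i \<in> {i \<in> insert j S. a i < x \<and> x < b i}"
        proof cases
          case 1
          then show ?thesis using x(1) xb[of "b j"] unfolding B_def by simp
        next
          case (2 t)
          have "a (g t) \<le> a j" using insert.hyps(2) g(1)[OF 2(1)] .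
          then show ?thesis using x(1) xb[of "b (g t)"] g(1)[OF 2(1)] 2 unfolding B_def by simp
        qed
      qed
      moreover have "finite {i \<in> insert j S. a i < x \<and> x < b i}" using insert.hyps(1) by simp
      ultimately have "card (insert j (g ` {..<m})) \<le> m"
        using insert.prems(2)[of x] by (meson card_mono le_trans)
      moreover have "inj_on g {..<m}" by (rule inj_on_inverseI[of _ col]) (simp add: g(2))
      moreover have "j \<notin> g ` {..<m}" using g(1) jS by auto
      ultimately show False by (simp add: card_image)
    qed
    then obtain t where t: "t < m" "\<forall>i\<in>S. col i = t \<longrightarrow> b i \<le> a j" by blast
    show ?thesis
      by (rule exI[of _ "col(j := t)"]) (use t col jS in auto)
  qed
qed

lemma disjoint_intervals_enumeration:
  fixes a b :: "'a \<Rightarrow> real"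
  assumes "finite S" "\<And>i. i \<in> S \<Longrightarrow> a i < b i"
    and "\<And>i j. i \<in> S \<Longrightarrow> j \<in> S \<Longrightarrow> i \<noteq> j \<Longrightarrow> b i \<le> a j \<or> b j \<le> a i"
  shows "\<exists>t. bij_betw t {..<card S} S \<and> (\<forall>j<card S. \<forall>i<j. b (t i) \<le> a (t j))"
  using assms
proof (induction S rule: finite_ranking_induct[where f = a])
  case empty
  then show ?case by (auto simp: bij_betw_def)
next
  case (insert x S)
  show ?case
  proof (cases "x \<in> S")
    case True
    then show ?thesis using insert by (simp add: insert_absorb)
  next
    case xS: False
    obtain t where t: "bij_betw t {..<card S} S" "\<forall>j<card S. \<forall>i<j. b (t i) \<le> a (t j)"
      using insert by blast
    have tS: "t i \<in> S" if "i < card S" for i using t(1) that by (auto simp: bij_betw_def)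
    define t' where "t' = t(card S := x)"
    have "bij_betw t' {..<card S} S" using t(1) unfolding t'_def by (subst bij_betw_cong[of _ _ t]) auto
    then have "bij_betw t' (insert (card S) {..<card S}) (insert x S)"
      using notIn_Un_bij_betw[of "card S" "{..<card S}" t' S] xS unfolding t'_def by auto
    moreover have "b (t' i) \<le> a (t' j)" if "j < Suc (card S)" "i < j" for i j
    proof (cases "j = card S")
      case True
      have "t i \<in> S" "t i \<noteq> x" using that True tS xS by auto
      then have "b (t i) \<le> a x \<or> b x \<le> a (t i)" using insert.prems(2) by blast
      then have "b (t i) \<le> a x" using insert.hyps(2) insert.prems(1) \<open>t i \<in> S\<close> by (meson insertI1 not_le order.trans)
      then show ?thesis using that True unfolding t'_def by auto
    next
      case False
      then show ?thesis using that t(2) unfolding t'_def by auto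
    qed
    ultimately show ?thesis
      using xS insert.hyps(1) by (intro exI[of _ t']) (auto simp: lessThan_Suc)
  qed
qed

text \<open>
  The left end point of the first interval of a chain is not used. This is why \<open>\<nu> (i, False)\<close> is only
  prescribed when some interval lies to the left of interval \<open>i\<close>, and why an interval that is
  unbounded on the left may be truncated to the left of all \<open>b j\<close>.
\<close>

lemma isotropic_family_chain:
  fixes a b :: "'a \<Rightarrow> real" and ca cb :: "'a \<Rightarrow> real"
  assumes fin: "finite S" and ab: "\<And>i. i \<in> S \<Longrightarrow> a i < b i"
    and dis: "\<And>i j. i \<in> S \<Longrightarrow> j \<in> S \<Longrightarrow> i \<noteq> j \<Longrightarrow> b i \<le> a j \<or> b j \<le> a i"
    and nb: "\<And>i. i \<in> S \<Longrightarrow> cb i > 0 \<and> \<nu> (i, True) = of_real (cb i) * (1 + \<i> * of_real (b i))"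
    and na: "\<And>i j. i \<in> S \<Longrightarrow> j \<in> S \<Longrightarrow> b j \<le> a i \<Longrightarrow> ca i > 0 \<and> \<nu> (i, False) = - of_real (ca i) * (1 + \<i> * of_real (a i))"
  shows "isotropic_family \<nu> (S \<times> {True} \<union> {i\<in>S. \<exists>j\<in>S. b j \<le> a i} \<times> {False}) (card S - 1)"
proof (cases "S = {}")
  case True
  then show ?thesis by (simp add: isotropic_family_0)
next
  case False
  have "\<exists>t. bij_betw t {..<card S} S \<and> (\<forall>j<card S. \<forall>i<j. b (t i) \<le> a (t j))"
    using fin ab dis by (rule disjoint_intervals_enumeration)
  then obtain t where t: "bij_betw t {..<card S} S" "\<And>i j. j < card S \<Longrightarrow> i < j \<Longrightarrow> b (t i) \<le> a (t j)"
    by blast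
  have tS: "t i \<in> S" if "i < card S" for i using t(1) that by (auto simp: bij_betw_def)
  define d where "d = card S - 1"
  have d: "card S = Suc d" using False fin unfolding d_def by (simp add: card_gt_0_iff)
  \<comment> \<open>Node i belongs to the interval with number (i + 1) div 2, even i standing for
    right and odd i for left ends. The order is b 0, a 1, b 1, a 2, b 2, ..., without the left end
    of interval 0.\<close>
  define e where "e = (\<lambda>i. (t (Suc i div 2), even i))"
  define x where "x = (\<lambda>i. if even i then b (t (Suc i div 2)) else a (t (Suc i div 2)))"
  define c where "c = (\<lambda>i. if even i then cb (t (Suc i div 2)) else ca (t (Suc i div 2)))"
  have step: "x i \<le> x (Suc i)" if "Suc i < 2 * d + 1" for i
  proof (cases "even i")
    case True
    then show ?thesis unfolding x_def using t(2)[of "Suc (Suc i) div 2" "Suc i div 2"] that d by (auto elim!: evenE)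
  next
    case False
    then have "Suc (Suc i) div 2 = Suc i div 2" by (auto elim!: oddE)
    moreover have "a (t (Suc i div 2)) < b (t (Suc i div 2))"
      using that d by (intro ab tS) linarith
    ultimately show ?thesis unfolding x_def using False by simp
  qed
  have mono: "x i \<le> x j" if "i < j" "j < 2 * d + 1" for i j
    using that
  proof (induction j)
    case (Suc j)
    then show ?case using step[of j] by (cases "i = j") auto
  qed simp
  have "isotropic_family (\<nu> \<circ> e) {..<2 * d + 1} d"
  proof (rule isotropic_family_alternating[of _ x _ c])
    fix i assume i: "i < 2 * d + 1"
    then have m: "Suc i div 2 < card S" using d by auto
    have "0 < Suc i div 2" if "odd i" using that by (auto elim!: oddE)
    then have "odd i \<Longrightarrow> b (t 0) \<le> a (t (Suc i div 2))" using t(2) m by blast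
    then show "(\<nu> \<circ> e) i = of_real (c i * (-1) ^ i) * (1 + \<i> * of_real (x i))" and "c i > 0"
      using nb[OF tS[OF m]] na[OF tS[OF m] tS[of 0]] d unfolding e_def x_def c_def by auto
  qed (use mono in auto)
  moreover have "inj_on e {..<2 * d + 1}"
  proof (rule inj_onI)
    fix i j assume ij: "i \<in> {..<2 * d + 1}" "j \<in> {..<2 * d + 1}" and "e i = e j"
    then have "t (Suc i div 2) = t (Suc j div 2)" and p: "even i = even j" unfolding e_def by auto
    then have "Suc i div 2 = Suc j div 2"
      using t(1) ij d unfolding bij_betw_def inj_on_def by auto
    then show "i = j" using p by presburger
  qed
  ultimately have "isotropic_family \<nu> (e ` {..<2 * d + 1}) d" by (rule isotropic_family_reindex)
  then show ?thesis unfolding d_def[symmetric]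
  proof (rule isotropic_family_superset)
    show "e ` {..<2 * d + 1} \<subseteq> S \<times> {True} \<union> {i\<in>S. \<exists>j\<in>S. b j \<le> a i} \<times> {False}"
    proof
      fix x assume "x \<in> e ` {..<2 * d + 1}"
      then obtain i where i: "i < 2 * d + 1" "x = e i" by auto
      have m: "Suc i div 2 < card S" using i d by auto
      have "\<exists>j\<in>S. b j \<le> a (t (Suc i div 2))" if "odd i"
      proof -
        have "0 < Suc i div 2" using that by (auto elim!: oddE)
        then have "b (t 0) \<le> a (t (Suc i div 2))" by (rule t(2)[OF m])
        moreover have "t 0 \<in> S" using tS[of 0] d by simp
        ultimately show ?thesis by blast
      qed
      then show "x \<in> S \<times> {True} \<union> {i\<in>S. \<exists>j\<in>S. b j \<le> a i} \<times> {False}"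
        using i tS[OF m] unfolding e_def by auto
    qed
  qed (use fin in auto)
qed

text \<open>Each colour class is a chain of disjoint intervals and yields one vector less than it
  has intervals, so m classes lose at most m dimensions.\<close>

lemma isotropic_family_intervals:
  fixes a b :: "'a \<Rightarrow> real" and ca cb :: "'a \<Rightarrow> real"
  assumes fin: "finite I" and ab: "\<And>i. i \<in> I \<Longrightarrow> a i < b i"
    and depth: "\<And>x. card {i\<in>I. a i < x \<and> x < b i} \<le> m"
    and nb: "\<And>i. i \<in> I \<Longrightarrow> cb i > 0 \<and> \<nu> (i, True) = of_real (cb i) * (1 + \<i> * of_real (b i))"
    and na: "\<And>i j. i \<in> I \<Longrightarrow> j \<in> I \<Longrightarrow> b j \<le> a i \<Longrightarrow> ca i > 0 \<and> \<nu> (i, False) = - of_real (ca i) * (1 + \<i> * of_real (a i))"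
  shows "isotropic_family \<nu> (I \<times> {True} \<union> {i\<in>I. \<exists>j\<in>I. b j \<le> a i} \<times> {False}) (card I - m)"
proof -
  have "\<exists>col. (\<forall>i\<in>I. col i < m) \<and> (\<forall>i\<in>I. \<forall>j\<in>I. i \<noteq> j \<and> col i = col j \<longrightarrow> b i \<le> a j \<or> b j \<le> a i)"
    using fin ab depth by (rule interval_coloring)
  then obtain col where "\<forall>i\<in>I. col i < m"
      "\<forall>i\<in>I. \<forall>j\<in>I. i \<noteq> j \<and> col i = col j \<longrightarrow> b i \<le> a j \<or> b j \<le> a i"
    by (elim exE conjE) (rule that)
  then have col: "\<And>i. i \<in> I \<Longrightarrow> col i < m"
      "\<And>i j. i \<in> I \<Longrightarrow> j \<in> I \<Longrightarrow> i \<noteq> j \<Longrightarrow> col i = col j \<Longrightarrow> b i \<le> a j \<or> b j \<le> a i"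
    by simp_all
  define S where "S = (\<lambda>t. {i\<in>I. col i = t})"
  define E where "E = (\<lambda>S. S \<times> {True} \<union> {i\<in>S. \<exists>j\<in>S. b j \<le> a i} \<times> {False})"
  have finS: "finite (S t)" for t unfolding S_def using fin by simp
  have fam: "isotropic_family \<nu> (\<Union>t\<in>{..<m}. E (S t)) (\<Sum>t\<in>{..<m}. card (S t) - 1)"
  proof (rule isotropic_family_UN)
    fix t assume "t \<in> {..<m}"
    show "isotropic_family \<nu> (E (S t)) (card (S t) - 1)"
      unfolding E_def
    proof (rule isotropic_family_chain[of _ a b cb _ ca])
      fix i j assume "i \<in> S t" "j \<in> S t"
      then have ij: "i \<in> I" "j \<in> I" "col i = t" "col j = t" unfolding S_def by auto
      show "a i < b i" using ab ij(1) .
      show "cb i > 0 \<and> \<nu> (i, True) = of_real (cb i) * (1 + \<i> * of_real (b i))" using nb ij(1) .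
      show "b i \<le> a j \<or> b j \<le> a i" if "i \<noteq> j" using col(2)[OF ij(1,2) that] ij by simp
      show "ca i > 0 \<and> \<nu> (i, False) = - of_real (ca i) * (1 + \<i> * of_real (a i))" if "b j \<le> a i"
        using na[OF ij(1,2) that] .
    qed (rule finS)
  next
    fix t u :: nat assume "t \<noteq> u"
    then show "E (S t) \<inter> E (S u) = {}" unfolding E_def S_def by auto
  next
    fix t show "finite (E (S t))" unfolding E_def using finS by simp
  qed simp
  have I: "I = (\<Union>t\<in>{..<m}. S t)" unfolding S_def using col(1) by auto
  have "card I - m \<le> (\<Sum>t\<in>{..<m}. card (S t) - 1)"
  proof -
    have "card I = (\<Sum>t\<in>{..<m}. card (S t))"
      unfolding I using finS by (subst card_UN_disjoint) (auto simp: S_def)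
    also have "\<dots> \<le> (\<Sum>t\<in>{..<m}. (card (S t) - 1) + 1)" by (intro sum_mono) auto
    also have "\<dots> = (\<Sum>t\<in>{..<m}. card (S t) - 1) + m" by (subst sum.distrib) simp
    finally show ?thesis by simp
  qed
  with fam have "isotropic_family \<nu> (\<Union>t\<in>{..<m}. E (S t)) (card I - m)"
    by (rule isotropic_family_less)
  moreover have "(\<Union>t\<in>{..<m}. E (S t)) \<subseteq> E I"
  proof (rule UN_least)
    fix t show "E (S t) \<subseteq> E I" unfolding E_def S_def by auto
  qed
  moreover have "finite (E I)" unfolding E_def using fin by simp
  ultimately have "isotropic_family \<nu> (E I) (card I - m)"
    by (rule isotropic_family_superset)
  then show ?thesis unfolding E_def .
qed

section \<open>Direct sums of two-dimensional forms\<close>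

text \<open>
  The form \<open>block_form g \<tau>\<close> has the matrix with rows \<open>(\<i>, sqrt g)\<close> and \<open>(0, \<tau>)\<close>. The number
  \<open>lower_envelope g \<tau> m\<close> is the minimum of \<open>Im w - m Re w\<close> over its values \<open>w\<close> at the vectors
  \<open>(y, 1)\<close>; it is positive iff \<open>0\<close> lies below the convex set of these values in the direction of slope \<open>m\<close>.
\<close>

definition lower_envelope :: "real \<Rightarrow> complex \<Rightarrow> real \<Rightarrow> real" where
  "lower_envelope g \<tau> m = Im \<tau> - m * Re \<tau> - g * (m\<^sup>2 + 1) / 4"

definition block_form :: "real \<Rightarrow> complex \<Rightarrow> complex \<times> complex \<Rightarrow> complex \<times> complex \<Rightarrow> complex" where
  "block_form g \<tau> x x' = \<i> * fst x * cnj (fst x') + of_real (sqrt g) * snd x * cnj (fst x') + \<tau> * snd x * cnj (snd x')"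

definition isotropic_blocks ::
    "nat \<Rightarrow> (nat \<Rightarrow> real) \<Rightarrow> (nat \<Rightarrow> complex) \<Rightarrow> nat \<Rightarrow> (nat \<Rightarrow> nat \<Rightarrow> complex \<times> complex) \<Rightarrow> bool" where
  "isotropic_blocks s g \<tau> k x \<longleftrightarrow>
     (\<forall>p<k. \<forall>q<k. (\<Sum>j<s. block_form (g j) (\<tau> j) (x p j) (x q j)) = 0) \<and>
     (\<forall>c. (\<forall>j<s. (\<Sum>p<k. c p * fst (x p j)) = 0 \<and> (\<Sum>p<k. c p * snd (x p j)) = 0) \<longrightarrow> (\<forall>p<k. c p = 0))"

text \<open>At (y, 1) the real part of the value depends on Re y only, and for fixed Re y the
  imaginary part is a quadratic in Im y that takes every value from its minimum upwards. For g > 0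
  the values fill the region on and above a parabola, and - 2 Re \<tau> / g is the slope of its
  tangent over real part 0. For g = 0 they form a vertical half-line; a slope at which
  \<open>lower_envelope\<close> equals 1 then excludes Re \<tau> \<noteq> 0.\<close>

lemma block_form_isotropic:
  assumes g: "g \<ge> 0" and f: "\<And>m. lower_envelope g \<tau> m \<le> 0"
  shows "\<exists>y. block_form g \<tau> (y, 1) (y, 1) = 0"
proof (cases "g = 0")
  case True
  have "Re \<tau> = 0"
  proof (rule ccontr)
    assume "Re \<tau> \<noteq> 0"
    then show False using f[of "(Im \<tau> - 1) / Re \<tau>"] True by (simp add: lower_envelope_def)
  qed
  moreover have "Im \<tau> \<le> 0" using f[of 0] True by (simp add: lower_envelope_def)
  ultimately have "block_form g \<tau> (of_real (sqrt (- Im \<tau>)), 1) (of_real (sqrt (- Im \<tau>)), 1) = 0"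
    using True by (simp add: block_form_def complex_eq_iff)
  then show ?thesis by blast
next
  case False
  with g have g: "g > 0" by simp
  define x where "x = - Re \<tau> / sqrt g"
  have x: "sqrt g * x = - Re \<tau>" "g * x\<^sup>2 = (Re \<tau>)\<^sup>2" unfolding x_def using g by (simp_all add: power_divide)
  have "lower_envelope g \<tau> (- 2 * Re \<tau> / g) = Im \<tau> + (Re \<tau>)\<^sup>2 / g - g / 4"
    using g by (simp add: lower_envelope_def power2_eq_square field_simps)
  moreover have "(Re \<tau>)\<^sup>2 / g = x\<^sup>2" using x(2) g by (simp add: field_simps)
  ultimately have d: "g / 4 - x\<^sup>2 - Im \<tau> \<ge> 0" using f[of "- 2 * Re \<tau> / g"] by linarith
  define y where "y = sqrt g / 2 + sqrt (g / 4 - x\<^sup>2 - Im \<tau>)"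
  have "(y - sqrt g / 2)\<^sup>2 = g / 4 - x\<^sup>2 - Im \<tau>" unfolding y_def using d by simp
  then have y: "x\<^sup>2 + y\<^sup>2 - sqrt g * y + Im \<tau> = 0" using g by (simp add: power2_diff power_divide algebra_simps)
  have "block_form g \<tau> (Complex x y, 1) (Complex x y, 1) = 0"
    unfolding block_form_def using x(1) y by (simp add: complex_eq_iff power2_eq_square algebra_simps)
  then show ?thesis by blast
qed

text \<open>For g > 0 the envelope is a concave quadratic in m, positive exactly between its roots.
  The formula for \<tau> is Vieta's: the coefficients, and with them \<tau>, are recovered from a +
  b and a b.\<close>

lemma lower_envelope_roots:
  assumes g: "g > 0" and pos: "lower_envelope g \<tau> m0 > 0"
  shows "\<exists>a b. a < b \<and> (\<forall>m. lower_envelope g \<tau> m > 0 \<longleftrightarrow> a < m \<and> m < b) \<and>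
           \<tau> = of_real (- g * (a + b) / 4) + \<i> * of_real (g * (1 - a * b) / 4)"
proof -
  define p where "p = - 2 * Re \<tau> / g"
  define d where "d = p\<^sup>2 - 1 + 4 * Im \<tau> / g"
  have f: "lower_envelope g \<tau> m = g / 4 * (d - (m - p)\<^sup>2)" for m
    unfolding lower_envelope_def p_def d_def using g by (simp add: power2_eq_square field_simps)
  have "d - (m0 - p)\<^sup>2 > 0" using pos g unfolding f by (simp add: zero_less_mult_iff)
  then have d: "d > 0" using zero_le_power2[of "m0 - p"] by linarith
  define a where "a = p - sqrt d"
  define b where "b = p + sqrt d"
  have ab: "d - (m - p)\<^sup>2 = (m - a) * (b - m)" for m
    unfolding a_def b_def using d by (simp add: power2_eq_square algebra_simps)
  have "a < b" unfolding a_def b_def using d by simp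
  moreover have "lower_envelope g \<tau> m > 0 \<longleftrightarrow> a < m \<and> m < b" for m
    unfolding f ab using g \<open>a < b\<close> by (auto simp: zero_less_mult_iff)
  moreover have "\<tau> = of_real (- g * (a + b) / 4) + \<i> * of_real (g * (1 - a * b) / 4)"
  proof -
    have "a * b = p\<^sup>2 - d" unfolding a_def b_def using d by (simp add: algebra_simps power2_eq_square)
    then have 1: "a * b = 1 - 4 * Im \<tau> / g" unfolding d_def by simp
    have 2: "a + b = - 4 * Re \<tau> / g" unfolding a_def b_def p_def by simp
    show ?thesis unfolding 1 2 using g by (simp add: complex_eq_iff)
  qed
  ultimately show ?thesis by blast
qed

text \<open>At y = sqrt g / 2 times (m + \<i>) the quantity Im w - m Re w is minimal, so the value
  there is the point of contact of the tangent of slope m. For m, m' among the roots a, b the mixed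
  values are 0, and the diagonal ones are g (b - a) / 4 times 1 + \<i> b and -(1 + \<i> a).\<close>

lemma block_form_root_vectors:
  assumes g: "g \<ge> 0" and \<tau>: "\<tau> = of_real (- g * (a + b) / 4) + \<i> * of_real (g * (1 - a * b) / 4)"
  shows "block_form g \<tau> (of_real (sqrt g / 2) * Complex m 1, 1) (of_real (sqrt g / 2) * Complex m' 1, 1) =
     of_real (g / 4) * (of_real (m + m' - a - b) + \<i> * of_real (m * m' - a * b))"
proof -
  have "sqrt g * sqrt g = g" using g by simp
  then have "sqrt g * (sqrt g * t) = g * t" for t by (metis mult.assoc)
  then show ?thesis
    unfolding block_form_def \<tau> using g by (simp add: complex_eq_iff field_simps)
qed

text \<open>
  If \<open>g j = 0\<close>, the slopes at which \<open>lower_envelope\<close> is positive form a half-line. The common value \<open>\<rho>\<close>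
  of the real parts puts all these half-lines on the same side.
\<close>

lemma exists_isotropic_blocks_nonneg:
  fixes g :: "nat \<Rightarrow> real" and \<tau> :: "nat \<Rightarrow> complex"
  assumes g: "\<And>j. j < s \<Longrightarrow> g j \<ge> 0" and \<rho>: "\<And>j. j < s \<Longrightarrow> g j = 0 \<Longrightarrow> Re (\<tau> j) = \<rho>" and \<rho>0: "\<rho> \<ge> 0"
    and k: "k \<le> s" and depth: "\<And>m. card {j. j < s \<and> lower_envelope (g j) (\<tau> j) m > 0} \<le> s - k"
  shows "\<exists>x. isotropic_blocks s g \<tau> k x"
proof -
  define bad where "bad = (\<lambda>j m. lower_envelope (g j) (\<tau> j) m > 0)"
  \<comment> \<open>Blocks in \<open>Good\<close> have an isotropic vector of their own. Blocks in
    \<open>Always\<close> (g = 0, real part 0, positive imaginary part) have none and count towards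
    the depth at every slope. For the blocks in \<open>I\<close> some slopes are bad and some are
    not.\<close>
  define Good where "Good = {j. j < s \<and> (\<forall>m. \<not> bad j m)}"
  define Always where "Always = {j. j < s \<and> (\<forall>m. bad j m)}"
  define I where "I = {..<s} - Good - Always"
  have fin: "finite Good" "finite Always" "finite I" unfolding Good_def Always_def I_def by auto
  have zero_env: "lower_envelope (g j) (\<tau> j) m = Im (\<tau> j) - m * \<rho>" if "j < s" "g j = 0" for j m
    using that \<rho> by (simp add: lower_envelope_def)
  have \<rho>pos: "\<rho> > 0" if "j \<in> I" "g j = 0" for j
  proof -
    from that have "j < s" "\<exists>m. bad j m" "\<exists>m. \<not> bad j m" unfolding I_def Good_def Always_def by auto
    then have "\<rho> \<noteq> 0" using zero_env that(2) unfolding bad_def by auto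
    then show ?thesis using \<rho>0 by simp
  qed
  define R where "R = (\<lambda>j a b. a < b \<and> (\<forall>m. bad j m \<longleftrightarrow> a < m \<and> m < b) \<and>
      \<tau> j = of_real (- g j * (a + b) / 4) + \<i> * of_real (g j * (1 - a * b) / 4))"
  have "\<exists>a b. R j a b" if "j \<in> I" "g j \<noteq> 0" for j
  proof -
    from that have "j < s" and "\<exists>m. bad j m" unfolding I_def Good_def by auto
    moreover have "g j > 0" using g[OF \<open>j < s\<close>] that(2) by simp
    ultimately show ?thesis using lower_envelope_roots unfolding R_def bad_def by blast
  qed
  then obtain a0 b0 where R0: "\<And>j. j \<in> I \<Longrightarrow> g j \<noteq> 0 \<Longrightarrow> R j (a0 j) (b0 j)"
    by metis
  then have ab0: "a0 j < b0 j \<and> (\<forall>m. bad j m \<longleftrightarrow> a0 j < m \<and> m < b0 j) \<and>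
      \<tau> j = of_real (- g j * (a0 j + b0 j) / 4) + \<i> * of_real (g j * (1 - a0 j * b0 j) / 4)"
    if "j \<in> I" "g j \<noteq> 0" for j using that unfolding R_def by blast
  define b where "b = (\<lambda>j. if g j = 0 then Im (\<tau> j) / \<rho> else b0 j)"
  \<comment> \<open>For g = 0 the bad slopes form the half-line below
    \<open>Im (\<tau> j) / \<rho>\<close>. Cutting it off to the left of all right ends ensures that
    no interval precedes it, so that its left end never becomes a node.\<close>
  define a where "a = (\<lambda>j. if g j = 0 then Min (b ` I) - 1 else a0 j)"
  have Minb: "Min (b ` I) \<le> b j" if "j \<in> I" for j using that fin by simp
  have ab: "a j < b j" if "j \<in> I" for j
  proof (cases "g j = 0")
    case True
    then show ?thesis using Minb[OF that] unfolding a_def by simp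
  next
    case False
    then show ?thesis using ab0[OF that False] unfolding a_def b_def by simp
  qed
  have bad: "bad j m" if "j \<in> I" "a j < m" "m < b j" for j m
  proof (cases "g j = 0")
    case True
    have "j < s" using that unfolding I_def by simp
    then show ?thesis using that True \<rho>pos[OF that(1) True] unfolding bad_def zero_env[OF \<open>j < s\<close> True] b_def
      by (simp add: field_simps)
  next
    case False
    then show ?thesis using ab0[OF that(1) False] that unfolding a_def b_def by simp
  qed
  have gpos: "g i > 0" if "i \<in> I" "j \<in> I" "b j \<le> a i" for i j
  proof -
    have "g i \<noteq> 0" using that Minb[of j] unfolding a_def by auto
    then show ?thesis using g[of i] that unfolding I_def by auto
  qed
  define y0 where "y0 = (\<lambda>j. SOME y. block_form (g j) (\<tau> j) (y, 1) (y, 1) = 0)"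
  have y0: "block_form (g j) (\<tau> j) (y0 j, 1) (y0 j, 1) = 0" if "j \<in> Good" for j
  proof -
    have "\<exists>y. block_form (g j) (\<tau> j) (y, 1) (y, 1) = 0"
      using that by (intro block_form_isotropic) (auto simp: Good_def bad_def not_less g)
    then show ?thesis unfolding y0_def by (rule someI_ex)
  qed
  \<comment> \<open>For j in \<open>I\<close> with g = 0 this gives the vector (0, 1), whose value
    is \<tau> = \<rho> (1 + \<i> b); hence the constant \<rho> in \<open>cc\<close> below.\<close>
  define y where "y = (\<lambda>(j, t). if j \<in> Good then y0 j else of_real (sqrt (g j) / 2) * Complex (if t then b j else a j) 1)"
  define \<nu> where "\<nu> = (\<lambda>x. block_form (g (fst x)) (\<tau> (fst x)) (y x, 1) (y x, 1))"
  define cc where "cc = (\<lambda>j. if g j = 0 then \<rho> else g j / 4 * (b j - a j))"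
  \<comment> \<open>The blocks in \<open>Always\<close> use up their share of the allowed depth at
    every slope, and only the rest is left for the intervals. The depth bound also gives card
    \<open>Always\<close> \<le> s - k, so the subtraction is not truncated.\<close>
  define m where "m = s - k - card Always"
  define SI where "SI = I \<times> {True} \<union> {i\<in>I. \<exists>j\<in>I. b j \<le> a i} \<times> {False}"
  have nG: "j \<notin> Good" if "j \<in> I" for j using that unfolding I_def by simp
  have fI: "isotropic_family \<nu> SI (card I - m)"
    unfolding SI_def
  proof (rule isotropic_family_intervals[of _ a b _ cc _ cc])
    fix x
    have "card {i \<in> I. a i < x \<and> x < b i} + card Always = card ({i \<in> I. a i < x \<and> x < b i} \<union> Always)"
      using fin by (intro card_Un_disjoint[symmetric]) (auto simp: I_def)
    also have "\<dots> \<le> card {j. j < s \<and> bad j x}"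
      using bad by (intro card_mono) (auto simp: I_def Always_def)
    also have "\<dots> \<le> s - k" using depth unfolding bad_def by simp
    finally show "card {i \<in> I. a i < x \<and> x < b i} \<le> m" unfolding m_def by linarith
  next
    fix i assume i: "i \<in> I"
    then have i_s: "i < s" unfolding I_def by simp
    show "cc i > 0 \<and> \<nu> (i, True) = of_real (cc i) * (1 + \<i> * of_real (b i))"
    proof (cases "g i = 0")
      case True
      then show ?thesis using \<rho>pos[OF i True] \<rho>[OF i_s True]
        unfolding \<nu>_def y_def cc_def b_def block_form_def by (simp add: nG[OF i] complex_eq_iff)
    next
      case False
      then have gi: "g i > 0" using g[OF i_s] by simp
      have "\<nu> (i, True) = of_real (g i / 4) * (of_real (b i + b i - a i - b i) + \<i> * of_real (b i * b i - a i * b i))"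
        unfolding \<nu>_def y_def using nG[OF i] False ab0[OF i False] g[OF i_s]
        by (simp only: fst_conv prod.case if_True if_False a_def b_def) (rule block_form_root_vectors; simp)
      also have "of_real (g i / 4) * (of_real (b i + b i - a i - b i) + \<i> * of_real (b i * b i - a i * b i)) =
          of_real (g i / 4 * (b i - a i)) * (1 + \<i> * of_real (b i))" by (simp add: algebra_simps)
      finally show ?thesis using ab[OF i] False gi unfolding cc_def by simp
    qed
  next
    fix i j assume i: "i \<in> I" and j: "j \<in> I" "b j \<le> a i"
    have gi: "g i > 0" using gpos[OF i j] .
    then have ne: "g i \<noteq> 0" by simp
    have "\<nu> (i, False) = of_real (g i / 4) * (of_real (a i + a i - a i - b i) + \<i> * of_real (a i * a i - a i * b i))"
      unfolding \<nu>_def y_def using nG[OF i] ne ab0[OF i ne] gi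
      by (simp only: fst_conv prod.case if_True if_False a_def b_def) (rule block_form_root_vectors; simp)
    also have "\<dots> = - of_real (g i / 4 * (b i - a i)) * (1 + \<i> * of_real (a i))" by (simp add: complex_eq_iff field_simps)
    finally show "cc i > 0 \<and> \<nu> (i, False) = - of_real (cc i) * (1 + \<i> * of_real (a i))"
      using ab[OF i] gi ne unfolding cc_def by simp
  qed (use fin ab in auto)
  have fG: "isotropic_family \<nu> (Good \<times> {True}) (card Good)"
    using isotropic_family_null[of "Good \<times> {True}" \<nu>] fin y0 by (auto simp: \<nu>_def y_def card_cartesian_product)
  define S where "S = SI \<union> Good \<times> {True}"
  have finS: "finite S" unfolding S_def SI_def using fin by simp
  have card_s: "card I + card Always + card Good = s"
  proof -
    have "{..<s} = I \<union> Always \<union> Good" unfolding I_def Good_def Always_def by auto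
    then have "s = card (I \<union> Always \<union> Good)" by (metis card_lessThan)
    also have "\<dots> = card (I \<union> Always) + card Good"
      using fin by (intro card_Un_disjoint) (auto simp: I_def Good_def Always_def)
    also have "card (I \<union> Always) = card I + card Always"
      using fin by (intro card_Un_disjoint) (auto simp: I_def)
    finally show ?thesis by simp
  qed
  have "isotropic_family \<nu> S (card I - m + card Good)"
    unfolding S_def using fI fG by (rule isotropic_family_Un) (use fin nG in \<open>auto simp: SI_def\<close>)
  moreover have "k \<le> card I - m + card Good"
  proof -
    have "card Always \<le> card {j. j < s \<and> bad j 0}" by (rule card_mono) (auto simp: Always_def)
    then have "card Always \<le> s - k" using depth[of 0] unfolding bad_def by simp
    then show ?thesis using card_s k unfolding m_def by linarith
  qed
  ultimately have "isotropic_family \<nu> S k" by (rule isotropic_family_less)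
  then obtain \<Phi> where "isotropic_system \<nu> S k \<Phi>" unfolding isotropic_family_def by blast
  note P = isotropic_systemD[OF this]
  \<comment> \<open>In block j, \<open>\<Phi> p\<close> supplies the coefficients of the two vectors
    (y (j, True), 1) and (y (j, False), 1).\<close>
  define X where "X = (\<lambda>p j. (of_real (\<Phi> p (j, True)) * y (j, True) + of_real (\<Phi> p (j, False)) * y (j, False),
                          complex_of_real (\<Phi> p (j, True) + \<Phi> p (j, False))))"
  have cross: "block_form (g j) (\<tau> j) (y (j, t), 1) (y (j, \<not> t), 1) = 0" if jF: "(j, False) \<in> S" for j t
  proof -
    from jF have j: "j \<in> I" and ex: "\<exists>l\<in>I. b l \<le> a j" unfolding S_def SI_def by auto
    from ex obtain l where l: "l \<in> I" "b l \<le> a j" by blast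
    have gj: "g j > 0" using gpos[OF j l] .
    then have ne: "g j \<noteq> 0" by simp
    have bf: "block_form (g j) (\<tau> j) (of_real (sqrt (g j) / 2) * Complex u 1, 1) (of_real (sqrt (g j) / 2) * Complex u' 1, 1) =
     of_real (g j / 4) * (of_real (u + u' - a j - b j) + \<i> * of_real (u * u' - a j * b j))" for u u'
      by (rule block_form_root_vectors) (use ab0[OF j ne] ne gj in \<open>simp_all add: a_def b_def\<close>)
    have "y (j, u) = of_real (sqrt (g j) / 2) * Complex (if u then b j else a j) 1" for u
      using nG[OF j] by (simp add: y_def)
    then show ?thesis by (simp only: bf) (cases t; simp add: mult.commute)
  qed
  have form: "block_form (g j) (\<tau> j) (X p j) (X q j) =
      \<nu> (j, True) * of_real (\<Phi> p (j, True) * \<Phi> q (j, True)) + \<nu> (j, False) * of_real (\<Phi> p (j, False) * \<Phi> q (j, False))"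
    if p: "p < k" and q: "q < k" for p q j
  proof -
    define V where "V = (\<lambda>t u. block_form (g j) (\<tau> j) (y (j, t), 1) (y (j, u), 1))"
    have "block_form (g j) (\<tau> j) (X p j) (X q j) =
      V True True * of_real (\<Phi> p (j, True) * \<Phi> q (j, True)) + V False False * of_real (\<Phi> p (j, False) * \<Phi> q (j, False)) +
      V True False * of_real (\<Phi> p (j, True) * \<Phi> q (j, False)) + V False True * of_real (\<Phi> p (j, False) * \<Phi> q (j, True))"
      unfolding X_def V_def block_form_def by (simp add: algebra_simps)
    moreover have "V True False * of_real (\<Phi> p (j, True) * \<Phi> q (j, False)) = 0"
      using P(1)[OF q, of "(j, False)"] cross[of j True] unfolding V_def by (cases "(j, False) \<in> S") auto
    moreover have "V False True * of_real (\<Phi> p (j, False) * \<Phi> q (j, True)) = 0"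
      using P(1)[OF p, of "(j, False)"] cross[of j False] unfolding V_def by (cases "(j, False) \<in> S") auto
    ultimately show ?thesis unfolding V_def \<nu>_def by (simp only: fst_conv add_0_right)
  qed
  have Ss: "S \<subseteq> {..<s} \<times> UNIV" unfolding S_def SI_def I_def Good_def by auto
  show ?thesis
    unfolding isotropic_blocks_def
  proof (intro exI[of _ X] conjI allI impI)
    fix p q assume pq: "p < k" "q < k"
    have "(\<Sum>j<s. block_form (g j) (\<tau> j) (X p j) (X q j)) = (\<Sum>j<s. \<Sum>t\<in>UNIV. \<nu> (j, t) * of_real (\<Phi> p (j, t) * \<Phi> q (j, t)))"
      by (rule sum.cong) (use form[OF pq] in \<open>auto simp: UNIV_bool\<close>)
    also have "\<dots> = (\<Sum>x\<in>{..<s} \<times> UNIV. \<nu> x * of_real (\<Phi> p x * \<Phi> q x))"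
      by (simp add: sum.cartesian_product)
    also have "\<dots> = (\<Sum>x\<in>S. \<nu> x * of_real (\<Phi> p x * \<Phi> q x))"
      using Ss P(1)[OF pq(1)] by (intro sum.mono_neutral_right) auto
    finally show "(\<Sum>j<s. block_form (g j) (\<tau> j) (X p j) (X q j)) = 0" using P(2)[OF pq] by simp
  next
    fix c :: "nat \<Rightarrow> complex" and p
    assume c: "\<forall>j<s. (\<Sum>p<k. c p * fst (X p j)) = 0 \<and> (\<Sum>p<k. c p * snd (X p j)) = 0" and p: "p < k"
    define \<phi> where "\<phi> = (\<lambda>x. \<Sum>p<k. c p * of_real (\<Phi> p x))"
    have e1: "(\<Sum>p<k. c p * fst (X p j)) = \<phi> (j, True) * y (j, True) + \<phi> (j, False) * y (j, False)"
      and e2: "(\<Sum>p<k. c p * snd (X p j)) = \<phi> (j, True) + \<phi> (j, False)" for j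
      unfolding X_def \<phi>_def sum_distrib_right sum.distrib[symmetric]
      by (rule sum.cong; simp add: algebra_simps)+
    have \<phi>1: "\<phi> (j, True) * y (j, True) + \<phi> (j, False) * y (j, False) = 0"
      and \<phi>2: "\<phi> (j, True) + \<phi> (j, False) = 0" if "j < s" for j
      using c that unfolding e1 e2 by auto
    have \<phi>S: "\<phi> x = 0" if "x \<notin> S" for x unfolding \<phi>_def using P(1)[OF _ that] by simp
    show "c p = 0"
    proof (rule P(3)[OF _ p])
      fix x assume x: "x \<in> S"
      obtain j t where xjt: "x = (j, t)" by (cases x)
      have j: "j < s" using x xjt Ss by auto
      have "\<phi> (j, True) = 0 \<and> \<phi> (j, False) = 0"
      proof (cases "(j, False) \<in> S")
        case False
        then show ?thesis using \<phi>S \<phi>2[OF j] by simp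
      next
        case True
        then have jI: "j \<in> I" and "\<exists>l\<in>I. b l \<le> a j" unfolding S_def SI_def by auto
        then have gj: "g j > 0" using gpos by blast
        have e: "\<phi> (j, False) = - \<phi> (j, True)" using \<phi>2[OF j] by (simp add: eq_neg_iff_add_eq_0 add.commute)
        have "\<phi> (j, True) * (y (j, True) - y (j, False)) = 0"
          using \<phi>1[OF j] unfolding e by (simp add: algebra_simps)
        moreover have "y (j, True) \<noteq> y (j, False)"
          unfolding y_def using nG[OF jI] gj ab[OF jI] by auto
        ultimately show ?thesis using e by simp
      qed
      then show "(\<Sum>i<k. c i * of_real (\<Phi> i x)) = 0" using xjt unfolding \<phi>_def by (cases t) auto
    qed
  qed
qed

text \<open>Reflection in the imaginary axis replaces \<tau> by - cnj \<tau> and the slope m by - m,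
  so the sign of \<rho> may be prescribed. It takes a vector (y, v) to (- cnj y, cnj v), and the
  form turns into its negative conjugate.\<close>

lemma exists_isotropic_blocks:
  fixes g :: "nat \<Rightarrow> real" and \<tau> :: "nat \<Rightarrow> complex"
  assumes g: "\<And>j. j < s \<Longrightarrow> g j \<ge> 0" and \<rho>: "\<And>j. j < s \<Longrightarrow> g j = 0 \<Longrightarrow> Re (\<tau> j) = \<rho>"
    and k: "k \<le> s" and depth: "\<And>m. card {j. j < s \<and> lower_envelope (g j) (\<tau> j) m > 0} \<le> s - k"
  shows "\<exists>x. isotropic_blocks s g \<tau> k x"
proof (cases "\<rho> \<ge> 0")
  case True
  then show ?thesis using exists_isotropic_blocks_nonneg[OF g \<rho> _ k depth] by blast
next
  case False
  have env: "lower_envelope g' (- cnj \<tau>') m = lower_envelope g' \<tau>' (- m)" for g' \<tau>' m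
    by (simp add: lower_envelope_def)
  have "\<exists>x. isotropic_blocks s g (\<lambda>j. - cnj (\<tau> j)) k x"
  proof (rule exists_isotropic_blocks_nonneg)
    show "card {j. j < s \<and> lower_envelope (g j) (- cnj (\<tau> j)) m > 0} \<le> s - k" for m
      using depth[of "- m"] by (simp only: env)
    show "Re (- cnj (\<tau> j)) = - \<rho>" if "j < s" "g j = 0" for j using \<rho>[OF that] by simp
  qed (use g k False in auto)
  then obtain x :: "nat \<Rightarrow> nat \<Rightarrow> complex \<times> complex" where x:
     "\<And>p q. p < k \<Longrightarrow> q < k \<Longrightarrow> (\<Sum>j<s. block_form (g j) (- cnj (\<tau> j)) (x p j) (x q j)) = 0"
     "\<And>c. (\<forall>j<s. (\<Sum>p<k. c p * fst (x p j)) = 0 \<and> (\<Sum>p<k. c p * snd (x p j)) = 0) \<Longrightarrow> (\<forall>p<k. c p = 0)"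
    unfolding isotropic_blocks_def by (elim exE conjE) blast
  define X where "X = (\<lambda>p j. (- cnj (fst (x p j)), cnj (snd (x p j))))"
  have "block_form (g j) (\<tau> j) (X p j) (X q j) = - cnj (block_form (g j) (- cnj (\<tau> j)) (x p j) (x q j))" for p q j
    unfolding X_def block_form_def by (simp add: algebra_simps)
  then have XX: "(\<Sum>j<s. block_form (g j) (\<tau> j) (X p j) (X q j)) = - cnj (\<Sum>j<s. block_form (g j) (- cnj (\<tau> j)) (x p j) (x q j))" for p q
    by (simp add: sum_negf)
  have "\<forall>p<k. \<forall>q<k. (\<Sum>j<s. block_form (g j) (\<tau> j) (X p j) (X q j)) = 0"
    unfolding XX using x(1) by (simp del: cnj_sum)
  moreover have "\<forall>p<k. c p = 0" if c: "\<forall>j<s. (\<Sum>p<k. c p * fst (X p j)) = 0 \<and> (\<Sum>p<k. c p * snd (X p j)) = 0" for c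
  proof -
    have cs: "(\<Sum>p<k. cnj (c p) * fst (x p j)) = - cnj (\<Sum>p<k. c p * fst (X p j))"
      "(\<Sum>p<k. cnj (c p) * snd (x p j)) = cnj (\<Sum>p<k. c p * snd (X p j))" for j
      unfolding X_def by (simp_all add: sum_negf)
    have "\<forall>p<k. cnj (c p) = 0"
    proof (rule x(2), intro allI impI)
      fix j assume "j < s"
      then show "(\<Sum>p<k. cnj (c p) * fst (x p j)) = 0 \<and> (\<Sum>p<k. cnj (c p) * snd (x p j)) = 0"
        unfolding cs using c by (simp del: cnj_sum)
    qed
    then show ?thesis by simp
  qed
  ultimately show ?thesis unfolding isotropic_blocks_def by blast
qed

section \<open>Rank numerical ranges in coordinates\<close>

lemma exists_kernel_vector:
  fixes L :: "nat \<Rightarrow> nat \<Rightarrow> complex"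
  assumes "l < k"
  shows "\<exists>c. (\<exists>p<k. c p \<noteq> 0) \<and> (\<forall>i<l. (\<Sum>p<k. L i p * c p) = 0)"
proof -
  \<comment> \<open>The l equations are padded with zero rows to a square matrix, which is therefore
    singular.\<close>
  define M where "M = mat\<^sub>r k k (\<lambda>i. if i = l then 0\<^sub>v k else vec k (\<lambda>p. if i < l then L i p else 0))"
  have M: "M \<in> carrier_mat k k" unfolding M_def by simp
  have "det M = 0" unfolding M_def by (rule det_row_0[OF assms]) auto
  then obtain v where v: "v \<in> carrier_vec k" "v \<noteq> 0\<^sub>v k" "M *\<^sub>v v = 0\<^sub>v k"
    using det_0_iff_vec_prod_zero[OF M] by auto
  have "\<exists>p<k. v $ p \<noteq> 0"
  proof (rule ccontr)
    assume "\<not> ?thesis"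
    then have "v = 0\<^sub>v k" using v(1) by (intro eq_vecI) auto
    then show False using v(2) by simp
  qed
  moreover have "(\<Sum>p<k. L i p * v $ p) = 0" if i: "i < l" for i
  proof -
    have "i < k" using i assms by simp
    then have "(M *\<^sub>v v) $ i = (\<Sum>p<k. L i p * v $ p)"
      using i v(1) unfolding M_def mult_mat_vec_def scalar_prod_def
      by (auto simp: lessThan_atLeast0 intro!: sum.cong)
    then show ?thesis using v(3) \<open>i < k\<close> by simp
  qed
  ultimately show ?thesis by blast
qed

text \<open>Vectors are functions of which only the first n values matter, so that calculations
  carry no carrier conditions. The first argument is the conjugated one.\<close>

definition hdot :: "nat \<Rightarrow> (nat \<Rightarrow> complex) \<Rightarrow> (nat \<Rightarrow> complex) \<Rightarrow> complex" where
  "hdot n x y = (\<Sum>i<n. cnj (x i) * y i)"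

definition mapply :: "nat \<Rightarrow> (nat \<Rightarrow> nat \<Rightarrow> complex) \<Rightarrow> (nat \<Rightarrow> complex) \<Rightarrow> nat \<Rightarrow> complex" where
  "mapply n M x i = (\<Sum>j<n. M i j * x j)"

definition lincomb_fun :: "nat \<Rightarrow> (nat \<Rightarrow> complex) \<Rightarrow> (nat \<Rightarrow> nat \<Rightarrow> complex) \<Rightarrow> nat \<Rightarrow> complex" where
  "lincomb_fun k c x i = (\<Sum>p<k. c p * x p i)"

lemma hdot_lincomb_right: "hdot n y (lincomb_fun k c x) = (\<Sum>p<k. c p * hdot n y (x p))"
  unfolding hdot_def lincomb_fun_def sum_distrib_left
  by (subst sum.swap) (simp add: mult_ac)

lemma hdot_lincomb_left: "hdot n (lincomb_fun k c x) y = (\<Sum>p<k. cnj (c p) * hdot n (x p) y)"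
  unfolding hdot_def lincomb_fun_def cnj_sum sum_distrib_left sum_distrib_right
  by (subst sum.swap) (simp add: mult_ac)

lemma mapply_lincomb: "mapply n M (lincomb_fun k c x) = lincomb_fun k c (\<lambda>p. mapply n M (x p))"
  unfolding lincomb_fun_def mapply_def sum_distrib_left
  by (rule ext, subst sum.swap) (simp add: mult_ac)

lemma hdot_self: "hdot n x x = of_real (\<Sum>i<n. (cmod (x i))\<^sup>2)"
  unfolding hdot_def by (simp add: complex_norm_square[symmetric] mult.commute)

lemma hdot_self_eq_0: "hdot n x x = 0 \<longleftrightarrow> (\<forall>i<n. x i = 0)"
proof -
  have "(\<Sum>i<n. (cmod (x i))\<^sup>2) = 0 \<longleftrightarrow> (\<forall>i\<in>{..<n}. (cmod (x i))\<^sup>2 = 0)"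
    by (rule sum_nonneg_eq_0_iff) auto
  then show ?thesis unfolding hdot_self by (simp del: of_real_sum) blast
qed

lemma hdot_cnj: "cnj (hdot n x y) = hdot n y x"
  unfolding hdot_def by (simp add: mult.commute)

definition independent_funs :: "nat \<Rightarrow> nat \<Rightarrow> (nat \<Rightarrow> nat \<Rightarrow> complex) \<Rightarrow> bool" where
  "independent_funs n k y \<longleftrightarrow> (\<forall>c. (\<forall>i<n. lincomb_fun k c y i = 0) \<longrightarrow> (\<forall>p<k. c p = 0))"

text \<open>Fewer conditions than coefficients leave a nonzero solution, and independence allows it
  to be normalised. As the vectors \<open>x m\<close> are arbitrary, the same count serves for
  orthonormalising, for intersecting subspaces and for completing orthonormal systems.\<close>

lemma exists_unit_orthogonal:
  assumes "independent_funs n k y" "l < k"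
  shows "\<exists>c. hdot n (lincomb_fun k c y) (lincomb_fun k c y) = 1 \<and> (\<forall>m<l. hdot n (x m) (lincomb_fun k c y) = 0)"
proof -
  obtain c where c: "\<exists>p<k. c p \<noteq> 0" "\<forall>m<l. (\<Sum>p<k. hdot n (x m) (y p) * c p) = 0"
    using exists_kernel_vector[OF assms(2), of "\<lambda>m p. hdot n (x m) (y p)"] by blast
  define Y where "Y = lincomb_fun k c y"
  have "\<not> (\<forall>i<n. Y i = 0)" using assms(1) c(1) unfolding independent_funs_def Y_def by blast
  then have nz: "hdot n Y Y \<noteq> 0" by (simp add: hdot_self_eq_0)
  define N where "N = (\<Sum>i<n. (cmod (Y i))\<^sup>2)"
  have YN: "hdot n Y Y = of_real N" unfolding N_def by (rule hdot_self)
  have N: "N > 0" using nz unfolding YN of_real_eq_0_iff by (simp add: N_def sum_nonneg less_le)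
  define c' where "c' = (\<lambda>p. c p / of_real (sqrt N))"
  have e: "lincomb_fun k c' y = (\<lambda>i. Y i / of_real (sqrt N))"
    unfolding Y_def lincomb_fun_def c'_def by (simp add: sum_divide_distrib)
  have "hdot n (lincomb_fun k c' y) (lincomb_fun k c' y) = hdot n Y Y / (of_real (sqrt N) * of_real (sqrt N))"
    unfolding e hdot_def by (simp add: sum_divide_distrib)
  also have "\<dots> = 1" unfolding YN using N by (simp flip: of_real_mult)
  finally have 1: "hdot n (lincomb_fun k c' y) (lincomb_fun k c' y) = 1" .
  have "hdot n (x m) (lincomb_fun k c' y) = (\<Sum>p<k. hdot n (x m) (y p) * c p) / of_real (sqrt N)" for m
    unfolding hdot_lincomb_right c'_def by (simp add: sum_divide_distrib mult.commute)
  then have "\<forall>m<l. hdot n (x m) (lincomb_fun k c' y) = 0" using c(2) by simp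
  with 1 show ?thesis by blast
qed

lemma exists_orthonormal_in_span:
  assumes "independent_funs n k y" "l \<le> k"
  shows "\<exists>c. \<forall>a<l. \<forall>b<l. hdot n (lincomb_fun k (c a) y) (lincomb_fun k (c b) y) = (if a = b then 1 else 0)"
  using assms(2)
proof (induction l)
  case (Suc l)
  then obtain c where c: "\<And>a b. a < l \<Longrightarrow> b < l \<Longrightarrow> hdot n (lincomb_fun k (c a) y) (lincomb_fun k (c b) y) = (if a = b then 1 else 0)"
    by auto
  have "l < k" using Suc by simp
  from exists_unit_orthogonal[OF assms(1) this, of "\<lambda>a. lincomb_fun k (c a) y"]
  obtain d where d: "hdot n (lincomb_fun k d y) (lincomb_fun k d y) = 1"
    "\<And>m. m < l \<Longrightarrow> hdot n (lincomb_fun k (c m) y) (lincomb_fun k d y) = 0" by blast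
  have d': "hdot n (lincomb_fun k d y) (lincomb_fun k (c m) y) = 0" if "m < l" for m
    using d(2)[OF that] by (metis hdot_cnj complex_cnj_zero)
  show ?case
  proof (intro exI[of _ "c(l := d)"] allI impI)
    fix a b assume "a < Suc l" "b < Suc l"
    then show "hdot n (lincomb_fun k ((c(l := d)) a) y) (lincomb_fun k ((c(l := d)) b) y) = (if a = b then 1 else 0)"
      using c[of a b] d d' by (cases "a = l"; cases "b = l") (auto simp: less_Suc_eq)
  qed
qed simp

definition in_rank_range :: "nat \<Rightarrow> nat \<Rightarrow> (nat \<Rightarrow> nat \<Rightarrow> complex) \<Rightarrow> complex \<Rightarrow> bool" where
  "in_rank_range n k M w \<longleftrightarrow> (\<exists>x. (\<forall>p<k. \<forall>q<k. hdot n (x p) (x q) = (if p = q then 1 else 0)) \<and>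
      (\<forall>p<k. \<forall>q<k. hdot n (x p) (mapply n M (x q)) = (if p = q then w else 0)))"

text \<open>The compression condition says that the form of M - w vanishes on a subspace, so any
  basis of it may be exchanged for an orthonormal one.\<close>

lemma in_rank_rangeI:
  assumes "independent_funs n k y"
    and "\<And>p q. p < k \<Longrightarrow> q < k \<Longrightarrow> hdot n (y p) (mapply n M (y q)) = w * hdot n (y p) (y q)"
  shows "in_rank_range n k M w"
proof -
  obtain c where c: "\<forall>a<k. \<forall>b<k. hdot n (lincomb_fun k (c a) y) (lincomb_fun k (c b) y) = (if a = b then 1 else 0)"
    using exists_orthonormal_in_span[OF assms(1) order_refl] by blast
  have "hdot n (lincomb_fun k (c a) y) (mapply n M (lincomb_fun k (c b) y)) =
     w * hdot n (lincomb_fun k (c a) y) (lincomb_fun k (c b) y)" for a b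
    unfolding mapply_lincomb hdot_lincomb_right hdot_lincomb_left sum_distrib_left
    using assms(2) by (intro sum.cong) auto
  then show ?thesis unfolding in_rank_range_def
    by (intro exI[of _ "\<lambda>a. lincomb_fun k (c a) y"]) (use c in auto)
qed

text \<open>A subspace of dimension k meets every subspace of codimension l < k. All necessary
  conditions for membership come from testing the form on suitable subspaces in this way.\<close>

lemma in_rank_range_constrained:
  assumes "in_rank_range n k M w" "l < k"
  shows "\<exists>x. (\<exists>i<n. x i \<noteq> 0) \<and> (\<forall>m<l. hdot n (L m) x = 0) \<and> hdot n x (mapply n M x) = w * hdot n x x"
proof -
  obtain y where y: "\<And>p q. p < k \<Longrightarrow> q < k \<Longrightarrow> hdot n (y p) (y q) = (if p = q then 1 else 0)"
      "\<And>p q. p < k \<Longrightarrow> q < k \<Longrightarrow> hdot n (y p) (mapply n M (y q)) = (if p = q then w else 0)"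
    using assms(1) unfolding in_rank_range_def by blast
  have "independent_funs n k y"
    unfolding independent_funs_def
  proof (intro allI impI)
    fix c p assume c: "\<forall>i<n. lincomb_fun k c y i = 0" and p: "p < k"
    have "0 = hdot n (y p) (lincomb_fun k c y)" unfolding hdot_def using c by simp
    also have "\<dots> = (\<Sum>q<k. if p = q then c q else 0)"
      unfolding hdot_lincomb_right using y(1)[OF p] by (intro sum.cong) auto
    finally show "c p = 0" using p by simp
  qed
  from exists_unit_orthogonal[OF this assms(2), of L] obtain c
    where c: "hdot n (lincomb_fun k c y) (lincomb_fun k c y) = 1" "\<forall>m<l. hdot n (L m) (lincomb_fun k c y) = 0"
    by blast
  have "\<exists>i<n. lincomb_fun k c y i \<noteq> 0" using c(1) hdot_self_eq_0[of n "lincomb_fun k c y"] by auto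
  moreover have "hdot n (lincomb_fun k c y) (mapply n M (lincomb_fun k c y)) = w * hdot n (lincomb_fun k c y) (lincomb_fun k c y)"
    unfolding mapply_lincomb hdot_lincomb_right hdot_lincomb_left sum_distrib_left
    using y by (intro sum.cong) auto
  ultimately show ?thesis using c(2) by blast
qed

section \<open>Translation between matrices and coordinates\<close>

lemma mat_adjoint_dim [simp]: "dim_row (mat_adjoint A) = dim_col A" "dim_col (mat_adjoint A) = dim_row A"
  unfolding mat_adjoint_def by auto

lemma mat_adjoint_carrier [simp]: "A \<in> carrier_mat m n \<Longrightarrow> mat_adjoint A \<in> carrier_mat n m"
  by (intro carrier_matI) auto

lemma mat_adjoint_index [simp]:
  "i < dim_col A \<Longrightarrow> j < dim_row A \<Longrightarrow> mat_adjoint (A :: complex mat) $$ (i, j) = cnj (A $$ (j, i))"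
  unfolding mat_adjoint_def by (simp add: mat_of_rows_index)

lemma mat_adjoint_mult:
  fixes A B :: "complex mat"
  assumes "A \<in> carrier_mat m n" "B \<in> carrier_mat n l"
  shows "mat_adjoint (A * B) = mat_adjoint B * mat_adjoint A"
proof (rule eq_matI)
  fix i j assume "i < dim_row (mat_adjoint B * mat_adjoint A)" "j < dim_col (mat_adjoint B * mat_adjoint A)"
  then show "mat_adjoint (A * B) $$ (i, j) = (mat_adjoint B * mat_adjoint A) $$ (i, j)"
    using assms by (auto simp: scalar_prod_def mult.commute intro!: sum.cong)
qed (use assms in auto)

lemma adjoint_mult_index:
  fixes X Y :: "complex mat"
  assumes "X \<in> carrier_mat n k" "Y \<in> carrier_mat n l" "p < k" "q < l"
  shows "(mat_adjoint X * Y) $$ (p, q) = hdot n (\<lambda>i. X $$ (i, p)) (\<lambda>i. Y $$ (i, q))"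
  using assms by (auto simp: scalar_prod_def hdot_def lessThan_atLeast0 intro!: sum.cong)

lemma mult_index_mapply:
  fixes M X :: "complex mat"
  assumes "M \<in> carrier_mat m n" "X \<in> carrier_mat n k" "i < m" "p < k"
  shows "(M * X) $$ (i, p) = mapply n (\<lambda>i j. M $$ (i, j)) (\<lambda>i. X $$ (i, p)) i"
  using assms by (auto simp: scalar_prod_def mapply_def lessThan_atLeast0 intro!: sum.cong)

lemma hdot_cong: "(\<And>i. i < n \<Longrightarrow> x i = x' i) \<Longrightarrow> (\<And>i. i < n \<Longrightarrow> y i = y' i) \<Longrightarrow> hdot n x y = hdot n x' y'"
  unfolding hdot_def by (intro sum.cong) auto

lemma mapply_cong: "(\<And>j. j < n \<Longrightarrow> M i j = M' i j) \<Longrightarrow> (\<And>j. j < n \<Longrightarrow> x j = x' j) \<Longrightarrow> mapply n M x i = mapply n M' x' i"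
  unfolding mapply_def by (intro sum.cong) auto

lemma compression_index:
  fixes M X :: "complex mat"
  assumes M: "M \<in> carrier_mat n n" and X: "X \<in> carrier_mat n k" and pq: "p < k" "q < k"
  shows "(mat_adjoint X * M * X) $$ (p, q) =
    hdot n (\<lambda>i. X $$ (i, p)) (mapply n (\<lambda>i j. M $$ (i, j)) (\<lambda>i. X $$ (i, q)))"
proof -
  have "mat_adjoint X * M * X = mat_adjoint X * (M * X)" by (rule assoc_mult_mat[OF mat_adjoint_carrier[OF X] M X])
  then have "(mat_adjoint X * M * X) $$ (p, q) = hdot n (\<lambda>i. X $$ (i, p)) (\<lambda>i. (M * X) $$ (i, q))"
    using adjoint_mult_index[OF X mult_carrier_mat[OF M X] pq] by (simp only:)
  also have "\<dots> = hdot n (\<lambda>i. X $$ (i, p)) (mapply n (\<lambda>i j. M $$ (i, j)) (\<lambda>i. X $$ (i, q)))"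
    by (rule hdot_cong[OF refl mult_index_mapply[OF M X _ pq(2)]])
  finally show ?thesis .
qed

lemma rank_numerical_range_iff:
  assumes M: "M \<in> carrier_mat n n"
  shows "w \<in> rank_numerical_range k M \<longleftrightarrow> in_rank_range n k (\<lambda>i j. M $$ (i, j)) w"
proof
  assume "w \<in> rank_numerical_range k M"
  then obtain X where X: "X \<in> carrier_mat n k" "mat_adjoint X * X = 1\<^sub>m k" "mat_adjoint X * M * X = w \<cdot>\<^sub>m 1\<^sub>m k"
    unfolding rank_numerical_range_def mem_Collect_eq carrier_matD(1)[OF M] by blast
  show "in_rank_range n k (\<lambda>i j. M $$ (i, j)) w"
    unfolding in_rank_range_def
  proof (intro exI[of _ "\<lambda>p i. X $$ (i, p)"] conjI allI impI)
    fix p q assume pq: "p < k" "q < k"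
    show "hdot n (\<lambda>i. X $$ (i, p)) (\<lambda>i. X $$ (i, q)) = (if p = q then 1 else 0)"
      using adjoint_mult_index[OF X(1) X(1) pq] pq unfolding X(2) by simp
    show "hdot n (\<lambda>i. X $$ (i, p)) (mapply n (\<lambda>i j. M $$ (i, j)) (\<lambda>i. X $$ (i, q))) = (if p = q then w else 0)"
      using compression_index[OF M X(1) pq] pq unfolding X(3) by (cases "p = q"; simp)
  qed
next
  assume "in_rank_range n k (\<lambda>i j. M $$ (i, j)) w"
  then obtain x where x: "\<And>p q. p < k \<Longrightarrow> q < k \<Longrightarrow> hdot n (x p) (x q) = (if p = q then 1 else 0)"
      "\<And>p q. p < k \<Longrightarrow> q < k \<Longrightarrow> hdot n (x p) (mapply n (\<lambda>i j. M $$ (i, j)) (x q)) = (if p = q then w else 0)"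
    unfolding in_rank_range_def by blast
  define X where "X = mat n k (\<lambda>(i, p). x p i)"
  have X: "X \<in> carrier_mat n k" unfolding X_def by simp
  have Xi: "X $$ (i, p) = x p i" if "i < n" "p < k" for i p unfolding X_def using that by simp
  have "mat_adjoint X * X = 1\<^sub>m k"
  proof (rule eq_matI)
    fix p q assume "p < dim_row (1\<^sub>m k :: complex mat)" "q < dim_col (1\<^sub>m k :: complex mat)"
    then have pq: "p < k" "q < k" by auto
    have "(mat_adjoint X * X) $$ (p, q) = hdot n (x p) (x q)"
      unfolding adjoint_mult_index[OF X X pq] using Xi pq by (intro hdot_cong) auto
    then show "(mat_adjoint X * X) $$ (p, q) = 1\<^sub>m k $$ (p, q)" using x(1) pq by simp
  qed (use X in auto)
  moreover have "mat_adjoint X * M * X = w \<cdot>\<^sub>m 1\<^sub>m k"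
  proof (rule eq_matI)
    fix p q assume "p < dim_row (w \<cdot>\<^sub>m 1\<^sub>m k)" "q < dim_col (w \<cdot>\<^sub>m 1\<^sub>m k)"
    then have pq: "p < k" "q < k" by auto
    have "(mat_adjoint X * M * X) $$ (p, q) = hdot n (x p) (mapply n (\<lambda>i j. M $$ (i, j)) (x q))"
      unfolding compression_index[OF M X pq] using Xi pq by (intro hdot_cong mapply_cong) auto
    then show "(mat_adjoint X * M * X) $$ (p, q) = (w \<cdot>\<^sub>m 1\<^sub>m k) $$ (p, q)" using x(2) pq by simp
  qed (use X in auto)
  ultimately show "w \<in> rank_numerical_range k M"
    unfolding rank_numerical_range_def mem_Collect_eq carrier_matD(1)[OF M] using X by blast
qed

lemma numerical_range_eq:
  assumes M: "M \<in> carrier_mat n n"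
  shows "numerical_range M = rank_numerical_range 1 M"
proof -
  have dot: "v \<bullet>c u = hdot n (\<lambda>i. u $ i) (\<lambda>i. v $ i)" if "v \<in> carrier_vec n" "u \<in> carrier_vec n" for u v :: "complex vec"
    using that unfolding scalar_prod_def hdot_def by (auto simp: lessThan_atLeast0 mult.commute intro!: sum.cong)
  have ap: "(M *\<^sub>v x) $ i = mapply n (\<lambda>i j. M $$ (i, j)) (\<lambda>i. x $ i) i" if "x \<in> carrier_vec n" "i < n" for x i
    using that M unfolding scalar_prod_def mapply_def by (auto simp: lessThan_atLeast0 scalar_prod_def intro!: sum.cong)
  have form: "(M *\<^sub>v x) \<bullet>c x = hdot n (\<lambda>i. x $ i) (mapply n (\<lambda>i j. M $$ (i, j)) (\<lambda>i. x $ i))"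
    if "x \<in> carrier_vec n" for x
    using that M by (subst dot) (auto intro!: hdot_cong ap)
  show ?thesis
  proof (intro equalityI subsetI)
    fix w assume "w \<in> numerical_range M"
    then obtain x where x: "x \<in> carrier_vec n" "x \<bullet>c x = 1" "w = (M *\<^sub>v x) \<bullet>c x"
      unfolding numerical_range_def carrier_matD(1)[OF M] by blast
    then show "w \<in> rank_numerical_range 1 M"
      unfolding rank_numerical_range_iff[OF M] in_rank_range_def
      by (intro exI[of _ "\<lambda>_ i. x $ i"]) (simp add: form dot)
  next
    fix w assume "w \<in> rank_numerical_range 1 M"
    then obtain x where x: "hdot n (x 0) (x 0) = 1" "hdot n (x 0) (mapply n (\<lambda>i j. M $$ (i, j)) (x 0)) = w"
      unfolding rank_numerical_range_iff[OF M] in_rank_range_def by auto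
    define v where "v = vec n (x 0)"
    have v: "v \<in> carrier_vec n" unfolding v_def by simp
    have "v \<bullet>c v = 1" unfolding dot[OF v v] x(1)[symmetric] by (intro hdot_cong) (auto simp: v_def)
    moreover have "(M *\<^sub>v v) \<bullet>c v = w"
      unfolding form[OF v] x(2)[symmetric] by (intro hdot_cong mapply_cong) (auto simp: v_def)
    ultimately show "w \<in> numerical_range M" unfolding numerical_range_def carrier_matD(1)[OF M] using v by blast
  qed
qed

lemma eigenvalue_iff_mapply:
  fixes M :: "complex mat"
  assumes M: "M \<in> carrier_mat n n"
  shows "eigenvalue M l \<longleftrightarrow> (\<exists>x. (\<exists>i<n. x i \<noteq> 0) \<and> (\<forall>i<n. mapply n (\<lambda>i j. M $$ (i, j)) x i = l * x i))"
proof
  assume "eigenvalue M l"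
  then obtain v where v: "v \<in> carrier_vec n" "v \<noteq> 0\<^sub>v n" "M *\<^sub>v v = l \<cdot>\<^sub>v v"
    unfolding eigenvalue_def eigenvector_def using M by auto
  have "\<exists>i<n. v $ i \<noteq> 0"
  proof (rule ccontr)
    assume "\<not> ?thesis"
    then have "v = 0\<^sub>v n" using v(1) by (intro eq_vecI) auto
    then show False using v(2) by simp
  qed
  moreover have "mapply n (\<lambda>i j. M $$ (i, j)) (\<lambda>i. v $ i) i = l * v $ i" if "i < n" for i
  proof -
    have "(M *\<^sub>v v) $ i = mapply n (\<lambda>i j. M $$ (i, j)) (\<lambda>i. v $ i) i"
      using that M v(1) unfolding mapply_def by (auto simp: lessThan_atLeast0 scalar_prod_def intro!: sum.cong)
    then show ?thesis using v that by simp
  qed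
  ultimately show "\<exists>x. (\<exists>i<n. x i \<noteq> 0) \<and> (\<forall>i<n. mapply n (\<lambda>i j. M $$ (i, j)) x i = l * x i)" by blast
next
  assume "\<exists>x. (\<exists>i<n. x i \<noteq> 0) \<and> (\<forall>i<n. mapply n (\<lambda>i j. M $$ (i, j)) x i = l * x i)"
  then obtain x i0 where x: "i0 < n" "x i0 \<noteq> 0" "\<forall>i<n. mapply n (\<lambda>i j. M $$ (i, j)) x i = l * x i" by blast
  have "M *\<^sub>v vec n x = l \<cdot>\<^sub>v vec n x"
  proof (rule eq_vecI)
    fix i assume "i < dim_vec (l \<cdot>\<^sub>v vec n x)"
    then have i: "i < n" by simp
    have "(M *\<^sub>v vec n x) $ i = mapply n (\<lambda>i j. M $$ (i, j)) x i"
      using i M unfolding mapply_def by (auto simp: lessThan_atLeast0 scalar_prod_def intro!: sum.cong)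
    then show "(M *\<^sub>v vec n x) $ i = (l \<cdot>\<^sub>v vec n x) $ i" using x(3) i by simp
  qed (use M in auto)
  moreover have "vec n x \<noteq> 0\<^sub>v n" using x(1,2) by (metis index_vec index_zero_vec(1))
  ultimately show "eigenvalue M l" unfolding eigenvalue_def eigenvector_def using M
    by (intro exI[of _ "vec n x"]) auto
qed

section \<open>Block matrices with commuting products\<close>

lemma mapply_add_scale:
  "mapply n M (\<lambda>i. a * x i + b * y i) = (\<lambda>i. a * mapply n M x i + b * mapply n M y i)"
  unfolding mapply_def by (simp add: sum.distrib sum_distrib_left algebra_simps)

lemma hdot_add_scale_right: "hdot n z (\<lambda>i. a * x i + b * y i) = a * hdot n z x + b * hdot n z y"
  unfolding hdot_def by (simp add: sum.distrib sum_distrib_left algebra_simps)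

lemma hdot_add_scale_left: "hdot n (\<lambda>i. a * x i + b * y i) z = cnj a * hdot n x z + cnj b * hdot n y z"
  unfolding hdot_def by (simp add: sum.distrib sum_distrib_left algebra_simps)

lemma hdot_mapply_adjoint: "hdot s v (mapply r D u) = hdot r (mapply s (\<lambda>i j. cnj (D j i)) v) u"
  unfolding hdot_def mapply_def cnj_sum sum_distrib_left sum_distrib_right
  by (subst sum.swap) (simp add: mult_ac)

lemma independent_standard_basis:
  assumes "k \<le> n"
  shows "independent_funs n k (\<lambda>p i. if p = i then 1 else 0)"
proof -
  have "lincomb_fun k c (\<lambda>p i. if p = i then 1 else 0) i = (if i < k then c i else 0)" for c i
    unfolding lincomb_fun_def by (simp add: if_distrib[of "\<lambda>y. _ * y"] cong: if_cong)
  then show ?thesis unfolding independent_funs_def using assms by auto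
qed

text \<open>
  The blocks \<open>C\<close> and \<open>D\<close> are written in an orthonormal basis that diagonalises both \<open>Z\<close> and \<open>H\<close>;
  \<open>s\<close> stands for \<open>n - r\<close>.
\<close>

locale commuting_blocks =
  fixes r s :: nat and \<alpha> \<beta> :: complex and C D :: "nat \<Rightarrow> nat \<Rightarrow> complex"
    and z :: "nat \<Rightarrow> complex" and h :: "nat \<Rightarrow> real"
  assumes s_le_r: "s \<le> r"
    and DC: "\<And>i j. i < s \<Longrightarrow> j < s \<Longrightarrow> (\<Sum>k<r. D i k * C k j) = (if i = j then z j else 0)"
    and CC_DD: "\<And>i j. i < s \<Longrightarrow> j < s \<Longrightarrow>
      (\<Sum>k<r. cnj (C k i) * C k j) + (\<Sum>k<r. D i k * cnj (D j k)) = (if i = j then of_real (h j) else 0)"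
begin

definition M :: "nat \<Rightarrow> nat \<Rightarrow> complex" where
  "M i j = (if i < r then (if j < r then (if i = j then \<alpha> else 0) else C i (j - r))
            else (if j < r then D (i - r) j else (if i = j then \<beta> else 0)))"

abbreviation low :: "(nat \<Rightarrow> complex) \<Rightarrow> nat \<Rightarrow> complex" where
  "low x \<equiv> \<lambda>j. x (r + j)"

lemma hdot_split: "hdot (r + s) x y = hdot r x y + hdot s (low x) (low y)"
  unfolding hdot_def by (rule sum_lessThan_add)

lemma mapply_M_upper: "i < r \<Longrightarrow> mapply (r + s) M x i = \<alpha> * x i + mapply s C (low x) i"
  unfolding mapply_def by (simp add: sum_lessThan_add M_def if_distrib[of "\<lambda>y. y * _"] cong: if_cong)

lemma mapply_M_lower: "j < s \<Longrightarrow> mapply (r + s) M x (r + j) = mapply r D x j + \<beta> * x (r + j)"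
  unfolding mapply_def by (simp add: sum_lessThan_add M_def if_distrib[of "\<lambda>y. y * _"] cong: if_cong)

lemma form_M: "hdot (r + s) y (mapply (r + s) M x) =
   \<alpha> * hdot r y x + hdot r y (mapply s C (low x)) + hdot s (low y) (mapply r D x) + \<beta> * hdot s (low y) (low x)"
proof -
  have "hdot r y (mapply (r + s) M x) = hdot r y (\<lambda>i. \<alpha> * x i + 1 * mapply s C (low x) i)"
    by (rule hdot_cong) (simp_all add: mapply_M_upper)
  moreover have "hdot s (low y) (low (mapply (r + s) M x)) = hdot s (low y) (\<lambda>j. 1 * mapply r D x j + \<beta> * low x j)"
    by (rule hdot_cong) (simp_all add: mapply_M_lower)
  ultimately show ?thesis unfolding hdot_split hdot_add_scale_right by simp
qed

text \<open>\<open>B e\<close> is twice the off-diagonal block of the Hermitian part of \<open>e\<close> times the matrix.\<close>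

definition B :: "complex \<Rightarrow> nat \<Rightarrow> nat \<Rightarrow> complex" where
  "B e k j = e * C k j + cnj e * cnj (D j k)"

text \<open>By \<open>BB\<close> these are the squared singular values of \<open>B e\<close>, with
  the standard basis as right singular vectors.\<close>

definition sv_sq :: "complex \<Rightarrow> nat \<Rightarrow> real" where
  "sv_sq e j = (cmod e)\<^sup>2 * h j + 2 * Re (e\<^sup>2 * z j)"

lemma BB: 
  assumes i: "i < s" and j: "j < s"
  shows "(\<Sum>k<r. cnj (B e k i) * B e k j) = (if i = j then of_real (sv_sq e j) else 0)"
proof -
  have "(\<Sum>k<r. cnj (B e k i) * B e k j) =
     (\<Sum>k<r. cnj e * e * (cnj (C k i) * C k j) + cnj e * e * (D i k * cnj (D j k))
        + e\<^sup>2 * (D i k * C k j) + cnj (e\<^sup>2 * (D j k * C k i)))"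
    by (intro sum.cong refl) (simp add: B_def power2_eq_square algebra_simps)
  also have "\<dots> = cnj e * e * ((\<Sum>k<r. cnj (C k i) * C k j) + (\<Sum>k<r. D i k * cnj (D j k)))
     + e\<^sup>2 * (\<Sum>k<r. D i k * C k j) + cnj (e\<^sup>2 * (\<Sum>k<r. D j k * C k i))"
    by (simp only: sum.distrib sum_distrib_left distrib_left cnj_sum)
  also have "\<dots> = (if i = j then cnj e * e * of_real (h j) + (e\<^sup>2 * z j + cnj (e\<^sup>2 * z j)) else 0)"
    unfolding DC[OF i j] DC[OF j i] CC_DD[OF i j] by simp
  also have "cnj e * e = of_real ((cmod e)\<^sup>2)" by (metis complex_norm_square mult.commute)
  also have "e\<^sup>2 * z j + cnj (e\<^sup>2 * z j) = of_real (2 * Re (e\<^sup>2 * z j))" by (rule complex_add_cnj)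
  finally show ?thesis unfolding sv_sq_def by (simp only: of_real_add of_real_mult)
qed

lemma B_norm: "hdot r (mapply s (B e) v) (mapply s (B e) v') = (\<Sum>j<s. of_real (sv_sq e j) * cnj (v j) * v' j)"
proof -
  have "hdot r (mapply s (B e) v) (mapply s (B e) v') = (\<Sum>k<r. \<Sum>i<s. \<Sum>j<s. cnj (v i) * v' j * (cnj (B e k i) * B e k j))"
    unfolding hdot_def mapply_def cnj_sum sum_product by (intro sum.cong refl) (simp add: mult_ac)
  also have "\<dots> = (\<Sum>i<s. \<Sum>k<r. \<Sum>j<s. cnj (v i) * v' j * (cnj (B e k i) * B e k j))"
    by (rule sum.swap)
  also have "\<dots> = (\<Sum>i<s. \<Sum>j<s. \<Sum>k<r. cnj (v i) * v' j * (cnj (B e k i) * B e k j))"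
    by (intro sum.cong refl sum.swap)
  also have "\<dots> = (\<Sum>i<s. \<Sum>j<s. if i = j then of_real (sv_sq e j) * cnj (v j) * v' j else 0)"
    unfolding sum_distrib_left[symmetric] by (intro sum.cong refl, simp only: lessThan_iff BB) simp
  finally show ?thesis by simp
qed

lemma sv_sq_nonneg: "j < s \<Longrightarrow> sv_sq e j \<ge> 0"
proof -
  assume j: "j < s"
  have "complex_of_real (\<Sum>k<r. (cmod (B e k j))\<^sup>2) = of_real (sv_sq e j)"
    unfolding of_real_sum complex_norm_square using BB[OF j j, of e] by (simp add: mult.commute)
  then have "(\<Sum>k<r. (cmod (B e k j))\<^sup>2) = sv_sq e j" by (simp only: of_real_eq_iff)
  then show "sv_sq e j \<ge> 0" by (metis sum_nonneg zero_le_power2)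
qed

text \<open>Squared singular values are nonnegative for all e, and the sharpest case is a unit e
  with e^2 z = - |z|. This is what makes the minor axes real.\<close>

lemma z_le_h: "j < s \<Longrightarrow> 2 * cmod (z j) \<le> h j"
proof -
  assume j: "j < s"
  show ?thesis
  proof (cases "z j = 0")
    case True
    then show ?thesis using sv_sq_nonneg[OF j, of 1] unfolding sv_sq_def by simp
  next
    case False
    define e where "e = csqrt (- cnj (z j) / of_real (cmod (z j)))"
    have e2: "e\<^sup>2 = - cnj (z j) / of_real (cmod (z j))" unfolding e_def by simp
    have "(cmod e)\<^sup>2 = cmod (e\<^sup>2)" by (simp add: norm_power)
    also have "\<dots> = 1" unfolding e2 using False by (simp add: norm_divide)
    finally have "(cmod e)\<^sup>2 = 1" .
    moreover have "e\<^sup>2 * z j = - of_real (cmod (z j))"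
      unfolding e2 using False by (simp add: complex_norm_square[symmetric] power2_eq_square mult.commute)
    ultimately show ?thesis using sv_sq_nonneg[OF j, of e] unfolding sv_sq_def by simp
  qed
qed

lemma h_nonneg: "j < s \<Longrightarrow> h j \<ge> 0"
  using z_le_h[of j] norm_ge_zero[of "z j"] by linarith

text \<open>Data of the ellipses in the normalisation of \<open>ellipse_support\<close>: c is the
  common centre, 4 F j is the discriminant \<Delta> j, and 2 K j = |\<alpha> - \<beta>|^2 / 2 + h
  j.\<close>

definition c :: complex where "c = (\<alpha> + \<beta>) / 2"
definition \<delta> :: complex where "\<delta> = (\<alpha> - \<beta>) / 2"
definition K :: "nat \<Rightarrow> real" where "K j = (cmod \<delta>)\<^sup>2 + h j / 2"
definition F :: "nat \<Rightarrow> complex" where "F j = \<delta>\<^sup>2 + z j"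

abbreviation supp :: "nat \<Rightarrow> complex \<Rightarrow> real" where "supp j e \<equiv> ellipse_support (K j) (F j) e"

lemma F_le_K: "j < s \<Longrightarrow> cmod (F j) \<le> K j"
  using norm_triangle_ineq[of "\<delta>\<^sup>2" "z j"] z_le_h[of j] unfolding F_def K_def by (simp add: norm_power)

text \<open>Re (e * c) plus or minus the root of the right-hand side are the eigenvalues of the
  Hermitian 2 x 2 matrix with diagonal Re (e * \<alpha>), Re (e * \<beta>) and off-diagonal entry
  \<open>sqrt (sv_sq e j) / 2\<close>. This is the link between eigenvalues and support
  functions.\<close>

lemma supp_sq:
  assumes j: "j < s"
  shows "(supp j e)\<^sup>2 = (Re (e * \<delta>))\<^sup>2 + sv_sq e j / 4"
proof -
  have "(supp j e)\<^sup>2 = (K j * (cmod e)\<^sup>2 + Re (e\<^sup>2 * F j)) / 2"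
    using F_le_K[OF j] power2_csqrt by (rule ellipse_support_sq)
  also have "\<dots> = ((cmod (e * \<delta>))\<^sup>2 + Re ((e * \<delta>)\<^sup>2)) / 2 + sv_sq e j / 4"
    unfolding K_def F_def sv_sq_def norm_mult power_mult_distrib by (simp add: field_simps)
  finally show ?thesis unfolding Re_sq .
qed

lemma supp_nonneg: "j < s \<Longrightarrow> supp j e \<ge> 0"
  using ellipse_support_nonneg[OF F_le_K power2_csqrt] .

text \<open>Both sides express that Re (e * w) minus the 2 x 2 matrix behind \<open>supp_sq\<close>
  is positive definite, once through its largest eigenvalue and once through leading entry and
  determinant.\<close>

lemma beyond_support_iff:
  assumes j: "j < s"
  shows "supp j e < Re (e * (w - c)) \<longleftrightarrow>
     Re (e * \<alpha>) < Re (e * w) \<and> sv_sq e j / 4 < (Re (e * w) - Re (e * \<alpha>)) * (Re (e * w) - Re (e * \<beta>))"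
proof -
  define R where "R = Re (e * (w - c))"
  define d where "d = Re (e * \<delta>)"
  have a: "Re (e * w) - Re (e * \<alpha>) = R - d" and b: "Re (e * w) - Re (e * \<beta>) = R + d"
    unfolding R_def d_def c_def \<delta>_def by (simp_all add: algebra_simps add_divide_distrib diff_divide_distrib)
  have sq: "(supp j e)\<^sup>2 = d\<^sup>2 + sv_sq e j / 4" using supp_sq[OF j] unfolding d_def .
  have g: "sv_sq e j \<ge> 0" and p: "supp j e \<ge> 0" using sv_sq_nonneg[OF j] supp_nonneg[OF j] by auto
  have prod: "(R - d) * (R + d) = R\<^sup>2 - d\<^sup>2" by (simp add: power2_eq_square algebra_simps)
  have "supp j e < R \<longleftrightarrow> 0 < R - d \<and> sv_sq e j / 4 < (R - d) * (R + d)"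
  proof
    assume l: "supp j e < R"
    have "\<bar>d\<bar> \<le> supp j e" using sq g p by (intro abs_le_square_iff[THEN iffD2, of d "supp j e", simplified abs_of_nonneg[OF p]]) simp
    moreover have "(supp j e)\<^sup>2 < R\<^sup>2" using l p by (simp add: power_strict_mono)
    ultimately show "0 < R - d \<and> sv_sq e j / 4 < (R - d) * (R + d)" unfolding prod using l sq by linarith
  next
    assume A: "0 < R - d \<and> sv_sq e j / 4 < (R - d) * (R + d)"
    then have "0 < (R - d) * (R + d)" using g by linarith
    then have "0 < R + d" using A by (simp add: zero_less_mult_iff)
    then have "0 < R" using A by linarith
    moreover have "(supp j e)\<^sup>2 < R\<^sup>2" using A sq unfolding prod by linarith
    ultimately show "supp j e < R" by (simp add: power2_less_imp_less)
  qed
  moreover have "0 < R - d \<longleftrightarrow> Re (e * \<alpha>) < Re (e * w)"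
    unfolding a[symmetric] by (rule diff_gt_0_iff_gt)
  ultimately show ?thesis by (simp only: a b R_def[symmetric])
qed

lemma Re_form_M: "Re (e * hdot (r + s) x (mapply (r + s) M x)) =
   Re (e * \<alpha>) * (\<Sum>i<r. (cmod (x i))\<^sup>2) + Re (e * \<beta>) * (\<Sum>j<s. (cmod (low x j))\<^sup>2) + Re (hdot r x (mapply s (B e) (low x)))"
proof -
  have 1: "hdot s (low x) (mapply r D x) = cnj (hdot r x (mapply s (\<lambda>i j. cnj (D j i)) (low x)))"
    by (simp only: hdot_mapply_adjoint[of s "low x" r D x] hdot_cnj)
  have "mapply s (B e) (low x) = (\<lambda>i. e * mapply s C (low x) i + cnj e * mapply s (\<lambda>i j. cnj (D j i)) (low x) i)"
    unfolding mapply_def B_def by (simp add: sum.distrib sum_distrib_left algebra_simps)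
  then have 2: "hdot r x (mapply s (B e) (low x)) = e * hdot r x (mapply s C (low x)) + cnj e * hdot r x (mapply s (\<lambda>i j. cnj (D j i)) (low x))"
    by (simp add: hdot_add_scale_right)
  have 3: "Re (e * cnj y) = Re (cnj e * y)" for y by simp
  have "Re (e * hdot (r + s) x (mapply (r + s) M x)) = Re (e * \<alpha> * hdot r x x) + Re (e * \<beta> * hdot s (low x) (low x))
     + Re (e * hdot r x (mapply s C (low x))) + Re (cnj e * hdot r x (mapply s (\<lambda>i j. cnj (D j i)) (low x)))"
    unfolding form_M 1 by (simp only: distrib_left plus_complex.simps 3 mult.assoc[symmetric])
  then show ?thesis unfolding 2 hdot_self by simp
qed

section \<open>Necessary conditions for membership in the rank numerical range\<close>

text \<open>With fewer than k indices in the set G below, the compression space would contain a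
  nonzero vector whose lower coordinates vanish on G. On such vectors the Hermitian part of e (w -
  M) is positive definite: completing the square in the upper part leaves a diagonal form in the
  lower part, because the columns of \<open>B e\<close> are orthogonal.\<close>

lemma rank_range_imp_supports:
  assumes R: "in_rank_range (r + s) k M w" and k: "k \<le> s"
  shows "k \<le> card {j. j < s \<and> Re (e * (w - c)) \<le> supp j e}"
proof (rule ccontr)
  define G where "G = {j. j < s \<and> Re (e * (w - c)) \<le> supp j e}"
  assume "\<not> ?thesis"
  then have less: "card G < k" unfolding G_def by simp
  have finG: "finite G" unfolding G_def by simp
  obtain \<sigma> where \<sigma>: "bij_betw \<sigma> {..<card G} G" using ex_bij_betw_nat_finite[OF finG] by (auto simp: lessThan_atLeast0)
  obtain x where x: "\<exists>i<r + s. x i \<noteq> 0" "\<forall>m<card G. hdot (r + s) (\<lambda>i. if i = r + \<sigma> m then 1 else 0) x = 0"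
     "hdot (r + s) x (mapply (r + s) M x) = w * hdot (r + s) x x"
    using in_rank_range_constrained[OF R less, of "\<lambda>m i. if i = r + \<sigma> m then 1 else 0"] by blast
  have vG: "low x j = 0" if jG: "j \<in> G" for j
  proof -
    obtain m where m: "m < card G" "j = \<sigma> m" using \<sigma> jG unfolding bij_betw_def by auto
    have "j < s" using jG unfolding G_def by simp
    moreover have "hdot (r + s) (\<lambda>i. if i = r + j then 1 else 0) x = (if r + j < r + s then x (r + j) else 0)"
      unfolding hdot_def by (simp add: if_distrib[of cnj] if_distrib[of "\<lambda>y. y * _"] cong: if_cong)
    ultimately show ?thesis using x(2) m by auto
  qed
  define p where "p = Re (e * w) - Re (e * \<alpha>)"
  define q where "q = Re (e * w) - Re (e * \<beta>)"
  have bad: "p > 0 \<and> sv_sq e j / 4 < p * q" if "j < s" "j \<notin> G" for j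
    using that beyond_support_iff[OF that(1), of e w] unfolding G_def p_def q_def by auto
  \<comment> \<open>G is too small to contain all s indices, and any index outside it yields p > 0,
    on which completing the square relies.\<close>
  obtain j0 where j0: "j0 < s" "j0 \<notin> G"
  proof -
    have "\<not> {..<s} \<subseteq> G" using card_mono[OF finG, of "{..<s}"] less k by auto
    then show ?thesis using that by auto
  qed
  have p: "p > 0" using bad[OF j0] by simp
  define U where "U = (\<Sum>i<r. (cmod (x i))\<^sup>2)"
  define V where "V = (\<Sum>j<s. (cmod (low x j))\<^sup>2)"
  define Y where "Y = mapply s (B e) (low x)"
  have hself: "hdot (r + s) x x = of_real (U + V)"
    by (simp only: hdot_split hdot_self[of r] hdot_self[of s] U_def V_def of_real_add)
  have eq: "Re (hdot r x Y) = p * U + q * V"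
  proof -
    have "Re (e * (w * hdot (r + s) x x)) = Re (e * w) * (U + V)" unfolding hself by (simp add: mult.assoc[symmetric])
    then show ?thesis using Re_form_M[of e x] x(3) unfolding U_def[symmetric] V_def[symmetric] Y_def p_def q_def
      by (simp add: algebra_simps)
  qed
  have YY: "(\<Sum>i<r. (cmod (Y i))\<^sup>2) = (\<Sum>j<s. sv_sq e j * (cmod (low x j))\<^sup>2)"
  proof -
    have "complex_of_real (\<Sum>i<r. (cmod (Y i))\<^sup>2) = (\<Sum>j<s. of_real (sv_sq e j) * cnj (low x j) * low x j)"
      unfolding hdot_self[symmetric] Y_def by (rule B_norm)
    also have "\<dots> = complex_of_real (\<Sum>j<s. sv_sq e j * (cmod (low x j))\<^sup>2)"
      unfolding of_real_sum by (intro sum.cong refl) (simp add: complex_norm_square mult_ac del: of_real_power)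
    finally show ?thesis by (simp only: of_real_eq_iff)
  qed
  \<comment> \<open>Up to the factor 4 p this is the square that completes p U - Re (hdot r x
    Y).\<close>
  have "0 \<le> (\<Sum>i<r. (cmod (of_real (2 * p) * x i - Y i))\<^sup>2)" by (intro sum_nonneg) simp
  also have "\<dots> = 4 * p\<^sup>2 * U - 4 * p * Re (hdot r x Y) + (\<Sum>i<r. (cmod (Y i))\<^sup>2)"
  proof -
    have "(cmod (of_real (2 * p) * x i - Y i))\<^sup>2 = 4 * p\<^sup>2 * (cmod (x i))\<^sup>2 - 4 * p * Re (cnj (x i) * Y i) + (cmod (Y i))\<^sup>2" for i
      unfolding cmod_power2 by (simp add: power2_eq_square algebra_simps)
    then show ?thesis unfolding U_def hdot_def
      by (simp only: sum.distrib sum_subtractf sum_distrib_left Re_sum)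
  qed
  also have "\<dots> = (\<Sum>j<s. sv_sq e j * (cmod (low x j))\<^sup>2) - 4 * p * q * V"
    unfolding eq YY by (simp add: power2_eq_square algebra_simps)
  also have "\<dots> = - (\<Sum>j<s. (4 * (p * q) - sv_sq e j) * (cmod (low x j))\<^sup>2)"
    unfolding V_def by (simp add: sum_distrib_left sum_subtractf algebra_simps)
  finally have le: "(\<Sum>j<s. (4 * (p * q) - sv_sq e j) * (cmod (low x j))\<^sup>2) \<le> 0" by simp
  have nn: "(4 * (p * q) - sv_sq e j) * (cmod (low x j))\<^sup>2 \<ge> 0" if "j < s" for j
    using bad[OF that] vG[of j] by (cases "j \<in> G") auto
  have all0: "\<forall>j\<in>{..<s}. (4 * (p * q) - sv_sq e j) * (cmod (low x j))\<^sup>2 = 0"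
    using le nn by (subst sum_nonneg_eq_0_iff[symmetric]) (auto intro!: antisym sum_nonneg)
  have v0: "low x j = 0" if "j < s" for j
    using bad[OF that] vG[of j] that bspec[OF all0, of j] by (cases "j \<in> G") auto
  then have "V = 0" "Y = (\<lambda>_. 0)" unfolding V_def Y_def mapply_def by auto
  then have "U = 0" using eq p unfolding hdot_def by simp
  then have u0: "x i = 0" if "i < r" for i
    using that unfolding U_def by (subst (asm) sum_nonneg_eq_0_iff) auto
  obtain i where "i < r + s" "x i \<noteq> 0" using x(1) by blast
  then show False using u0[of i] v0[of "i - r"] by (cases "i < r") (auto simp: not_less less_diff_conv2)
qed

text \<open>For k > s the compression space contains a nonzero vector without lower part, on which
  the form is \<alpha> times the squared norm; for k > r it contains one without upper part, on
  which the form is \<beta> times the squared norm.\<close>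

lemma rank_range_large:
  assumes R: "in_rank_range (r + s) k M w"
  shows "s < k \<Longrightarrow> w = \<alpha>" and "r < k \<Longrightarrow> w = \<beta>"
proof -
  have unit: "hdot (r + s) (\<lambda>i. if i = l then 1 else 0) x = x l" if "l < r + s" for x l
    unfolding hdot_def using that by (simp add: if_distrib[of cnj] if_distrib[of "\<lambda>y. y * _"] cong: if_cong)
  show "w = \<alpha>" if sk: "s < k"
  proof -
    obtain x where x: "\<exists>i<r + s. x i \<noteq> 0" "\<forall>m<s. hdot (r + s) (\<lambda>i. if i = r + m then 1 else 0) x = 0"
     "hdot (r + s) x (mapply (r + s) M x) = w * hdot (r + s) x x"
      using in_rank_range_constrained[OF R sk, of "\<lambda>m i. if i = r + m then 1 else 0"] by blast
    have v0: "low x j = 0" if "j < s" for j using x(2) unit[of "r + j" x] that by auto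
    have "hdot r x (mapply s C (low x)) = 0" "hdot s (low x) (mapply r D x) = 0" "hdot s (low x) (low x) = 0"
      unfolding hdot_def mapply_def using v0 by auto
    then have "\<alpha> * hdot r x x = w * hdot r x x" using x(3) unfolding form_M hdot_split[of x x] by simp
    moreover have "hdot r x x \<noteq> 0"
    proof
      assume "hdot r x x = 0"
      then have "\<forall>i<r. x i = 0" by (simp add: hdot_self_eq_0)
      moreover obtain i where "i < r + s" "x i \<noteq> 0" using x(1) by blast
      ultimately show False using v0[of "i - r"] by (cases "i < r") (auto simp: not_less less_diff_conv2)
    qed
    ultimately show ?thesis by simp
  qed
  show "w = \<beta>" if rk: "r < k"
  proof -
    obtain x where x: "\<exists>i<r + s. x i \<noteq> 0" "\<forall>m<r. hdot (r + s) (\<lambda>i. if i = m then 1 else 0) x = 0"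
     "hdot (r + s) x (mapply (r + s) M x) = w * hdot (r + s) x x"
      using in_rank_range_constrained[OF R rk, of "\<lambda>m i. if i = m then 1 else 0"] by blast
    have u0: "x i = 0" if "i < r" for i using x(2) unit[of i x] that by auto
    have "hdot r x (mapply s C (low x)) = 0" "hdot s (low x) (mapply r D x) = 0" "hdot r x x = 0"
      unfolding hdot_def mapply_def using u0 by auto
    then have "\<beta> * hdot s (low x) (low x) = w * hdot s (low x) (low x)" using x(3) unfolding form_M hdot_split[of x x] by simp
    moreover have "hdot s (low x) (low x) \<noteq> 0"
    proof
      assume "hdot s (low x) (low x) = 0"
      then have "\<forall>j<s. low x j = 0" by (simp add: hdot_self_eq_0)
      moreover obtain i where "i < r + s" "x i \<noteq> 0" using x(1) by blast
      ultimately show False using u0[of i] by (cases "i < r") (auto dest: spec[of _ "i - r"])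
    qed
    ultimately show ?thesis by simp
  qed
qed

lemma alpha_in_rank_range: "k \<le> r \<Longrightarrow> in_rank_range (r + s) k M \<alpha>"
proof (rule in_rank_rangeI[of _ _ "\<lambda>p i. if p = i then 1 else 0"])
  assume k: "k \<le> r"
  show "independent_funs (r + s) k (\<lambda>p i. if p = i then 1 else 0)"
    by (rule independent_standard_basis) (use k in simp)
  fix p q assume pq: "p < k" "q < k"
  have "mapply s C (low (\<lambda>i. if q = i then 1 else 0)) = (\<lambda>_. 0)"
    using pq k unfolding mapply_def by (auto intro!: sum.neutral)
  moreover have "hdot s (low (\<lambda>i. if p = i then 1 else 0)) y = 0" for y
    using pq k unfolding hdot_def by (auto intro!: sum.neutral)
  ultimately show "hdot (r + s) (\<lambda>i. if p = i then 1 else 0) (mapply (r + s) M (\<lambda>i. if q = i then 1 else 0)) =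
     \<alpha> * hdot (r + s) (\<lambda>i. if p = i then 1 else 0) (\<lambda>i. if q = i then 1 else 0)"
    unfolding form_M hdot_split[of "\<lambda>i. if p = i then 1 else 0" "\<lambda>i. if q = i then 1 else 0"]
    by (simp add: hdot_def)
qed

end

section \<open>Congruence to two-dimensional blocks, and ranks above r\<close>

context commuting_blocks
begin

text \<open>Polar decomposition of \<open>B e\<close>. Its nonzero columns are orthogonal and get
  normalised; columns with \<open>sv_sq e j = 0\<close> vanish, and s \<le> r leaves room for unit
  vectors in their place.\<close>

lemma polar_columns:
  "\<exists>q. (\<forall>i<s. \<forall>j<s. hdot r (q i) (q j) = (if i = j then 1 else 0)) \<and>
       (\<forall>j<s. \<forall>i<r. B e i j = of_real (sqrt (sv_sq e j)) * q j i)"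
proof -
  \<comment> \<open>Columns with a positive singular value are settled from the start, and the
    induction on l settles the others. Each new unit vector is made orthogonal to all s - 1 other
    columns, settled or not, which is possible as s - 1 < r.\<close>
  define P where "P = (\<lambda>l q. (\<forall>i<s. \<forall>j<s. (sv_sq e i > 0 \<or> i < l) \<and> (sv_sq e j > 0 \<or> j < l) \<longrightarrow>
        hdot r (q i) (q j) = (if i = j then 1 else 0)) \<and>
      (\<forall>i<s. sv_sq e i > 0 \<longrightarrow> q i = (\<lambda>k. B e k i / of_real (sqrt (sv_sq e i)))))"
  have "\<exists>q. P l q" if "l \<le> s" for l
    using that
  proof (induction l)
    case 0
    have "hdot r (\<lambda>k. B e k i / of_real (sqrt (sv_sq e i))) (\<lambda>k. B e k j / of_real (sqrt (sv_sq e j))) = (if i = j then 1 else 0)"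
      if ij: "i < s" "j < s" "sv_sq e i > 0" "sv_sq e j > 0" for i j
    proof -
      have "hdot r (\<lambda>k. B e k i / of_real (sqrt (sv_sq e i))) (\<lambda>k. B e k j / of_real (sqrt (sv_sq e j))) =
        (\<Sum>k<r. cnj (B e k i) * B e k j) / of_real (sqrt (sv_sq e i) * sqrt (sv_sq e j))"
        unfolding hdot_def by (simp add: sum_divide_distrib)
      then show ?thesis unfolding BB[OF ij(1,2)] using ij by (simp flip: of_real_mult)
    qed
    then show ?case unfolding P_def
      by (intro exI[of _ "\<lambda>i k. B e k i / of_real (sqrt (sv_sq e i))"]) auto
  next
    case (Suc l)
    then obtain q where q: "P l q" by auto
    show ?case
    proof (cases "sv_sq e l > 0")
      case True
      then have "P (Suc l) q" using q unfolding P_def by (auto simp: less_Suc_eq)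
      then show ?thesis by blast
    next
      case False
      define x where "x = (\<lambda>m. if m < l then q m else q (Suc m))"
      have "s - 1 < r" using Suc.prems s_le_r by linarith
      from exists_unit_orthogonal[OF independent_standard_basis[OF order_refl] this, of x]
      obtain u where u: "hdot r u u = 1" "\<forall>m<s - 1. hdot r (x m) u = 0" by blast
      have qu: "hdot r (q i) u = 0" if "i < s" "i \<noteq> l" for i
      proof (cases "i < l")
        case True
        then show ?thesis using u(2)[rule_format, of i] Suc.prems unfolding x_def by auto
      next
        case False
        then have "0 < i" "i - 1 < s - 1" "\<not> i - 1 < l" using that by auto
        then show ?thesis using u(2)[rule_format, of "i - 1"] unfolding x_def by auto
      qed
      have uq: "hdot r u (q i) = 0" if "i < s" "i \<noteq> l" for i
        using qu[OF that] by (metis hdot_cnj complex_cnj_zero)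
      have "P (Suc l) (q(l := u))"
        unfolding P_def
      proof (intro conjI allI impI)
        fix i j assume ij: "i < s" "j < s" "(sv_sq e i > 0 \<or> i < Suc l) \<and> (sv_sq e j > 0 \<or> j < Suc l)"
        then show "hdot r ((q(l := u)) i) ((q(l := u)) j) = (if i = j then 1 else 0)"
          using q u(1) qu[of i] uq[of j] unfolding P_def
          by (cases "i = l"; cases "j = l") (auto simp: less_Suc_eq)
      next
        fix i assume "i < s" "sv_sq e i > 0"
        then show "(q(l := u)) i = (\<lambda>k. B e k i / of_real (sqrt (sv_sq e i)))"
          using q False unfolding P_def by auto
      qed
      then show ?thesis by blast
    qed
  qed
  then obtain q where q: "P s q" by blast
  have "B e i j = of_real (sqrt (sv_sq e j)) * q j i" if j: "j < s" and i: "i < r" for i j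
  proof (cases "sv_sq e j > 0")
    case True
    then have "q j = (\<lambda>k. B e k j / of_real (sqrt (sv_sq e j)))" using q j unfolding P_def by simp
    then show ?thesis using True by simp
  next
    case False
    then have g0: "sv_sq e j = 0" using sv_sq_nonneg[OF j, of e] by simp
    have "hdot r (\<lambda>k. B e k j) (\<lambda>k. B e k j) = 0"
      unfolding hdot_def using BB[OF j j, of e] g0 by simp
    then show ?thesis using i g0 by (simp add: hdot_self_eq_0)
  qed
  then show ?thesis using q unfolding P_def by blast
qed

text \<open>Lower right entry of the j-th block of e (M - w) after the congruence. The term \<i> e^2
  z comes from eliminating the lower left block and uses that D C is diagonal.\<close>

definition \<tau> :: "complex \<Rightarrow> complex \<Rightarrow> nat \<Rightarrow> complex" where
  "\<tau> w e j = \<i> * e\<^sup>2 * z j + e * (\<beta> - w)"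

text \<open>The slope m belongs to the direction (m + \<i>) e. Because e (\<alpha> - w) = \<i>, the
  leading entry in \<open>beyond_support_iff\<close> is 1 in this direction, and the determinant is
  exactly \<open>lower_envelope\<close>.\<close>

lemma lower_envelope_bad:
  assumes j: "j < s" and e: "e * (\<alpha> - w) = \<i>" and pos: "lower_envelope (sv_sq e j) (\<tau> w e j) m > 0"
  shows "supp j (Complex m 1 * e) < Re (Complex m 1 * e * (w - c))"
proof -
  define Z where "Z = e\<^sup>2 * z j"
  define b where "b = e * (\<beta> - w)"
  define H where "H = (cmod e)\<^sup>2 * h j"
  have "Re (Complex m 1 * e * w) - Re (Complex m 1 * e * \<alpha>) = - Re (Complex m 1 * (e * (\<alpha> - w)))"
    by (simp add: algebra_simps)
  then have 1: "Re (Complex m 1 * e * w) - Re (Complex m 1 * e * \<alpha>) = 1" unfolding e by simp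
  have "Re (Complex m 1 * e * w) - Re (Complex m 1 * e * \<beta>) = - Re (Complex m 1 * b)"
    unfolding b_def by (simp add: algebra_simps)
  then have 2: "Re (Complex m 1 * e * w) - Re (Complex m 1 * e * \<beta>) = Im b - m * Re b" by simp
  have "(Complex m 1)\<^sup>2 = Complex (m\<^sup>2 - 1) (2 * m)" by (simp add: complex_eq_iff power2_eq_square)
  then have "(Complex m 1 * e)\<^sup>2 * z j = Complex (m\<^sup>2 - 1) (2 * m) * Z"
    unfolding Z_def power_mult_distrib by (simp add: mult.assoc)
  moreover have "(cmod (Complex m 1 * e))\<^sup>2 * h j = (m\<^sup>2 + 1) * H"
    unfolding H_def norm_mult power_mult_distrib by (simp add: cmod_power2)
  ultimately have 3: "sv_sq (Complex m 1 * e) j = (m\<^sup>2 + 1) * H + 2 * ((m\<^sup>2 - 1) * Re Z - 2 * m * Im Z)"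
    unfolding sv_sq_def by simp
  have "sv_sq e j = H + 2 * Re Z" "\<tau> w e j = \<i> * Z + b"
    unfolding sv_sq_def H_def Z_def \<tau>_def b_def by (simp_all add: mult.assoc)
  then have "sv_sq (Complex m 1 * e) j / 4 < Im b - m * Re b"
    using pos unfolding 3 lower_envelope_def by (simp add: field_simps)
  then have "sv_sq (Complex m 1 * e) j / 4 < (Re (Complex m 1 * e * w) - Re (Complex m 1 * e * \<alpha>)) *
      (Re (Complex m 1 * e * w) - Re (Complex m 1 * e * \<beta>))"
    by (simp only: 1 2 mult_1_left)
  moreover have "Re (Complex m 1 * e * \<alpha>) < Re (Complex m 1 * e * w)" using 1 by linarith
  ultimately show ?thesis unfolding beyond_support_iff[OF j] by blast
qed

lemma supports_imp_rank_range:
  assumes k: "k \<le> s" and sup: "\<And>e. k \<le> card {j. j < s \<and> Re (e * (w - c)) \<le> supp j e}"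
  shows "in_rank_range (r + s) k M w"
proof (cases "w = \<alpha>")
  case True
  then show ?thesis using alpha_in_rank_range k s_le_r by simp
next
  case False
  define e where "e = \<i> / (\<alpha> - w)"
  have e: "e * (\<alpha> - w) = \<i>" and e0: "e \<noteq> 0" using False unfolding e_def by auto
  define g where "g = sv_sq e"
  define t where "t = \<tau> w e"
  have g_nn: "g j \<ge> 0" if "j < s" for j using sv_sq_nonneg[OF that] unfolding g_def .
  have "\<exists>x. isotropic_blocks s g t k x"
  proof (rule exists_isotropic_blocks)
    fix j assume j: "j < s" and "g j = 0"
    \<comment> \<open>A vanishing singular value forces e^2 z j to be real and nonpositive, so \<i>
      e^2 z j does not affect the real part of \<open>t j\<close>. Hence the common value \<rho> =
      Re (e (\<beta> - w)).\<close>
    then have "(cmod e)\<^sup>2 * h j + 2 * Re (e\<^sup>2 * z j) = 0" unfolding g_def sv_sq_def by simp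
    moreover have "2 * cmod (e\<^sup>2 * z j) \<le> (cmod e)\<^sup>2 * h j"
      using mult_left_mono[OF z_le_h[OF j], of "(cmod e)\<^sup>2"] by (simp add: norm_mult norm_power)
    ultimately have "cmod (e\<^sup>2 * z j) \<le> - Re (e\<^sup>2 * z j)" by linarith
    then have "(cmod (e\<^sup>2 * z j))\<^sup>2 \<le> (Re (e\<^sup>2 * z j))\<^sup>2"
      by (metis norm_ge_zero power2_minus power_mono)
    then have "Im (e\<^sup>2 * z j) = 0" unfolding cmod_power2 by simp
    then show "Re (t j) = Re (e * (\<beta> - w))" unfolding t_def \<tau>_def by (simp add: mult.assoc)
  next
    fix m
    define G where "G = {j. j < s \<and> Re (Complex m 1 * e * (w - c)) \<le> supp j (Complex m 1 * e)}"
    have "{j. j < s \<and> lower_envelope (g j) (t j) m > 0} \<subseteq> {..<s} - G"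
    proof
      fix j assume j: "j \<in> {j. j < s \<and> lower_envelope (g j) (t j) m > 0}"
      then have "supp j (Complex m 1 * e) < Re (Complex m 1 * e * (w - c))"
        by (intro lower_envelope_bad[OF _ e]) (auto simp: g_def t_def)
      then show "j \<in> {..<s} - G" using j unfolding G_def by (simp add: not_le)
    qed
    then have "card {j. j < s \<and> lower_envelope (g j) (t j) m > 0} \<le> card ({..<s} - G)"
      by (intro card_mono) auto
    also have "\<dots> = s - card G" by (subst card_Diff_subset) (auto simp: G_def)
    also have "\<dots> \<le> s - k" using sup[of "Complex m 1 * e"] unfolding G_def by linarith
    finally show "card {j. j < s \<and> lower_envelope (g j) (t j) m > 0} \<le> s - k" .
  qed (use g_nn k in auto)
  then obtain x :: "nat \<Rightarrow> nat \<Rightarrow> complex \<times> complex" where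
      x: "\<And>p q. p < k \<Longrightarrow> q < k \<Longrightarrow> (\<Sum>j<s. block_form (g j) (t j) (x p j) (x q j)) = 0"
      and ind: "\<And>c. (\<forall>j<s. (\<Sum>p<k. c p * fst (x p j)) = 0 \<and> (\<Sum>p<k. c p * snd (x p j)) = 0) \<Longrightarrow> (\<forall>p<k. c p = 0)"
    unfolding isotropic_blocks_def by (elim exE conjE) blast
  obtain q where q: "\<And>i j. i < s \<Longrightarrow> j < s \<Longrightarrow> hdot r (q i) (q j) = (if i = j then 1 else 0)"
      and Bq: "\<And>i j. j < s \<Longrightarrow> i < r \<Longrightarrow> B e i j = of_real (sqrt (g j)) * q j i"
    using polar_columns[of e] unfolding g_def by blast
  define Dadj where "Dadj = (\<lambda>v. mapply s (\<lambda>i j. cnj (D j i)) v)"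
  define y where "y = (\<lambda>p j. fst (x p j))"
  define v where "v = (\<lambda>p j. snd (x p j))"
  \<comment> \<open>With this first component the lower left entries of the transformed blocks vanish, because \<open>e * (\<alpha> - w) = \<i>\<close>.\<close>
  define u where "u = (\<lambda>p i. 1 * lincomb_fun s (y p) q i + (- \<i> * cnj e) * Dadj (v p) i)"
  define Y where "Y = (\<lambda>p i. if i < r then u p i else v p (i - r))"
  have lowY: "low (Y p) = v p" for p unfolding Y_def by auto
  have Yu: "hdot r (Y p) a = hdot r (u p) a" "hdot r a (Y p) = hdot r a (u p)"
    "mapply r D (Y p) = mapply r D (u p)" for p a
    unfolding hdot_def mapply_def Y_def by auto
  have orth: "hdot r (lincomb_fun s a q) (lincomb_fun s b q) = (\<Sum>j<s. cnj (a j) * b j)" for a b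
  proof -
    have "hdot r (lincomb_fun s a q) (lincomb_fun s b q) = (\<Sum>j<s. \<Sum>i<s. b j * (cnj (a i) * hdot r (q i) (q j)))"
      unfolding hdot_lincomb_right hdot_lincomb_left sum_distrib_left ..
    also have "\<dots> = (\<Sum>j<s. \<Sum>i<s. if i = j then cnj (a j) * b j else 0)"
      by (intro sum.cong refl) (simp add: q)
    finally show ?thesis by simp
  qed
  have "independent_funs (r + s) k Y"
    unfolding independent_funs_def
  proof (intro allI impI)
    fix cc p assume cc: "\<forall>i<r + s. lincomb_fun k cc Y i = 0" and p: "p < k"
    have v0: "(\<Sum>p<k. cc p * v p j) = 0" if "j < s" for j
      using cc[rule_format, of "r + j"] that unfolding lincomb_fun_def Y_def by simp
    define b where "b = (\<lambda>j. \<Sum>p<k. cc p * y p j)"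
    have Dv: "lincomb_fun k cc (\<lambda>p. Dadj (v p)) = (\<lambda>_. 0)"
      unfolding Dadj_def mapply_lincomb[symmetric] unfolding mapply_def lincomb_fun_def by (simp add: v0)
    have "lincomb_fun s b q i = 0" if i: "i < r" for i
    proof -
      have "0 = lincomb_fun k cc Y i" using cc i by simp
      also have "\<dots> = (\<Sum>p<k. cc p * lincomb_fun s (y p) q i) + (- \<i> * cnj e) * lincomb_fun k cc (\<lambda>p. Dadj (v p)) i"
        unfolding lincomb_fun_def[of k] Y_def u_def using i
        by (simp add: sum.distrib sum_subtractf sum_distrib_left sum_negf algebra_simps)
      also have "\<dots> = (\<Sum>p<k. cc p * lincomb_fun s (y p) q i)" unfolding Dv by simp
      also have "\<dots> = lincomb_fun s b q i"
        unfolding b_def lincomb_fun_def sum_distrib_left sum_distrib_right by (subst sum.swap) (simp add: mult_ac)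
      finally show ?thesis by simp
    qed
    then have "hdot r (lincomb_fun s b q) (lincomb_fun s b q) = 0" by (simp add: hdot_self_eq_0)
    then have "hdot s b b = 0" by (simp only: orth hdot_def[of s])
    then have "b j = 0" if "j < s" for j using that by (simp add: hdot_self_eq_0)
    then have "\<forall>p<k. cc p = 0" using v0 unfolding b_def y_def v_def by (intro ind) auto
    then show "cc p = 0" using p by simp
  qed
  then show ?thesis
  proof (rule in_rank_rangeI)
    fix p p' assume pp: "p < k" "p' < k"
    \<comment> \<open>Upper part of e (M - w) applied to the second vector. The summand of
      \<open>u\<close> with \<open>Dadj\<close> completes e C to \<open>B e\<close>, so by the polar
      decomposition its coefficients in the system q are \<open>tt\<close>, the first rows of the
      blocks.\<close>
    define row where "row = (\<lambda>i. \<i> * u p' i + e * mapply s C (v p') i)"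
    define tt where "tt = (\<lambda>j. \<i> * y p' j + of_real (sqrt (g j)) * v p' j)"
    have row: "row i = lincomb_fun s tt q i" if i: "i < r" for i
    proof -
      have "row i = \<i> * lincomb_fun s (y p') q i + (cnj e * Dadj (v p') i + e * mapply s C (v p') i)"
        unfolding row_def u_def by (simp add: algebra_simps)
      also have "cnj e * Dadj (v p') i + e * mapply s C (v p') i = mapply s (B e) (v p') i"
        unfolding Dadj_def mapply_def B_def by (simp add: sum.distrib sum_distrib_left algebra_simps)
      also have "\<dots> = lincomb_fun s (\<lambda>j. of_real (sqrt (g j)) * v p' j) q i"
        unfolding mapply_def lincomb_fun_def using i by (intro sum.cong refl) (simp add: Bq mult_ac)
      also have "\<i> * lincomb_fun s (y p') q i + \<dots> = lincomb_fun s tt q i"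
        unfolding tt_def lincomb_fun_def by (simp add: sum.distrib sum_distrib_left algebra_simps)
      finally show ?thesis .
    qed
    have "hdot r (u p) row = hdot r (lincomb_fun s (y p) q) row + cnj (- \<i> * cnj e) * hdot r (Dadj (v p)) row"
      unfolding u_def hdot_add_scale_left by simp
    also have "hdot r (lincomb_fun s (y p) q) row = (\<Sum>j<s. cnj (y p j) * tt j)"
      unfolding orth[symmetric] by (rule hdot_cong) (simp_all add: row)
    also have "hdot r (Dadj (v p)) row = hdot s (v p) (mapply r D row)"
      unfolding hdot_mapply_adjoint Dadj_def ..
    finally have R1: "hdot r (u p) row = (\<Sum>j<s. cnj (y p j) * tt j) + \<i> * e * hdot s (v p) (mapply r D row)" by simp
    \<comment> \<open>Since \<i> * \<i> * u + u = 0, only \<i> e D C v survives. This is where the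
      lower left entries cancel.\<close>
    have rowD: "\<i> * mapply r D row j + mapply r D (u p') j = \<i> * e * z j * v p' j" if j: "j < s" for j
    proof -
      have "\<i> * mapply r D row j + mapply r D (u p') j = mapply r D (\<lambda>i. \<i> * row i + 1 * u p' i) j"
        unfolding mapply_add_scale by simp
      also have "(\<lambda>i. \<i> * row i + 1 * u p' i) = (\<lambda>i. \<i> * e * mapply s C (v p') i + 0 * 0)"
        unfolding row_def by (simp add: algebra_simps)
      also have "mapply r D \<dots> j = \<i> * e * mapply r D (mapply s C (v p')) j"
        by (simp add: mapply_add_scale[of r D _ _ 0 "\<lambda>_. 0", simplified])
      also have "mapply r D (mapply s C (v p')) j = (\<Sum>l<s. (\<Sum>i<r. D j i * C i l) * v p' l)"
        unfolding mapply_def sum_distrib_left sum_distrib_right by (subst sum.swap) (simp add: mult_ac)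
      also have "\<dots> = (\<Sum>l<s. if l = j then z j * v p' j else 0)"
        by (intro sum.cong refl) (use j DC in auto)
      finally show ?thesis using j by (simp add: mult_ac)
    qed
    have "\<i> * (cnj (v p j) * mapply r D row j) + cnj (v p j) * mapply r D (u p') j = \<i> * e * z j * cnj (v p j) * v p' j"
      if "j < s" for j
    proof -
      have "\<i> * (cnj (v p j) * mapply r D row j) + cnj (v p j) * mapply r D (u p') j =
          cnj (v p j) * (\<i> * mapply r D row j + mapply r D (u p') j)" by (simp add: algebra_simps)
      then show ?thesis unfolding rowD[OF that] by (simp add: mult_ac)
    qed
    then have R2: "\<i> * hdot s (v p) (mapply r D row) + hdot s (v p) (mapply r D (u p')) = (\<Sum>j<s. \<i> * e * z j * cnj (v p j) * v p' j)"
      unfolding hdot_def sum_distrib_left sum.distrib[symmetric]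
      by (intro sum.cong refl) (simp only: lessThan_iff)
    have "e * (hdot (r + s) (Y p) (mapply (r + s) M (Y p')) - w * hdot (r + s) (Y p) (Y p')) =
        (e * (\<alpha> - w)) * hdot r (u p) (u p') + e * hdot r (u p) (mapply s C (v p')) +
        e * hdot s (v p) (mapply r D (u p')) + e * (\<beta> - w) * hdot s (v p) (v p')"
      unfolding form_M hdot_split[of "Y p" "Y p'"] lowY Yu by (simp add: algebra_simps)
    also have "(e * (\<alpha> - w)) * hdot r (u p) (u p') + e * hdot r (u p) (mapply s C (v p')) = hdot r (u p) row"
      unfolding e row_def hdot_add_scale_right ..
    also have "hdot r (u p) row + e * hdot s (v p) (mapply r D (u p')) =
        (\<Sum>j<s. cnj (y p j) * tt j) + e * (\<i> * hdot s (v p) (mapply r D row) + hdot s (v p) (mapply r D (u p')))"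
      unfolding R1 by (simp add: algebra_simps)
    also have "\<dots> + e * (\<beta> - w) * hdot s (v p) (v p') = (\<Sum>j<s. block_form (g j) (t j) (x p' j) (x p j))"
      unfolding R2 unfolding hdot_def sum_distrib_left sum.distrib[symmetric]
      by (intro sum.cong refl)
        (simp add: block_form_def tt_def t_def \<tau>_def y_def v_def power2_eq_square algebra_simps)
    also have "\<dots> = 0" using x pp by blast
    finally show "hdot (r + s) (Y p) (mapply (r + s) M (Y p')) = w * hdot (r + s) (Y p) (Y p')"
      using e0 by simp
  qed
qed

text \<open>
  If \<open>h j \<noteq> 0\<close>, then \<open>sv_sq e j\<close> vanishes at most for one value of \<open>e\<^sup>2 / (cmod e)\<^sup>2\<close>.
\<close>

lemma generic_direction: "\<exists>e. \<forall>j<s. h j \<noteq> 0 \<longrightarrow> sv_sq e j > 0"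
proof -
  \<comment> \<open>For e^2 = 1 + \<i> t the imaginary part of e^2 z is Im z + t Re z, so avoiding
    these quotients keeps it nonzero when Re z \<noteq> 0. For Re z = 0 the quotient is 0 by
    convention, and the imaginary part is Im z whatever t is.\<close>
  have "\<exists>t::real. t \<notin> (\<lambda>j. - Im (z j) / Re (z j)) ` {..<s}"
    by (rule ex_new_if_finite) (auto simp: infinite_UNIV_char_0)
  then obtain t where t: "\<And>j. j < s \<Longrightarrow> t \<noteq> - Im (z j) / Re (z j)" by auto
  define e where "e = csqrt (Complex 1 t)"
  have e2: "e\<^sup>2 = Complex 1 t" unfolding e_def by simp
  have "sv_sq e j > 0" if j: "j < s" and hj: "h j \<noteq> 0" for j
  proof -
    have "e \<noteq> 0" using e2 by (auto simp: complex_eq_iff)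
    then have ne: "(cmod e)\<^sup>2 > 0" by simp
    have nz: "(cmod e)\<^sup>2 * (2 * cmod (z j)) \<le> (cmod e)\<^sup>2 * h j"
      using z_le_h[OF j] by (intro mult_left_mono) auto
    show ?thesis
    proof (cases "z j = 0")
      case True
      then show ?thesis using ne h_nonneg[OF j] hj unfolding sv_sq_def by simp
    next
      case False
      have "Im (e\<^sup>2 * z j) \<noteq> 0"
      proof (cases "Re (z j) = 0")
        case True
        then show ?thesis using False unfolding e2 by (simp add: complex_eq_iff)
      next
        case F: False
        then show ?thesis using t[OF j] unfolding e2 by (simp add: field_simps)
      qed
      then have "(Re (e\<^sup>2 * z j))\<^sup>2 < (cmod (e\<^sup>2 * z j))\<^sup>2" unfolding cmod_power2 by simp
      then have "\<bar>Re (e\<^sup>2 * z j)\<bar> < cmod (e\<^sup>2 * z j)"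
        by (metis abs_norm_cancel power2_abs power2_less_imp_less norm_ge_zero)
      moreover have "cmod (e\<^sup>2 * z j) = (cmod e)\<^sup>2 * cmod (z j)" by (simp add: norm_mult norm_power)
      ultimately show ?thesis using nz unfolding sv_sq_def by linarith
    qed
  qed
  then show ?thesis by blast
qed

text \<open>If h j = 0, then column j of C and row j of D vanish, so for \<alpha> = \<beta> the j-th
  lower basis vector is a further reducing eigenvector for \<alpha>; hence \<alpha> survives up to
  rank r plus the number of such j. Beyond that rank the compression space meets the span of
  eigenvectors of the Hermitian part of e M with eigenvalues above Re (e * \<alpha>); a generic e
  provides one for each j with h j \<noteq> 0.\<close>

lemma rank_range_too_large:
  assumes R: "in_rank_range (r + s) k M w" and k: "r + card {j. j < s \<and> h j = 0} < k" and ab: "\<alpha> = \<beta>"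
  shows False
proof -
  define N where "N = {j. j < s \<and> h j = 0}"
  have finN: "finite N" unfolding N_def by simp
  obtain \<sigma> where \<sigma>: "bij_betw \<sigma> {..<card N} N" using ex_bij_betw_nat_finite[OF finN] by (auto simp: lessThan_atLeast0)
  obtain e where e: "\<And>j. j < s \<Longrightarrow> h j \<noteq> 0 \<Longrightarrow> sv_sq e j > 0" using generic_direction by blast
  have w: "w = \<alpha>" using rank_range_large(2)[OF R] k ab by simp
  define b where "b = (\<lambda>m j. B e m j / of_real (sqrt (sv_sq e j)))"
  \<comment> \<open>The first r conditions tie the upper part to the lower one through the
    normalised columns of \<open>B e\<close>; the others delete the lower coordinates with h j =
    0.\<close>
  define L where "L = (\<lambda>m i. if m < r then (if i < r then (if i = m then 1 else 0) else - cnj (b m (i - r)))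
      else (if i = r + \<sigma> (m - r) then 1 else 0))"
  obtain x where x: "\<exists>i<r + s. x i \<noteq> 0" "\<forall>m<r + card N. hdot (r + s) (L m) x = 0"
     "hdot (r + s) x (mapply (r + s) M x) = w * hdot (r + s) x x"
    using in_rank_range_constrained[OF R, of "r + card N" L] k unfolding N_def by blast
  have vN: "low x j = 0" if jN: "j \<in> N" for j
  proof -
    obtain m where m: "m < card N" "j = \<sigma> m" using \<sigma> jN unfolding bij_betw_def by auto
    have "j < s" using jN unfolding N_def by simp
    moreover have "hdot (r + s) (L (r + m)) x = (if r + j < r + s then x (r + j) else 0)"
      unfolding hdot_def L_def m(2) by (simp add: if_distrib[of cnj] if_distrib[of "\<lambda>y. y * _"] cong: if_cong)
    ultimately show ?thesis using x(2) m by auto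
  qed
  have u: "x i = (\<Sum>j<s. b i j * low x j)" if i: "i < r" for i
  proof -
    have "hdot (r + s) (L i) x = x i - (\<Sum>j<s. b i j * low x j)"
      unfolding hdot_split unfolding hdot_def L_def using i
      by (simp add: if_distrib[of cnj] if_distrib[of "\<lambda>y. y * _"] sum_negf cong: if_cong)
    then show ?thesis using x(2) i by simp
  qed
  define v where "v = (\<lambda>j. low x j / of_real (sqrt (sv_sq e j)))"
  have uv: "x i = mapply s (B e) v i" if "i < r" for i
    unfolding u[OF that] mapply_def b_def v_def by (intro sum.cong) auto
  have "hdot r x (mapply s (B e) (low x)) = hdot r (mapply s (B e) v) (mapply s (B e) (low x))"
    by (rule hdot_cong) (simp_all add: uv)
  also have "\<dots> = (\<Sum>j<s. of_real (sv_sq e j) * cnj (v j) * low x j)" by (rule B_norm)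
  also have "\<dots> = (\<Sum>j<s. of_real (sqrt (sv_sq e j) * (cmod (low x j))\<^sup>2))"
  proof (intro sum.cong refl)
    fix j assume "j \<in> {..<s}"
    then have g: "sv_sq e j \<ge> 0" using sv_sq_nonneg by simp
    have "complex_of_real (sv_sq e j) * cnj (v j) * low x j = of_real (sv_sq e j / sqrt (sv_sq e j)) * (low x j * cnj (low x j))"
      unfolding v_def by simp
    also have "sv_sq e j / sqrt (sv_sq e j) = sqrt (sv_sq e j)" using g by (rule real_div_sqrt)
    finally show "complex_of_real (sv_sq e j) * cnj (v j) * low x j = of_real (sqrt (sv_sq e j) * (cmod (low x j))\<^sup>2)"
      by (simp only: of_real_mult complex_norm_square)
  qed
  finally have B: "Re (hdot r x (mapply s (B e) (low x))) = (\<Sum>j<s. sqrt (sv_sq e j) * (cmod (low x j))\<^sup>2)"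
    by simp
  define U where "U = (\<Sum>i<r. (cmod (x i))\<^sup>2) + (\<Sum>j<s. (cmod (low x j))\<^sup>2)"
  have "hdot (r + s) x x = of_real U"
    by (simp only: hdot_split hdot_self[of r] hdot_self[of s] U_def of_real_add)
  then have "Re (e * (w * hdot (r + s) x x)) = Re (e * \<alpha>) * U" unfolding w by (simp add: mult.assoc[symmetric])
  moreover have "Re (e * hdot (r + s) x (mapply (r + s) M x)) = Re (e * \<alpha>) * U + (\<Sum>j<s. sqrt (sv_sq e j) * (cmod (low x j))\<^sup>2)"
  proof -
    have "Re (e * \<beta>) = Re (e * \<alpha>)" using ab by simp
    then show ?thesis using Re_form_M[of e x] unfolding B U_def by (simp only: distrib_left)
  qed
  ultimately have "(\<Sum>j<s. sqrt (sv_sq e j) * (cmod (low x j))\<^sup>2) = 0" unfolding x(3) by simp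
  then have all0: "\<forall>j\<in>{..<s}. sqrt (sv_sq e j) * (cmod (low x j))\<^sup>2 = 0"
    by (subst (asm) sum_nonneg_eq_0_iff) (use sv_sq_nonneg in auto)
  have v0: "low x j = 0" if "j < s" for j
    using vN[of j] e[OF that] that bspec[OF all0, of j] unfolding N_def by (cases "h j = 0") auto
  then have "x i = 0" if "i < r" for i using u[OF that] by simp
  moreover obtain i where "i < r + s" "x i \<noteq> 0" using x(1) by blast
  ultimately show False using v0[of "i - r"] by (cases "i < r") (auto simp: not_less less_diff_conv2)
qed

end

section \<open>The boundary generating curve\<close>

lemma frequently_eq_tendsto:
  fixes f g :: "real \<Rightarrow> real"
  assumes "(f \<longlongrightarrow> a) F" "(g \<longlongrightarrow> b) F" "\<exists>\<^sub>F t in F. f t = g t"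
  shows "a = b"
proof (rule ccontr)
  assume "a \<noteq> b"
  then have "\<forall>\<^sub>F t in F. f t - g t \<noteq> 0"
    by (intro tendsto_imp_eventually_ne[OF tendsto_diff[OF assms(1,2)]]) simp
  then show False using assms(3) unfolding frequently_def by (auto elim: eventually_mono)
qed

text \<open>
  By the pigeonhole principle \<open>\<mu>\<close> agrees with a single branch at points accumulating at \<open>\<theta>\<close>, and this
  suffices to transfer the first-order contact.
\<close>

lemma envelope_of_finite_branches:
  fixes Br :: "(real \<Rightarrow> real) set" and \<mu> l :: "real \<Rightarrow> real"
  assumes fin: "finite Br" and diff: "\<And>f. f \<in> Br \<Longrightarrow> \<exists>d. (f has_real_derivative d) (at \<theta>)"
    and l: "\<exists>d. (l has_real_derivative d) (at \<theta>)"
    and ev: "\<forall>\<^sub>F t in nhds \<theta>. \<exists>f\<in>Br. \<mu> t = f t"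
    and tang: "l \<theta> = \<mu> \<theta>" "((\<lambda>t. l t - \<mu> t) has_real_derivative 0) (at \<theta>)"
  shows "\<exists>f\<in>Br. l \<theta> = f \<theta> \<and> ((\<lambda>t. l t - f t) has_real_derivative 0) (at \<theta>)"
proof -
  have ev': "\<forall>\<^sub>F t in at \<theta>. \<exists>f\<in>Br. \<mu> t = f t"
    using ev unfolding eventually_at_filter by (auto elim: eventually_mono)
  obtain f where f: "f \<in> Br" "\<exists>\<^sub>F t in at \<theta>. \<mu> t = f t"
  proof -
    have "\<exists>f\<in>Br. \<exists>\<^sub>F t in at \<theta>. \<mu> t = f t"
    proof (rule ccontr)
      assume "\<not> ?thesis"
      then have "\<forall>f\<in>Br. \<forall>\<^sub>F t in at \<theta>. \<mu> t \<noteq> f t" unfolding frequently_def by simp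
      then have "\<forall>\<^sub>F t in at \<theta>. \<forall>f\<in>Br. \<mu> t \<noteq> f t" using fin by (intro eventually_ball_finite) auto
      with ev' have "\<forall>\<^sub>F t in at \<theta>. False" by eventually_elim auto
      then show False by simp
    qed
    then show ?thesis using that by blast
  qed
  obtain d where d: "((\<lambda>t. l t - f t) has_real_derivative d) (at \<theta>)"
    using diff[OF f(1)] l by (auto intro!: derivative_intros)
  have fr: "\<exists>\<^sub>F t in at \<theta>. l t - \<mu> t = l t - f t" using f(2) by (rule frequently_mono[rotated]) simp
  have "0 = l \<theta> - f \<theta>"
  proof (rule frequently_eq_tendsto[OF _ _ fr])
    show "((\<lambda>t. l t - \<mu> t) \<longlongrightarrow> 0) (at \<theta>)"
      using DERIV_isCont[OF tang(2)] tang(1) unfolding isCont_def by simp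
    show "((\<lambda>t. l t - f t) \<longlongrightarrow> l \<theta> - f \<theta>) (at \<theta>)"
      using DERIV_isCont[OF d] unfolding isCont_def .
  qed
  moreover have "0 = d"
  proof (rule frequently_eq_tendsto)
    show "((\<lambda>t. ((l t - \<mu> t) - (l \<theta> - \<mu> \<theta>)) / (t - \<theta>)) \<longlongrightarrow> 0) (at \<theta>)"
      using tang(2) unfolding has_field_derivative_iff .
    show "((\<lambda>t. ((l t - f t) - (l \<theta> - f \<theta>)) / (t - \<theta>)) \<longlongrightarrow> d) (at \<theta>)"
      using d unfolding has_field_derivative_iff .
    show "\<exists>\<^sub>F t in at \<theta>. ((l t - \<mu> t) - (l \<theta> - \<mu> \<theta>)) / (t - \<theta>) = ((l t - f t) - (l \<theta> - f \<theta>)) / (t - \<theta>)"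
      using f(2) by (rule frequently_mono[rotated]) (use tang(1) \<open>0 = l \<theta> - f \<theta>\<close> in simp)
  qed
  ultimately show ?thesis using f(1) d by auto
qed

definition tangent_to :: "complex \<Rightarrow> (real \<Rightarrow> real) \<Rightarrow> bool" where
  "tangent_to w f \<longleftrightarrow> (\<exists>\<theta>. Re (cis (- \<theta>) * w) = f \<theta> \<and> ((\<lambda>t. Re (cis (- t) * w) - f t) has_real_derivative 0) (at \<theta>))"

lemma Re_cis_derivative: "((\<lambda>t. Re (cis (- t) * w)) has_real_derivative Im (cis (- \<theta>) * w)) (at \<theta>)"
proof -
  have "((\<lambda>t. cos t * Re w + sin t * Im w) has_real_derivative - sin \<theta> * Re w + cos \<theta> * Im w) (at \<theta>)"
    by (auto intro!: derivative_eq_intros)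
  then show ?thesis by simp
qed

lemma Re_cis_differentiable: "\<exists>d. ((\<lambda>t. Re (cis (- t) * w)) has_real_derivative d) (at \<theta>)"
  using Re_cis_derivative by blast

lemma tangent_to_iff:
  assumes "\<And>\<theta>. (f has_real_derivative f' \<theta>) (at \<theta>)"
  shows "tangent_to w f \<longleftrightarrow> (\<exists>\<theta>. Re (cis (- \<theta>) * w) = f \<theta> \<and> Im (cis (- \<theta>) * w) = f' \<theta>)"
proof -
  have "((\<lambda>t. Re (cis (- t) * w) - f t) has_real_derivative 0) (at \<theta>) \<longleftrightarrow> Im (cis (- \<theta>) * w) = f' \<theta>" for \<theta>
  proof -
    have "((\<lambda>t. Re (cis (- t) * w) - f t) has_real_derivative Im (cis (- \<theta>) * w) - f' \<theta>) (at \<theta>)"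
      by (intro DERIV_diff Re_cis_derivative assms)
    then show ?thesis using DERIV_unique by force
  qed
  then show ?thesis unfolding tangent_to_def by simp
qed

lemma tangent_to_pencil: "tangent_to w (\<lambda>t. Re (cis (- t) * p)) \<longleftrightarrow> w = p"
proof -
  have "Re (cis (- \<theta>) * w) = Re (cis (- \<theta>) * p) \<and> Im (cis (- \<theta>) * w) = Im (cis (- \<theta>) * p) \<longleftrightarrow> w = p" for \<theta>
    by (metis complex_eqI cis_neq_zero mult_left_cancel)
  then show ?thesis unfolding tangent_to_iff[OF Re_cis_derivative] by simp
qed

text \<open>Contact at \<theta> prescribes both coordinates of w - c in the frame turned by
  \<theta>, namely value and derivative of the branch. For the plus branch these are the coordinates
  of the point of contact of the ellipse, for the minus branch their negatives, and the ellipse is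
  symmetric about c.\<close>

lemma tangent_to_ellipse_branches:
  fixes K :: real and F f c :: complex
  assumes nd: "cmod F < K" and fF: "f\<^sup>2 = F"
  defines "p \<equiv> \<lambda>t. ellipse_support K F (cis (- t))"
  shows "w \<in> ellipse (c + f) (c - f) (sqrt (2 * K + 2 * cmod F)) (sqrt (2 * K - 2 * cmod F)) \<longleftrightarrow>
     tangent_to w (\<lambda>t. Re (cis (- t) * c) + p t) \<or> tangent_to w (\<lambda>t. Re (cis (- t) * c) - p t)"
    and "(p has_real_derivative Im ((cis (- \<theta>))\<^sup>2 * F) / (2 * p \<theta>)) (at \<theta>)"
proof -
  have FK: "cmod F \<le> K" using nd by simp
  have p0: "p t > 0" for t unfolding p_def by (rule tangent_point_mem_ellipse(1)[OF FK fF nd]) simp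
  have p2: "(p t)\<^sup>2 = (K + Re ((cis (- t))\<^sup>2 * F)) / 2" for t
    unfolding p_def ellipse_support_sq[OF FK fF] by simp
  have p_sqrt: "p = (\<lambda>t. sqrt ((K + Re (cis (- (2 * t)) * F)) / 2))"
    unfolding p_def ellipse_support_def by (auto simp: power2_eq_square cis_mult)
  show dp: "(p has_real_derivative Im ((cis (- \<theta>))\<^sup>2 * F) / (2 * p \<theta>)) (at \<theta>)" for \<theta>
  proof -
    have "((\<lambda>t. Re (cis (- (2 * t)) * F)) has_real_derivative Im (cis (- (2 * \<theta>)) * F) * 2) (at \<theta>)"
      by (rule DERIV_chain2[of "\<lambda>t. Re (cis (- t) * F)" _ "\<lambda>t. 2 * t"], rule Re_cis_derivative)
        (auto intro!: derivative_eq_intros)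
    then have "((\<lambda>t. (K + Re (cis (- (2 * t)) * F)) / 2) has_real_derivative Im (cis (- (2 * \<theta>)) * F)) (at \<theta>)"
      by (auto intro!: derivative_eq_intros)
    moreover have "(K + Re (cis (- (2 * \<theta>)) * F)) / 2 > 0"
      using p0[of \<theta>] unfolding p_sqrt by simp
    ultimately have "(p has_real_derivative inverse (p \<theta>) / 2 * Im (cis (- (2 * \<theta>)) * F)) (at \<theta>)"
      unfolding p_sqrt by (intro DERIV_chain2[OF DERIV_real_sqrt])
    moreover have "(cis (- \<theta>))\<^sup>2 = cis (- (2 * \<theta>))" by (simp add: power2_eq_square cis_mult)
    ultimately show ?thesis by (simp only: divide_inverse inverse_mult_distrib mult_ac)
  qed
  define q where "q = (\<lambda>\<theta>. Im ((cis (- \<theta>))\<^sup>2 * F) / (2 * p \<theta>))"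
  have plus: "tangent_to w (\<lambda>t. Re (cis (- t) * c) + p t) \<longleftrightarrow>
      (\<exists>\<theta>. Re (cis (- \<theta>) * (w - c)) = p \<theta> \<and> Im (cis (- \<theta>) * (w - c)) = q \<theta>)"
    unfolding tangent_to_iff[OF DERIV_add[OF Re_cis_derivative dp]] q_def
    by (simp only: right_diff_distrib minus_complex.simps diff_eq_eq add.commute)
  have shift: "x - y = - b \<longleftrightarrow> x = y - b" for x y b :: real by auto
  have minus: "tangent_to w (\<lambda>t. Re (cis (- t) * c) - p t) \<longleftrightarrow>
      (\<exists>\<theta>. Re (cis (- \<theta>) * (w - c)) = - p \<theta> \<and> Im (cis (- \<theta>) * (w - c)) = - q \<theta>)"
    unfolding tangent_to_iff[OF DERIV_diff[OF Re_cis_derivative dp]] q_def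
    by (simp only: right_diff_distrib minus_complex.simps shift)
  define Ell where "Ell = ellipse (c + f) (c - f) (sqrt (2 * K + 2 * cmod F)) (sqrt (2 * K - 2 * cmod F))"
  have mem: "w \<in> Ell \<longleftrightarrow> cmod ((w - c)\<^sup>2 - F) = K - (cmod (w - c))\<^sup>2" for w
    unfolding Ell_def by (rule mem_ellipse_nondegenerate[OF FK fF nd])
  have tp: "c + Complex (p \<theta>) (q \<theta>) / cis (- \<theta>) \<in> Ell" for \<theta>
    unfolding Ell_def p_def q_def by (rule tangent_point_mem_ellipse(2)[OF FK fF nd]) simp
  have "w \<in> Ell \<longleftrightarrow> (\<exists>\<theta>. Re (cis (- \<theta>) * (w - c)) = p \<theta> \<and> Im (cis (- \<theta>) * (w - c)) = q \<theta>) \<or>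
      (\<exists>\<theta>. Re (cis (- \<theta>) * (w - c)) = - p \<theta> \<and> Im (cis (- \<theta>) * (w - c)) = - q \<theta>)"
  proof (intro iffI)
    assume w: "w \<in> Ell"
    define T where "T = (w - c)\<^sup>2 - F"
    \<comment> \<open>This rotation makes (w - c)^2 - F real and nonnegative, so the equation of the
      ellipse becomes u^2 - G = K - |u|^2. Its real part gives Re u up to sign, and its imaginary
      part the tangential coordinate. Halving the argument determines \<theta> only modulo pi, hence
      the two signs.\<close>
    define \<theta> where "\<theta> = Arg T / 2"
    define u where "u = cis (- \<theta>) * (w - c)"
    define G where "G = (cis (- \<theta>))\<^sup>2 * F"
    have "(cis (- \<theta>))\<^sup>2 * T = of_real (cmod T)"
    proof -
      have "(cis (- \<theta>))\<^sup>2 = cis (- Arg T)" unfolding \<theta>_def by (simp add: power2_eq_square cis_mult)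
      moreover have "cis (- Arg T) * (of_real (cmod T) * cis (Arg T)) = of_real (cmod T) * (cis (- Arg T) * cis (Arg T))"
        by (rule mult.left_commute)
      moreover have "of_real (cmod T) * cis (Arg T) = T" using rcis_cmod_Arg[of T] unfolding rcis_def .
      ultimately show ?thesis by (simp only: cis_mult left_minus cis_zero mult_1_right)
    qed
    moreover have "cmod T = K - (cmod u)\<^sup>2" using w unfolding mem T_def u_def by (simp add: norm_mult)
    moreover have "u\<^sup>2 - G = (cis (- \<theta>))\<^sup>2 * T"
      unfolding G_def T_def right_diff_distrib[of "(cis (- \<theta>))\<^sup>2"] by (simp only: u_def power_mult_distrib)
    ultimately have "u\<^sup>2 - G = of_real (K - (cmod u)\<^sup>2)" by (simp only:)
    then have re: "(Re u)\<^sup>2 - (Im u)\<^sup>2 - Re G = K - ((Re u)\<^sup>2 + (Im u)\<^sup>2)" and im: "2 * Re u * Im u = Im G"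
      unfolding complex_eq_iff cmod_power2 by (auto simp: power2_eq_square mult_ac)
    have "(Re u)\<^sup>2 = (p \<theta>)\<^sup>2" unfolding p2[of \<theta>, folded G_def] using re by (simp add: field_simps)
    then have "Re u = p \<theta> \<or> Re u = - p \<theta>" by (simp add: power2_eq_iff)
    moreover have "Im u = Im G / (2 * Re u)" using im calculation p0[of \<theta>] by (auto simp: field_simps)
    ultimately have "Re u = p \<theta> \<and> Im u = q \<theta> \<or> Re u = - p \<theta> \<and> Im u = - q \<theta>"
      unfolding q_def G_def by auto
    then show "(\<exists>\<theta>. Re (cis (- \<theta>) * (w - c)) = p \<theta> \<and> Im (cis (- \<theta>) * (w - c)) = q \<theta>) \<or>
      (\<exists>\<theta>. Re (cis (- \<theta>) * (w - c)) = - p \<theta> \<and> Im (cis (- \<theta>) * (w - c)) = - q \<theta>)"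
      unfolding u_def by blast
  next
    assume "(\<exists>\<theta>. Re (cis (- \<theta>) * (w - c)) = p \<theta> \<and> Im (cis (- \<theta>) * (w - c)) = q \<theta>) \<or>
      (\<exists>\<theta>. Re (cis (- \<theta>) * (w - c)) = - p \<theta> \<and> Im (cis (- \<theta>) * (w - c)) = - q \<theta>)"
    then obtain \<theta> where "cis (- \<theta>) * (w - c) = Complex (p \<theta>) (q \<theta>) \<or> cis (- \<theta>) * (w - c) = - Complex (p \<theta>) (q \<theta>)"
      by (auto simp: complex_eq_iff)
    moreover have eq: "w - c = cis (- \<theta>) * (w - c) / cis (- \<theta>)" by simp
    ultimately have "w - c = Complex (p \<theta>) (q \<theta>) / cis (- \<theta>) \<or> w - c = - (Complex (p \<theta>) (q \<theta>) / cis (- \<theta>))"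
      by (elim disjE) (subst eq, simp only: minus_divide_left simp_thms)+
    then show "w \<in> Ell" using tp[of \<theta>] unfolding mem by (elim disjE) (simp_all only: add_diff_cancel_left' power2_minus norm_minus_cancel)
  qed
  then show "w \<in> ellipse (c + f) (c - f) (sqrt (2 * K + 2 * cmod F)) (sqrt (2 * K - 2 * cmod F)) \<longleftrightarrow>
     tangent_to w (\<lambda>t. Re (cis (- t) * c) + p t) \<or> tangent_to w (\<lambda>t. Re (cis (- t) * c) - p t)"
    unfolding plus minus Ell_def .
qed

section \<open>Eigenvalue branches of the Hermitian parts\<close>

context commuting_blocks
begin

definition hpart :: "complex \<Rightarrow> nat \<Rightarrow> nat \<Rightarrow> complex" where
  "hpart e i j = (e * M i j + cnj (e * M j i)) / 2"

definition spectrum_at :: "complex \<Rightarrow> complex \<Rightarrow> bool" where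
  "spectrum_at e l \<longleftrightarrow> (\<exists>x. (\<exists>i<r + s. x i \<noteq> 0) \<and> (\<forall>i<r + s. mapply (r + s) (hpart e) x i = l * x i))"

lemma mapply_hpart_upper:
  "i < r \<Longrightarrow> mapply (r + s) (hpart e) x i = of_real (Re (e * \<alpha>)) * x i + mapply s (B e) (low x) i / 2"
proof -
  assume i: "i < r"
  have "(\<Sum>j<r. hpart e i j * x j) = (\<Sum>j<r. if i = j then of_real (Re (e * \<alpha>)) * x i else 0)"
    using i by (intro sum.cong refl) (auto simp: hpart_def M_def complex_eq_iff)
  moreover have "(\<Sum>j<s. hpart e i (r + j) * x (r + j)) = (\<Sum>j<s. B e i j * x (r + j)) / 2"
    unfolding sum_divide_distrib using i by (intro sum.cong refl) (simp add: hpart_def M_def B_def)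
  ultimately show ?thesis unfolding mapply_def sum_lessThan_add using i by simp
qed

lemma mapply_hpart_lower:
  "j < s \<Longrightarrow> mapply (r + s) (hpart e) x (r + j) = hdot r (\<lambda>i. B e i j) x / 2 + of_real (Re (e * \<beta>)) * low x j"
proof -
  assume j: "j < s"
  have "(\<Sum>i<r. hpart e (r + j) i * x i) = (\<Sum>i<r. cnj (B e i j) * x i) / 2"
    unfolding sum_divide_distrib by (intro sum.cong refl) (simp add: hpart_def M_def B_def)
  moreover have "(\<Sum>l<s. hpart e (r + j) (r + l) * x (r + l)) = (\<Sum>l<s. if j = l then of_real (Re (e * \<beta>)) * x (r + j) else 0)"
    by (intro sum.cong refl) (auto simp: hpart_def M_def complex_eq_iff)
  ultimately show ?thesis unfolding mapply_def sum_lessThan_add hdot_def using j by simp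
qed

lemma hdot_B_col: "j < s \<Longrightarrow> hdot r (\<lambda>i. B e i j) (mapply s (B e) v) = of_real (sv_sq e j) * v j"
proof -
  assume j: "j < s"
  have "(\<lambda>i. B e i j) = mapply s (B e) (\<lambda>l. if l = j then 1 else 0)"
    unfolding mapply_def using j by (simp add: if_distrib[of "\<lambda>y. _ * y"] cong: if_cong)
  then show ?thesis using j
    by (simp add: B_norm if_distrib[of "\<lambda>y. _ * y"] if_distrib[of cnj] if_distrib[of "\<lambda>y. y * _"] cong: if_cong)
qed

text \<open>Either there are fewer columns than dimensions, or one column is zero and at most s - 1
  < r conditions remain.\<close>

lemma B_cokernel:
  assumes "s < r \<or> (\<exists>j<s. sv_sq e j = 0)"
  shows "\<exists>u. (\<exists>i<r. u i \<noteq> 0) \<and> (\<forall>j<s. hdot r (\<lambda>i. B e i j) u = 0)"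
proof (cases "s < r")
  case True
  from exists_kernel_vector[OF this, of "\<lambda>j i. cnj (B e i j)"] show ?thesis unfolding hdot_def .
next
  case False
  then obtain j where j: "j < s" "sv_sq e j = 0" using assms by blast
  then have "s - 1 < r" using s_le_r by linarith
  from exists_kernel_vector[OF this, of "\<lambda>m i. cnj (B e i (if m < j then m else Suc m))"]
  obtain u where u: "\<exists>i<r. u i \<noteq> 0" "\<And>m. m < s - 1 \<Longrightarrow> hdot r (\<lambda>i. B e i (if m < j then m else Suc m)) u = 0"
    unfolding hdot_def by blast
  have "hdot r (\<lambda>k. B e k j) (\<lambda>k. B e k j) = 0" unfolding hdot_def using BB[OF j(1) j(1), of e] j(2) by simp
  then have "hdot r (\<lambda>i. B e i j) u = 0" unfolding hdot_self_eq_0 by (simp add: hdot_def)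
  moreover have "hdot r (\<lambda>i. B e i l) u = 0" if "l < s" "l \<noteq> j" for l
  proof (cases "l < j")
    case True
    then show ?thesis using u(2)[of l] j(1) by simp
  next
    case False
    then have "\<not> l - 1 < j" "Suc (l - 1) = l" "l - 1 < s - 1" using that by auto
    then show ?thesis using u(2)[of "l - 1"] by simp
  qed
  ultimately show ?thesis using u(1) by metis
qed

text \<open>With a = Re (e * \<alpha>) and b = Re (e * \<beta>), an eigenvector satisfies two
  equations: \<open>B e\<close> maps the lower part to 2 (l - a) times the upper part, and its
  adjoint maps the upper part to 2 (l - b) times the lower part. Composing them gives the quadratic
  equation for every j with nonzero lower coordinate. Without a lower part l = a, and the upper part
  lies in the kernel of the adjoint, which needs s < r or a vanishing singular value.\<close>

lemma spectrum_at_iff: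
  "spectrum_at e (of_real l) \<longleftrightarrow> s < r \<and> l = Re (e * \<alpha>) \<or> (\<exists>j<s. (l - Re (e * \<alpha>)) * (l - Re (e * \<beta>)) = sv_sq e j / 4)"
proof
  define a where "a = Re (e * \<alpha>)"
  define b where "b = Re (e * \<beta>)"
  assume "spectrum_at e (of_real l)"
  then obtain x where x: "\<exists>i<r + s. x i \<noteq> 0" "\<And>i. i < r + s \<Longrightarrow> mapply (r + s) (hpart e) x i = of_real l * x i"
    unfolding spectrum_at_def by blast
  have up: "mapply s (B e) (low x) i = of_real (2 * (l - a)) * x i" if "i < r" for i
    using x(2)[of i] mapply_hpart_upper[OF that, of e x] that unfolding a_def by (simp add: field_simps)
  have lo: "hdot r (\<lambda>i. B e i j) x = of_real (2 * (l - b)) * low x j" if "j < s" for j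
    using x(2)[of "r + j"] mapply_hpart_lower[OF that, of e x] that unfolding b_def by (simp add: field_simps)
  have prod: "of_real (sv_sq e j) * low x j = of_real (4 * (l - a) * (l - b)) * low x j" if j: "j < s" for j
  proof -
    have "of_real (sv_sq e j) * low x j = hdot r (\<lambda>i. B e i j) (mapply s (B e) (low x))"
      using hdot_B_col[OF j] by simp
    also have "\<dots> = hdot r (\<lambda>i. B e i j) (\<lambda>i. of_real (2 * (l - a)) * x i + 0 * 0)"
      by (rule hdot_cong) (simp_all add: up)
    also have "\<dots> = of_real (2 * (l - a)) * hdot r (\<lambda>i. B e i j) x"
      by (simp add: hdot_add_scale_right[of r _ _ _ 0 "\<lambda>_. 0", simplified])
    finally show ?thesis unfolding lo[OF j] by (simp add: algebra_simps)
  qed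
  show "s < r \<and> l = Re (e * \<alpha>) \<or> (\<exists>j<s. (l - Re (e * \<alpha>)) * (l - Re (e * \<beta>)) = sv_sq e j / 4)"
  proof (cases "\<exists>j<s. low x j \<noteq> 0")
    case True
    then obtain j where j: "j < s" "low x j \<noteq> 0" by blast
    then have "complex_of_real (sv_sq e j) = of_real (4 * (l - a) * (l - b))" using prod[OF j(1)] by simp
    then have "(l - a) * (l - b) = sv_sq e j / 4" by (simp only: of_real_eq_iff)
    then show ?thesis using j(1) unfolding a_def b_def by blast
  next
    case False
    then have v0: "low x j = 0" if "j < s" for j using that by blast
    obtain i where i: "i < r" "x i \<noteq> 0"
    proof -
      obtain i where "i < r + s" "x i \<noteq> 0" using x(1) by blast
      then show ?thesis using that v0[of "i - r"] by (cases "i < r") (auto simp: not_less less_diff_conv2)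
    qed
    have "mapply s (B e) (low x) i = 0" unfolding mapply_def using v0 by simp
    then have "complex_of_real (2 * (l - a)) = 0" using up[OF i(1)] i(2) by simp
    then have la: "l = a" by simp
    have ortho: "hdot r (\<lambda>i. B e i j) x = 0" if "j < s" for j using lo[OF that] v0[OF that] by simp
    have "\<exists>j<s. sv_sq e j = 0" if "\<not> s < r"
    proof (rule ccontr)
      assume "\<not> ?thesis"
      then have gpos: "sv_sq e j \<noteq> 0" if "j < s" for j using that by blast
      obtain q where q: "\<And>i j. i < s \<Longrightarrow> j < s \<Longrightarrow> hdot r (q i) (q j) = (if i = j then 1 else 0)"
          and Bq: "\<And>i j. j < s \<Longrightarrow> i < r \<Longrightarrow> B e i j = of_real (sqrt (sv_sq e j)) * q j i"
        using polar_columns[of e] by blast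
      have qx: "hdot r (q j) x = 0" if "j < s" for j
      proof -
        have "hdot r (\<lambda>i. B e i j) x = of_real (sqrt (sv_sq e j)) * hdot r (q j) x"
          unfolding hdot_def sum_distrib_left using that by (intro sum.cong refl) (simp add: Bq)
        then show ?thesis using ortho[OF that] gpos[OF that] by simp
      qed
      have rs: "r = s" using that s_le_r by simp
      \<comment> \<open>The orthonormal q and the nonzero x orthogonal to all of them would be r + 1
        independent vectors in dimension r = s.\<close>
      define y where "y = (\<lambda>p. if p < s then q p else x)"
      obtain cc where cc: "\<exists>p<Suc r. cc p \<noteq> 0" "\<forall>i<r. (\<Sum>p<Suc r. y p i * cc p) = 0"
        using exists_kernel_vector[of r "Suc r" "\<lambda>i p. y p i"] by blast
      have lc: "lincomb_fun (Suc r) cc y i = 0" if "i < r" for i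
        using cc(2) that unfolding lincomb_fun_def by (simp add: mult.commute)
      have dot0: "(\<Sum>p<Suc r. cc p * hdot r z (y p)) = 0" for z
      proof -
        have "(\<Sum>p<Suc r. cc p * hdot r z (y p)) = hdot r z (lincomb_fun (Suc r) cc y)"
          by (rule hdot_lincomb_right[symmetric])
        also have "\<dots> = 0" unfolding hdot_def using lc by simp
        finally show ?thesis .
      qed
      have c0: "cc p = 0" if "p < s" for p
      proof -
        have "(\<Sum>p'<Suc r. cc p' * hdot r (q p) (y p')) = (\<Sum>p'<Suc r. if p' = p then cc p else 0)"
          by (intro sum.cong refl) (use that q qx rs in \<open>auto simp: y_def less_Suc_eq\<close>)
        then show ?thesis using dot0[of "q p"] that rs by simp
      qed
      have "(\<Sum>p<Suc r. cc p * hdot r x (y p)) = cc r * hdot r x x"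
        using c0 rs unfolding y_def by simp
      moreover have "hdot r x x \<noteq> 0" using i by (auto simp: hdot_self_eq_0)
      ultimately have "cc r = 0" using dot0[of x] by simp
      then show False using cc(1) c0 rs by (auto simp: less_Suc_eq)
    qed
    then show ?thesis using la unfolding a_def by (cases "s < r") auto
  qed
next
  define a where "a = Re (e * \<alpha>)"
  define b where "b = Re (e * \<beta>)"
  have at_a: "spectrum_at e (of_real a)" if A: "s < r \<or> (\<exists>j<s. sv_sq e j = 0)"
  proof -
    obtain u where u: "\<exists>i<r. u i \<noteq> 0" "\<And>j. j < s \<Longrightarrow> hdot r (\<lambda>i. B e i j) u = 0"
      using B_cokernel[OF A] by blast
    define x where "x = (\<lambda>i. if i < r then u i else 0)"
    have lx: "low x = (\<lambda>_. 0)" unfolding x_def by auto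
    have "hdot r (\<lambda>i. B e i j) x = 0" if "j < s" for j
      using u(2)[OF that] by (subst hdot_cong[of r _ "\<lambda>i. B e i j" _ u]) (auto simp: x_def)
    then have lower: "mapply (r + s) (hpart e) x (r + j) = of_real a * x (r + j)" if "j < s" for j
      unfolding mapply_hpart_lower[OF that] using that by (simp add: x_def)
    have upper: "mapply (r + s) (hpart e) x i = of_real a * x i" if "i < r" for i
      unfolding mapply_hpart_upper[OF that] lx a_def by (simp add: mapply_def)
    have "mapply (r + s) (hpart e) x i = of_real a * x i" if "i < r + s" for i
    proof (cases "i < r")
      case False
      then have "i = r + (i - r)" "i - r < s" using that by auto
      then show ?thesis using lower[of "i - r"] by metis
    qed (rule upper)
    moreover have "\<exists>i<r + s. x i \<noteq> 0" using u(1) unfolding x_def by auto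
    ultimately show ?thesis unfolding spectrum_at_def by blast
  qed
  assume "s < r \<and> l = Re (e * \<alpha>) \<or> (\<exists>j<s. (l - Re (e * \<alpha>)) * (l - Re (e * \<beta>)) = sv_sq e j / 4)"
  then consider "s < r" "l = a" | j where "j < s" "(l - a) * (l - b) = sv_sq e j / 4"
    unfolding a_def b_def by blast
  then show "spectrum_at e (of_real l)"
  proof cases
    case 1
    then show ?thesis using at_a by simp
  next
    case (2 j)
    show ?thesis
    proof (cases "l = a")
      case True
      then have "sv_sq e j = 0" using 2 by simp
      then show ?thesis using at_a 2(1) True by blast
    next
      case False
      \<comment> \<open>The lower part is the j-th unit vector. The upper part is chosen to solve
        the first eigenvalue equation, and the quadratic equation for l then yields the
        second.\<close>
      define v where "v = (\<lambda>l. if l = j then 1 else (0::complex))"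
      define x where "x = (\<lambda>i. if i < r then mapply s (B e) v i / of_real (2 * (l - a)) else v (i - r))"
      have lx: "low x = v" unfolding x_def by auto
      have n0: "complex_of_real (2 * (l - a)) \<noteq> 0" using False by simp
      have upper: "mapply (r + s) (hpart e) x i = of_real l * x i" if "i < r" for i
      proof -
        have "mapply s (B e) v i = of_real (2 * (l - a)) * x i" unfolding x_def using that n0 by simp
        then show ?thesis unfolding mapply_hpart_upper[OF that] lx a_def[symmetric] by (simp add: field_simps)
      qed
      have lower: "mapply (r + s) (hpart e) x (r + k) = of_real l * x (r + k)" if k: "k < s" for k
      proof -
        have "of_real (2 * (l - a)) * hdot r (\<lambda>i. B e i k) x = hdot r (\<lambda>i. B e i k) (mapply s (B e) v)"
          unfolding hdot_def sum_distrib_left by (intro sum.cong refl) (use n0 in \<open>simp add: x_def\<close>)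
        also have "\<dots> = of_real (sv_sq e k) * v k" by (rule hdot_B_col[OF k])
        also have "\<dots> = of_real (4 * ((l - a) * (l - b))) * v k"
        proof (cases "k = j")
          case True
          have "sv_sq e j = 4 * ((l - a) * (l - b))" using 2(2) by simp
          then show ?thesis unfolding True by (simp only:)
        qed (simp add: v_def)
        also have "\<dots> = of_real (2 * (l - a)) * (of_real (2 * (l - b)) * v k)" by (simp add: algebra_simps)
        finally have "hdot r (\<lambda>i. B e i k) x = of_real (2 * (l - b)) * v k" by (rule mult_left_cancel[OF n0, THEN iffD1])
        moreover have "x (r + k) = v k" using lx by metis
        ultimately show ?thesis unfolding mapply_hpart_lower[OF k] lx b_def[symmetric] by (simp add: field_simps)
      qed
      have "mapply (r + s) (hpart e) x i = of_real l * x i" if "i < r + s" for i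
      proof (cases "i < r")
        case False
        then have "i = r + (i - r)" "i - r < s" using that by auto
        then show ?thesis using lower[of "i - r"] by metis
      qed (rule upper)
      moreover have "x (r + j) \<noteq> 0" using lx unfolding v_def by (metis one_neq_zero)
      ultimately show ?thesis unfolding spectrum_at_def using 2(1) by (meson add_strict_left_mono)
    qed
  qed
qed

definition focus :: "nat \<Rightarrow> complex" where "focus j = csqrt (F j)"

definition Ellipse :: "nat \<Rightarrow> complex set" where
  "Ellipse j = ellipse (c + focus j) (c - focus j) (sqrt (2 * K j + 2 * cmod (F j))) (sqrt (2 * K j - 2 * cmod (F j)))"

text \<open>For a degenerate ellipse \<open>supp\<close> is |Re (e * focus)|, which may have kinks.
  The two signed functions run through the same eigenvalues, are differentiable, and have the foci
  as envelopes.\<close>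

definition branches_of :: "nat \<Rightarrow> (real \<Rightarrow> real) set" where
  "branches_of j = (if cmod (F j) < K j
     then {\<lambda>t. Re (cis (- t) * c) + supp j (cis (- t)), \<lambda>t. Re (cis (- t) * c) - supp j (cis (- t))}
     else {\<lambda>t. Re (cis (- t) * (c + focus j)), \<lambda>t. Re (cis (- t) * (c - focus j))})"

text \<open>For s < r the adjoint of \<open>B e\<close> has a kernel for every e, whence the pencil
  of lines through \<alpha>.\<close>

definition branches :: "(real \<Rightarrow> real) set" where
  "branches = (\<Union>j<s. branches_of j) \<union> (if s < r then {\<lambda>t. Re (cis (- t) * \<alpha>)} else {})"

lemma bex_branches: "(\<exists>f\<in>branches. P f) \<longleftrightarrow>
    s < r \<and> P (\<lambda>t. Re (cis (- t) * \<alpha>)) \<or> (\<exists>j<s. \<exists>f\<in>branches_of j. P f)"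
proof (cases "s < r")
  case True
  show ?thesis unfolding branches_def if_P[OF True] using True by blast
next
  case False
  show ?thesis unfolding branches_def if_not_P[OF False] using False by blast
qed

lemma focus_sq: "(focus j)\<^sup>2 = F j" unfolding focus_def by simp

lemma mem_branches_of_value:
  assumes j: "j < s"
  shows "(\<exists>f\<in>branches_of j. l = f t) \<longleftrightarrow>
     (l - Re (cis (- t) * \<alpha>)) * (l - Re (cis (- t) * \<beta>)) = sv_sq (cis (- t)) j / 4"
proof -
  define e where "e = cis (- t)"
  have "(l - Re (e * \<alpha>)) * (l - Re (e * \<beta>)) = (l - Re (e * c))\<^sup>2 - (Re (e * \<delta>))\<^sup>2"
    unfolding c_def \<delta>_def by (simp add: power2_eq_square field_simps)
  then have 1: "(l - Re (e * \<alpha>)) * (l - Re (e * \<beta>)) = sv_sq e j / 4 \<longleftrightarrow> (l - Re (e * c))\<^sup>2 = (supp j e)\<^sup>2"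
    unfolding supp_sq[OF j] by auto
  show ?thesis
  proof (cases "cmod (F j) < K j")
    case True
    then have "(\<exists>f\<in>branches_of j. l = f t) \<longleftrightarrow> l = Re (e * c) + supp j e \<or> l = Re (e * c) - supp j e"
      unfolding branches_of_def e_def by auto
    also have "\<dots> \<longleftrightarrow> (l - Re (e * c))\<^sup>2 = (supp j e)\<^sup>2" unfolding power2_eq_iff by auto
    finally show ?thesis using 1 unfolding e_def by simp
  next
    case False
    then have "(\<exists>f\<in>branches_of j. l = f t) \<longleftrightarrow> l = Re (e * c) + Re (e * focus j) \<or> l = Re (e * c) - Re (e * focus j)"
      unfolding branches_of_def e_def by (simp add: algebra_simps)
    also have "\<dots> \<longleftrightarrow> (l - Re (e * c))\<^sup>2 = (Re (e * focus j))\<^sup>2" unfolding power2_eq_iff by auto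
    also have "(Re (e * focus j))\<^sup>2 = (supp j e)\<^sup>2"
      using degenerate_support_sq[OF F_le_K[OF j] focus_sq, of e] False F_le_K[OF j] by simp
    finally show ?thesis using 1 unfolding e_def by simp
  qed
qed

lemma spectrum_at_branches: "spectrum_at (cis (- t)) (of_real l) \<longleftrightarrow> (\<exists>f\<in>branches. l = f t)"
proof -
  have "(\<exists>f\<in>branches. l = f t) \<longleftrightarrow> s < r \<and> l = Re (cis (- t) * \<alpha>) \<or> (\<exists>j<s. \<exists>f\<in>branches_of j. l = f t)"
    by (rule bex_branches)
  also have "(\<exists>j<s. \<exists>f\<in>branches_of j. l = f t) \<longleftrightarrow>
      (\<exists>j<s. (l - Re (cis (- t) * \<alpha>)) * (l - Re (cis (- t) * \<beta>)) = sv_sq (cis (- t)) j / 4)"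
    using mem_branches_of_value[of _ l t] by blast
  finally show ?thesis unfolding spectrum_at_iff by (rule sym)
qed

lemma branches_differentiable:
  assumes f: "f \<in> branches"
  shows "\<exists>d. (f has_real_derivative d) (at \<theta>)"
proof -
  have "\<exists>d. (f has_real_derivative d) (at \<theta>)" if "j < s" "f \<in> branches_of j" for j f
  proof (cases "cmod (F j) < K j")
    case True
    note d = tangent_to_ellipse_branches(2)[OF True focus_sq, of \<theta>]
    have "\<exists>d. ((\<lambda>t. Re (cis (- t) * c) + supp j (cis (- t))) has_real_derivative d) (at \<theta>)"
      "\<exists>d. ((\<lambda>t. Re (cis (- t) * c) - supp j (cis (- t))) has_real_derivative d) (at \<theta>)"
      using DERIV_add[OF Re_cis_derivative d] DERIV_diff[OF Re_cis_derivative d] by blast+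
    then show ?thesis using that(2) unfolding branches_of_def if_P[OF True] by blast
  next
    case False
    then show ?thesis using that(2) Re_cis_differentiable unfolding branches_of_def if_not_P[OF False] by blast
  qed
  moreover have "(\<exists>f'\<in>branches. f = f')" using f by blast
  ultimately show ?thesis unfolding bex_branches using Re_cis_differentiable[of \<alpha>] by blast
qed

lemma tangent_to_branches_of: "j < s \<Longrightarrow> w \<in> Ellipse j \<longleftrightarrow> (\<exists>f\<in>branches_of j. tangent_to w f)"
proof -
  assume j: "j < s"
  show ?thesis
  proof (cases "cmod (F j) < K j")
    case True
    show ?thesis
      unfolding Ellipse_def branches_of_def if_P[OF True] tangent_to_ellipse_branches(1)[OF True focus_sq] by blast
  next
    case False
    then have eq: "cmod (F j) = K j" using F_le_K[OF j] by simp
    have "w \<in> Ellipse j \<longleftrightarrow> w = c + focus j \<or> w = c - focus j"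
      unfolding Ellipse_def degenerate_ellipse_eq[OF F_le_K[OF j] focus_sq eq] by simp
    also have "\<dots> \<longleftrightarrow> (\<exists>f\<in>branches_of j. tangent_to w f)"
      unfolding branches_of_def if_not_P[OF False] tangent_to_pencil[symmetric, of w] by blast
    finally show ?thesis .
  qed
qed

lemma kippenhahn_eq_ellipses:
  "{w. \<exists>\<theta> \<mu>. (\<forall>\<^sub>F t in nhds \<theta>. spectrum_at (cis (- t)) (of_real (\<mu> t))) \<and> Re (cis (- \<theta>) * w) = \<mu> \<theta> \<and>
     ((\<lambda>t. Re (cis (- t) * w) - \<mu> t) has_real_derivative 0) (at \<theta>)} =
   (\<Union>j<s. Ellipse j) \<union> (if s < r then {\<alpha>} else {})"
proof -
  have fin: "finite branches" unfolding branches_def branches_of_def by auto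
  have "(\<exists>\<theta> \<mu>. (\<forall>\<^sub>F t in nhds \<theta>. \<exists>f\<in>branches. \<mu> t = f t) \<and> Re (cis (- \<theta>) * w) = \<mu> \<theta> \<and>
     ((\<lambda>t. Re (cis (- t) * w) - \<mu> t) has_real_derivative 0) (at \<theta>)) \<longleftrightarrow> (\<exists>f\<in>branches. tangent_to w f)" for w
  proof
    assume "\<exists>\<theta> \<mu>. (\<forall>\<^sub>F t in nhds \<theta>. \<exists>f\<in>branches. \<mu> t = f t) \<and> Re (cis (- \<theta>) * w) = \<mu> \<theta> \<and>
     ((\<lambda>t. Re (cis (- t) * w) - \<mu> t) has_real_derivative 0) (at \<theta>)"
    then obtain \<theta> \<mu> where *: "\<forall>\<^sub>F t in nhds \<theta>. \<exists>f\<in>branches. \<mu> t = f t" "Re (cis (- \<theta>) * w) = \<mu> \<theta>"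
      "((\<lambda>t. Re (cis (- t) * w) - \<mu> t) has_real_derivative 0) (at \<theta>)" by blast
    have "\<exists>f\<in>branches. Re (cis (- \<theta>) * w) = f \<theta> \<and> ((\<lambda>t. Re (cis (- t) * w) - f t) has_real_derivative 0) (at \<theta>)"
      by (rule envelope_of_finite_branches[OF fin branches_differentiable _ *]) (use Re_cis_derivative in blast)+
    then show "\<exists>f\<in>branches. tangent_to w f" unfolding tangent_to_def by blast
  next
    assume "\<exists>f\<in>branches. tangent_to w f"
    then obtain f \<theta> where f: "f \<in> branches" "Re (cis (- \<theta>) * w) = f \<theta>"
      "((\<lambda>t. Re (cis (- t) * w) - f t) has_real_derivative 0) (at \<theta>)" unfolding tangent_to_def by blast
    have "\<forall>\<^sub>F t in nhds \<theta>. \<exists>f'\<in>branches. f t = f' t" using f(1) by (intro always_eventually) blast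
    with f show "\<exists>\<theta> \<mu>. (\<forall>\<^sub>F t in nhds \<theta>. \<exists>f\<in>branches. \<mu> t = f t) \<and> Re (cis (- \<theta>) * w) = \<mu> \<theta> \<and>
     ((\<lambda>t. Re (cis (- t) * w) - \<mu> t) has_real_derivative 0) (at \<theta>)" by blast
  qed
  moreover have "(\<exists>f\<in>branches. tangent_to w f) \<longleftrightarrow> w \<in> (\<Union>j<s. Ellipse j) \<union> (if s < r then {\<alpha>} else {})" for w
  proof -
    have "(\<exists>f\<in>branches. tangent_to w f) \<longleftrightarrow> s < r \<and> w = \<alpha> \<or> (\<exists>j<s. w \<in> Ellipse j)"
      unfolding bex_branches tangent_to_pencil using tangent_to_branches_of[of _ w] by blast
    then show ?thesis by auto
  qed
  ultimately show ?thesis unfolding spectrum_at_branches by blast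
qed

text \<open>A set of indices below s has at least k elements iff it meets every set of s - k + 1
  indices. Applied for each e, this permits exchanging the quantifiers over e and over index sets,
  and for a fixed index set the condition over all e describes a convex hull.\<close>

lemma rank_range_iff_hulls:
  assumes k: "1 \<le> k" "k \<le> s"
  shows "in_rank_range (r + s) k M w \<longleftrightarrow>
    w \<in> (\<Inter>J\<in>{J. J \<subseteq> {..<s} \<and> card J = s - k + 1}. convex hull (\<Union>j\<in>J. Ellipse j))"
proof -
  define G where "G = (\<lambda>e. {j. j < s \<and> Re (e * (w - c)) \<le> supp j e})"
  have "in_rank_range (r + s) k M w \<longleftrightarrow> (\<forall>e. k \<le> card (G e))"
    unfolding G_def using rank_range_imp_supports[OF _ k(2)] supports_imp_rank_range[OF k(2)] by blast
  also have "\<dots> \<longleftrightarrow> (\<forall>e. \<forall>J. J \<subseteq> {..<s} \<and> card J = s - k + 1 \<longrightarrow> J \<inter> G e \<noteq> {})"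
  proof (intro iff_allI)
    fix e
    have G: "G e \<subseteq> {..<s}" "finite (G e)" unfolding G_def by auto
    show "k \<le> card (G e) \<longleftrightarrow> (\<forall>J. J \<subseteq> {..<s} \<and> card J = s - k + 1 \<longrightarrow> J \<inter> G e \<noteq> {})"
    proof
      assume le: "k \<le> card (G e)"
      show "\<forall>J. J \<subseteq> {..<s} \<and> card J = s - k + 1 \<longrightarrow> J \<inter> G e \<noteq> {}"
      proof (intro allI impI notI)
        fix J assume J: "J \<subseteq> {..<s} \<and> card J = s - k + 1" and e: "J \<inter> G e = {}"
        then have "finite J" using finite_subset by blast
        then have "card J + card (G e) = card (J \<union> G e)" using G e by (simp add: card_Un_disjoint)
        also have "\<dots> \<le> s" using card_mono[of "{..<s}" "J \<union> G e"] J G by auto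
        finally show False using J le k by linarith
      qed
    next
      assume A: "\<forall>J. J \<subseteq> {..<s} \<and> card J = s - k + 1 \<longrightarrow> J \<inter> G e \<noteq> {}"
      show "k \<le> card (G e)"
      proof (rule ccontr)
        assume "\<not> ?thesis"
        moreover have "card ({..<s} - G e) = s - card (G e)" using G by (subst card_Diff_subset) auto
        ultimately have "s - k + 1 \<le> card ({..<s} - G e)" using k by linarith
        then obtain J where "J \<subseteq> {..<s} - G e" "card J = s - k + 1"
          by (meson obtain_subset_with_card_n)
        then show False using A by blast
      qed
    qed
  qed
  also have "\<dots> \<longleftrightarrow> (\<forall>J. J \<subseteq> {..<s} \<and> card J = s - k + 1 \<longrightarrow> w \<in> convex hull (\<Union>j\<in>J. Ellipse j))"
  proof -
    have "w \<in> convex hull (\<Union>j\<in>J. Ellipse j) \<longleftrightarrow> (\<forall>e. J \<inter> G e \<noteq> {})"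
      if J: "J \<subseteq> {..<s}" "card J = s - k + 1" for J
    proof -
      have "finite J" "J \<noteq> {}" using J finite_subset by auto
      then have "w \<in> convex hull (\<Union>j\<in>J. Ellipse j) \<longleftrightarrow> (\<forall>e. \<exists>j\<in>J. Re (e * (w - c)) \<le> supp j e)"
        unfolding Ellipse_def by (rule mem_convex_hull_ellipses) (use J F_le_K focus_sq in auto)
      also have "\<dots> \<longleftrightarrow> (\<forall>e. J \<inter> G e \<noteq> {})" unfolding G_def using J(1) by blast
      finally show ?thesis .
    qed
    then show ?thesis by blast
  qed
  finally show ?thesis by blast
qed

end

section \<open>Transfer to matrices\<close>

lemma mat_adjoint_adjoint [simp]: "mat_adjoint (mat_adjoint A) = (A :: complex mat)"
  by (rule eq_matI) auto

lemma mat_adjoint_congruence: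
  fixes A V :: "complex mat"
  assumes A: "A \<in> carrier_mat n n" and V: "V \<in> carrier_mat n n"
  shows "mat_adjoint (mat_adjoint V * A * V) = mat_adjoint V * mat_adjoint A * V"
proof -
  have V': "mat_adjoint V \<in> carrier_mat n n" using V by simp
  have "mat_adjoint (mat_adjoint V * A * V) = mat_adjoint V * (mat_adjoint A * V)"
    using mat_adjoint_mult[OF mult_carrier_mat[OF V' A] V] mat_adjoint_mult[OF V' A] by simp
  then show ?thesis using assoc_mult_mat[OF V' _ V, of "mat_adjoint A"] A by simp
qed

lemma rank_numerical_range_congruence_subset:
  fixes A V :: "complex mat"
  assumes A: "A \<in> carrier_mat n n" and V: "V \<in> carrier_mat n n" and VV: "mat_adjoint V * V = 1\<^sub>m n"
  shows "rank_numerical_range k (mat_adjoint V * A * V) \<subseteq> rank_numerical_range k A"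
proof
  have V': "mat_adjoint V \<in> carrier_mat n n" using V by simp
  fix w assume "w \<in> rank_numerical_range k (mat_adjoint V * A * V)"
  then obtain X where X: "X \<in> carrier_mat n k" "mat_adjoint X * X = 1\<^sub>m k"
      "mat_adjoint X * (mat_adjoint V * A * V) * X = w \<cdot>\<^sub>m 1\<^sub>m k"
    unfolding rank_numerical_range_def using V by auto
  have X': "mat_adjoint X \<in> carrier_mat k n" using X(1) by simp
  have VX: "V * X \<in> carrier_mat n k" using V X(1) by simp
  have adj: "mat_adjoint (V * X) = mat_adjoint X * mat_adjoint V" by (rule mat_adjoint_mult[OF V X(1)])
  have "mat_adjoint (V * X) * (V * X) = mat_adjoint X * (mat_adjoint V * (V * X))"
    unfolding adj by (rule assoc_mult_mat[OF X' V' VX])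
  also have "mat_adjoint V * (V * X) = mat_adjoint V * V * X" by (rule assoc_mult_mat[OF V' V X(1), symmetric])
  also have "\<dots> = X" unfolding VV using X(1) by simp
  finally have 1: "mat_adjoint (V * X) * (V * X) = 1\<^sub>m k" using X(2) by simp
  have "mat_adjoint (V * X) * A * (V * X) = mat_adjoint X * (mat_adjoint V * A) * (V * X)"
    unfolding adj using assoc_mult_mat[OF X' V' A] by simp
  also have "\<dots> = mat_adjoint X * (mat_adjoint V * A) * V * X"
    by (rule assoc_mult_mat[OF mult_carrier_mat[OF X' mult_carrier_mat[OF V' A]] V X(1), symmetric])
  also have "mat_adjoint X * (mat_adjoint V * A) * V = mat_adjoint X * (mat_adjoint V * A * V)"
    by (rule assoc_mult_mat[OF X' mult_carrier_mat[OF V' A] V])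
  finally have "mat_adjoint (V * X) * A * (V * X) = w \<cdot>\<^sub>m 1\<^sub>m k" using X(3) by simp
  with 1 VX show "w \<in> rank_numerical_range k A"
    unfolding rank_numerical_range_def mem_Collect_eq carrier_matD(1)[OF A] by blast
qed

lemma rank_numerical_range_congruence:
  fixes A V :: "complex mat"
  assumes A: "A \<in> carrier_mat n n" and V: "V \<in> carrier_mat n n" and VV: "mat_adjoint V * V = 1\<^sub>m n"
  shows "rank_numerical_range k (mat_adjoint V * A * V) = rank_numerical_range k A"
proof
  show "rank_numerical_range k (mat_adjoint V * A * V) \<subseteq> rank_numerical_range k A"
    by (rule rank_numerical_range_congruence_subset[OF assms])
  have V': "mat_adjoint V \<in> carrier_mat n n" using V by simp
  have VV': "V * mat_adjoint V = 1\<^sub>m n" by (rule mat_mult_left_right_inverse[OF V' V VV])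
  have B: "mat_adjoint V * A * V \<in> carrier_mat n n" by (rule mult_carrier_mat[OF mult_carrier_mat[OF V' A] V])
  have "mat_adjoint (mat_adjoint V) * (mat_adjoint V * A * V) * mat_adjoint V = A"
  proof -
    have "V * (mat_adjoint V * A * V) * mat_adjoint V = V * (mat_adjoint V * A * V * mat_adjoint V)"
      by (rule assoc_mult_mat[OF V B V'])
    also have "mat_adjoint V * A * V * mat_adjoint V = mat_adjoint V * A * (V * mat_adjoint V)"
      by (rule assoc_mult_mat[OF mult_carrier_mat[OF V' A] V V'])
    also have "\<dots> = mat_adjoint V * A" unfolding VV' by (rule right_mult_one_mat[OF mult_carrier_mat[OF V' A]])
    also have "V * (mat_adjoint V * A) = V * mat_adjoint V * A" by (rule assoc_mult_mat[OF V V' A, symmetric])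
    also have "\<dots> = A" unfolding VV' using A by simp
    finally show ?thesis by simp
  qed
  then show "rank_numerical_range k A \<subseteq> rank_numerical_range k (mat_adjoint V * A * V)"
    using rank_numerical_range_congruence_subset[OF B V', of k] VV' by simp
qed

lemma hermitian_part_congruence:
  fixes A V :: "complex mat"
  assumes A: "A \<in> carrier_mat n n" and V: "V \<in> carrier_mat n n"
  shows "hermitian_part (e \<cdot>\<^sub>m (mat_adjoint V * A * V)) = mat_adjoint V * hermitian_part (e \<cdot>\<^sub>m A) * V"
proof -
  have V': "mat_adjoint V \<in> carrier_mat n n" using V by simp
  have scale: "mat_adjoint V * (a \<cdot>\<^sub>m N) * V = a \<cdot>\<^sub>m (mat_adjoint V * N * V)" if "N \<in> carrier_mat n n" for a N
    unfolding mult_smult_distrib[OF V' that] by (rule mult_smult_assoc_mat[OF mult_carrier_mat[OF V' that] V])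
  have add: "mat_adjoint V * (N + N') * V = mat_adjoint V * N * V + mat_adjoint V * N' * V"
    if "N \<in> carrier_mat n n" "N' \<in> carrier_mat n n" for N N'
    unfolding mult_add_distrib_mat[OF V' that]
    by (rule add_mult_distrib_mat[OF mult_carrier_mat[OF V' that(1)] mult_carrier_mat[OF V' that(2)] V])
  have eA: "e \<cdot>\<^sub>m A \<in> carrier_mat n n" "mat_adjoint (e \<cdot>\<^sub>m A) \<in> carrier_mat n n" using A by auto
  have "hermitian_part (e \<cdot>\<^sub>m (mat_adjoint V * A * V)) =
      (1 / 2) \<cdot>\<^sub>m (mat_adjoint V * (e \<cdot>\<^sub>m A) * V + mat_adjoint V * mat_adjoint (e \<cdot>\<^sub>m A) * V)"
    unfolding hermitian_part_def scale[OF A, symmetric] mat_adjoint_congruence[OF eA(1) V] ..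
  also have "\<dots> = mat_adjoint V * hermitian_part (e \<cdot>\<^sub>m A) * V"
    unfolding hermitian_part_def add[OF eA, symmetric] using eA by (intro scale[symmetric]) simp
  finally show ?thesis .
qed

lemma eigenvalue_hermitian_part_congruence:
  fixes A V :: "complex mat"
  assumes A: "A \<in> carrier_mat n n" and V: "V \<in> carrier_mat n n" and VV: "mat_adjoint V * V = 1\<^sub>m n"
  shows "eigenvalue (hermitian_part (e \<cdot>\<^sub>m (mat_adjoint V * A * V))) l \<longleftrightarrow> eigenvalue (hermitian_part (e \<cdot>\<^sub>m A)) l"
proof -
  define N where "N = hermitian_part (e \<cdot>\<^sub>m A)"
  have N: "N \<in> carrier_mat n n" unfolding N_def hermitian_part_def using A by simp
  have V': "mat_adjoint V \<in> carrier_mat n n" using V by simp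
  have VV': "V * mat_adjoint V = 1\<^sub>m n" by (rule mat_mult_left_right_inverse[OF V' V VV])
  have B: "mat_adjoint V * N * V \<in> carrier_mat n n" by (rule mult_carrier_mat[OF mult_carrier_mat[OF V' N] V])
  have "similar_mat (mat_adjoint V * N * V) N"
    by (rule similar_matI[of _ _ _ _ n]) (use B N V V' VV VV' in auto)
  then have "char_poly (mat_adjoint V * N * V) = char_poly N" by (rule char_poly_similar)
  then show ?thesis unfolding hermitian_part_congruence[OF A V] N_def[symmetric]
    by (simp only: eigenvalue_root_char_poly[OF B] eigenvalue_root_char_poly[OF N])
qed

lemma in_rank_range_cong:
  assumes "\<And>i j. i < n \<Longrightarrow> j < n \<Longrightarrow> M i j = M' i j"
  shows "in_rank_range n k M w \<longleftrightarrow> in_rank_range n k M' w"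
proof -
  have "hdot n x (mapply n M y) = hdot n x (mapply n M' y)" for x y
    by (intro hdot_cong mapply_cong) (use assms in auto)
  then show ?thesis unfolding in_rank_range_def by simp
qed

theorem theorem2p1:
  fixes r n :: nat
    and \<alpha> \<beta> :: complex
    and C D U :: "complex mat"
    and z :: "nat \<Rightarrow> complex"
    and h :: "nat \<Rightarrow> real"
  defines "A \<equiv> four_block_mat (\<alpha> \<cdot>\<^sub>m 1\<^sub>m r) C D (\<beta> \<cdot>\<^sub>m 1\<^sub>m (n - r))"
    and "Z \<equiv> D * C"
    and "H \<equiv> mat_adjoint C * C + D * mat_adjoint D"
    and "\<Delta> \<equiv> (\<lambda>j. (\<alpha> - \<beta>)\<^sup>2 + 4 * z j)"
  defines "E \<equiv> (\<lambda>j. ellipse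
      ((\<alpha> + \<beta>) / 2 + csqrt (\<Delta> j) / 2)
      ((\<alpha> + \<beta>) / 2 - csqrt (\<Delta> j) / 2)
      (sqrt ((cmod (\<alpha> - \<beta>))\<^sup>2 / 2 + h j + cmod (\<Delta> j) / 2))
      (sqrt ((cmod (\<alpha> - \<beta>))\<^sup>2 / 2 + h j - cmod (\<Delta> j) / 2)))"
  assumes "0 < r" and "r < n" and "n \<le> 2 * r"
    and "C \<in> carrier_mat r (n - r)" and "D \<in> carrier_mat (n - r) r"
    and "normal_mat Z" and "Z * H = H * Z"
    and "unitary_mat (n - r) U"
    and "mat_adjoint U * Z * U = mat_diag (n - r) z"
    and "mat_adjoint U * H * U = mat_diag (n - r) (\<lambda>j. complex_of_real (h j))"
  shows "kippenhahn_curve A =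
           (if n < 2 * r then (\<Union>j<n - r. E j) \<union> {\<alpha>} else (\<Union>j<n div 2. E j)) \<and>
         numerical_range A = convex hull (\<Union>j<n - r. E j) \<and>
         (\<forall>k. 1 \<le> k \<and> k \<le> n - r \<longrightarrow>
           rank_numerical_range k A =
             (\<Inter>J \<in> {J. J \<subseteq> {..<n - r} \<and> card J = n - r - k + 1}. convex hull (\<Union>j\<in>J. E j))) \<and>
         (n < 2 * r \<longrightarrow>
           (\<forall>k. n - r < k \<and> k \<le> r \<longrightarrow> rank_numerical_range k A = {\<alpha>}) \<and>
           (\<forall>k. r < k \<and> k \<le> n \<and> (\<alpha> = \<beta> \<longrightarrow> card {j. j < n - r \<and> h j = 0} < k - r) \<longrightarrow>
             rank_numerical_range k A = {})) \<and>
         (n = 2 * r \<longrightarrow>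
           (\<forall>k. n div 2 < k \<and> k \<le> n \<and> (\<alpha> = \<beta> \<longrightarrow> card {j. j < n - r \<and> h j = 0} < k - r) \<longrightarrow>
             rank_numerical_range k A = {}))"
proof -
  define s where "s = n - r"
  have n: "n = r + s" and sr: "s \<le> r" and s0: "0 < s"
    using \<open>r < n\<close> \<open>n \<le> 2 * r\<close> unfolding s_def by auto
  have C: "C \<in> carrier_mat r s" and D: "D \<in> carrier_mat s r" using assms(9,10) unfolding s_def by auto
  have U: "U \<in> carrier_mat s s" and UU: "mat_adjoint U * U = 1\<^sub>m s"
    using \<open>unitary_mat (n - r) U\<close> unfolding unitary_mat_def s_def by auto
  have U': "mat_adjoint U \<in> carrier_mat s s" using U by simp
  have D': "mat_adjoint D \<in> carrier_mat r s" and C': "mat_adjoint C \<in> carrier_mat s r" using C D by auto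
  define C1 where "C1 = C * U"
  define D1 where "D1 = mat_adjoint U * D"
  have C1: "C1 \<in> carrier_mat r s" and D1: "D1 \<in> carrier_mat s r" unfolding C1_def D1_def using C D U U' by auto
  have DC1: "D1 * C1 = mat_diag s z"
  proof -
    have "D1 * C1 = mat_adjoint U * (D * (C * U))"
      unfolding D1_def C1_def by (rule assoc_mult_mat[OF U' D mult_carrier_mat[OF C U]])
    also have "D * (C * U) = Z * U" unfolding Z_def by (rule assoc_mult_mat[OF D C U, symmetric])
    also have "mat_adjoint U * (Z * U) = mat_adjoint U * Z * U"
      unfolding Z_def by (rule assoc_mult_mat[OF U' mult_carrier_mat[OF D C] U, symmetric])
    finally show ?thesis using assms(14) unfolding s_def by simp
  qed
  have HH1: "mat_adjoint C1 * C1 + D1 * mat_adjoint D1 = mat_diag s (\<lambda>j. complex_of_real (h j))"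
  proof -
    have CC: "mat_adjoint C * C \<in> carrier_mat s s" and DD: "D * mat_adjoint D \<in> carrier_mat s s"
      using C D C' D' by auto
    have "mat_adjoint C1 * C1 = mat_adjoint U * mat_adjoint C * (C * U)"
      unfolding C1_def mat_adjoint_mult[OF C U] ..
    also have "\<dots> = mat_adjoint U * (mat_adjoint C * (C * U))"
      by (rule assoc_mult_mat[OF U' C' mult_carrier_mat[OF C U]])
    also have "mat_adjoint C * (C * U) = mat_adjoint C * C * U" by (rule assoc_mult_mat[OF C' C U, symmetric])
    finally have 1: "mat_adjoint C1 * C1 = mat_adjoint U * (mat_adjoint C * C) * U"
      using assoc_mult_mat[OF U' CC U] by simp
    have "D1 * mat_adjoint D1 = mat_adjoint U * D * (mat_adjoint D * U)"
      unfolding D1_def mat_adjoint_mult[OF U' D] mat_adjoint_adjoint ..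
    also have "\<dots> = mat_adjoint U * (D * (mat_adjoint D * U))"
      by (rule assoc_mult_mat[OF U' D mult_carrier_mat[OF D' U]])
    also have "D * (mat_adjoint D * U) = D * mat_adjoint D * U" by (rule assoc_mult_mat[OF D D' U, symmetric])
    finally have 2: "D1 * mat_adjoint D1 = mat_adjoint U * (D * mat_adjoint D) * U"
      using assoc_mult_mat[OF U' DD U] by simp
    have "mat_adjoint U * H * U = mat_adjoint U * (mat_adjoint C * C) * U + mat_adjoint U * (D * mat_adjoint D) * U"
      unfolding H_def mult_add_distrib_mat[OF U' CC DD]
      by (rule add_mult_distrib_mat[OF mult_carrier_mat[OF U' CC] mult_carrier_mat[OF U' DD] U])
    then show ?thesis using assms(15) unfolding 1 2 s_def by simp
  qed
  define Cf where "Cf = (\<lambda>i j. C1 $$ (i, j))"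
  define Df where "Df = (\<lambda>i j. D1 $$ (i, j))"
  interpret cb: commuting_blocks r s \<alpha> \<beta> Cf Df z h
  proof
    fix i j assume ij: "i < s" "j < s"
    have "(\<Sum>k<r. Df i k * Cf k j) = (D1 * C1) $$ (i, j)"
      using ij C1 D1 unfolding Cf_def Df_def by (auto simp: scalar_prod_def lessThan_atLeast0 intro!: sum.cong)
    then show "(\<Sum>k<r. Df i k * Cf k j) = (if i = j then z j else 0)"
      unfolding DC1 using ij by (simp add: mat_diag_def)
    have "(mat_adjoint C1 * C1 + D1 * mat_adjoint D1) $$ (i, j) = (mat_adjoint C1 * C1) $$ (i, j) + (D1 * mat_adjoint D1) $$ (i, j)"
      using ij C1 D1 by auto
    also have "(mat_adjoint C1 * C1) $$ (i, j) = (\<Sum>k<r. cnj (Cf k i) * Cf k j)"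
      using ij C1 unfolding Cf_def by (auto simp: scalar_prod_def lessThan_atLeast0 intro!: sum.cong)
    also have "(D1 * mat_adjoint D1) $$ (i, j) = (\<Sum>k<r. Df i k * cnj (Df j k))"
      using ij D1 unfolding Df_def by (auto simp: scalar_prod_def lessThan_atLeast0 intro!: sum.cong)
    finally show "(\<Sum>k<r. cnj (Cf k i) * Cf k j) + (\<Sum>k<r. Df i k * cnj (Df j k)) = (if i = j then of_real (h j) else 0)"
      unfolding HH1 using ij by (simp add: mat_diag_def)
  qed (rule sr)
  \<comment> \<open>The change of basis acts on the lower block only, so the scalar diagonal blocks
    stay and C, D become \<open>C1\<close>, \<open>D1\<close>.\<close>
  define V where "V = four_block_mat (1\<^sub>m r) (0\<^sub>m r s) (0\<^sub>m s r) U"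
  define A1 where "A1 = four_block_mat (\<alpha> \<cdot>\<^sub>m 1\<^sub>m r) C1 D1 (\<beta> \<cdot>\<^sub>m 1\<^sub>m s)"
  have V: "V \<in> carrier_mat n n" unfolding V_def n using U by simp
  have A: "A \<in> carrier_mat n n" unfolding A_def n using C D by simp
  have adjV: "mat_adjoint V = four_block_mat (1\<^sub>m r) (0\<^sub>m r s) (0\<^sub>m s r) (mat_adjoint U)"
    unfolding V_def by (rule eq_matI) (use U in auto)
  have VV: "mat_adjoint V * V = 1\<^sub>m n"
    unfolding adjV unfolding V_def n
    by (subst mult_four_block_mat[of _ r r _ s _ s _ _ r _ s]) (use U U' UU in auto)
  have VAV: "mat_adjoint V * A * V = A1"
  proof -
    have 1: "\<alpha> \<cdot>\<^sub>m 1\<^sub>m r \<in> carrier_mat r r" "\<beta> \<cdot>\<^sub>m 1\<^sub>m s \<in> carrier_mat s s" by auto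
    have "mat_adjoint V * A = four_block_mat (\<alpha> \<cdot>\<^sub>m 1\<^sub>m r) C D1 (\<beta> \<cdot>\<^sub>m mat_adjoint U)"
      unfolding adjV A_def s_def[symmetric]
      by (subst mult_four_block_mat[of _ r r _ s _ s _ _ r _ s])
        (use U' C D mult_smult_distrib[OF U', of "1\<^sub>m s" s \<beta>] in \<open>auto simp: D1_def\<close>)
    then have "mat_adjoint V * A * V = four_block_mat (\<alpha> \<cdot>\<^sub>m 1\<^sub>m r) C D1 (\<beta> \<cdot>\<^sub>m mat_adjoint U) * V" by simp
    also have "\<dots> = A1"
      unfolding V_def A1_def
      by (subst mult_four_block_mat[of _ r r _ s _ s _ _ r _ s])
        (use U U' C D1 UU mult_smult_assoc_mat[OF U' U, of \<beta>] in \<open>auto simp: C1_def\<close>)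
    finally show ?thesis .
  qed
  have A1: "A1 \<in> carrier_mat (r + s) (r + s)" unfolding A1_def using C1 D1 by simp
  have A1_index: "A1 $$ (i, j) = cb.M i j" if "i < r + s" "j < r + s" for i j
    unfolding A1_def cb.M_def unfolding Cf_def Df_def using that C1 D1 by auto
  have rank: "w \<in> rank_numerical_range k A \<longleftrightarrow> in_rank_range (r + s) k cb.M w" for w k
    unfolding rank_numerical_range_congruence[OF A V VV, symmetric] VAV rank_numerical_range_iff[OF A1]
    by (rule in_rank_range_cong) (rule A1_index)
  have spec: "eigenvalue (hermitian_part (e \<cdot>\<^sub>m A)) l \<longleftrightarrow> cb.spectrum_at e l" for e l
  proof -
    have "hermitian_part (e \<cdot>\<^sub>m A1) \<in> carrier_mat (r + s) (r + s)" unfolding hermitian_part_def using A1 by simp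
    note eig = eigenvalue_iff_mapply[OF this]
    have "hermitian_part (e \<cdot>\<^sub>m A1) $$ (i, j) = cb.hpart e i j" if "i < r + s" "j < r + s" for i j
      unfolding hermitian_part_def cb.hpart_def using that A1 A1_index by simp
    then have "mapply (r + s) (\<lambda>i j. hermitian_part (e \<cdot>\<^sub>m A1) $$ (i, j)) x i = mapply (r + s) (cb.hpart e) x i"
      if "i < r + s" for x i using that by (intro mapply_cong) auto
    then show ?thesis
      unfolding eigenvalue_hermitian_part_congruence[OF A V VV, symmetric] VAV eig cb.spectrum_at_def by simp
  qed
  have E: "E j = cb.Ellipse j" for j
  proof -
    have \<Delta>: "\<Delta> j = 4 * cb.F j" unfolding \<Delta>_def cb.F_def cb.\<delta>_def by (simp add: power_divide algebra_simps)
    \<comment> \<open>The discriminant is 4 F j, and doubling a principal square root stays in the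
      range of the principal branch.\<close>
    have f: "csqrt (\<Delta> j) / 2 = cb.focus j"
    proof -
      have "csqrt ((2 * csqrt (cb.F j))\<^sup>2) = 2 * csqrt (cb.F j)"
        by (rule csqrt_square) (use csqrt_principal[of "cb.F j"] in auto)
      then show ?thesis unfolding \<Delta> cb.focus_def by (simp add: power_mult_distrib)
    qed
    have "(cmod (\<alpha> - \<beta>))\<^sup>2 / 2 + h j = 2 * cb.K j" "cmod (\<Delta> j) / 2 = 2 * cmod (cb.F j)"
      unfolding cb.K_def cb.\<delta>_def \<Delta> by (simp_all add: norm_divide norm_mult power_divide)
    then show ?thesis unfolding E_def cb.Ellipse_def f cb.c_def by simp
  qed
  have "kippenhahn_curve A = (\<Union>j<s. E j) \<union> (if s < r then {\<alpha>} else {})"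
    unfolding kippenhahn_curve_def spec E by (rule cb.kippenhahn_eq_ellipses)
  then have kipp: "kippenhahn_curve A = (if n < 2 * r then (\<Union>j<n - r. E j) \<union> {\<alpha>} else (\<Union>j<n div 2. E j))"
    using n sr by (cases "s < r") auto
  have hulls: "rank_numerical_range k A = (\<Inter>J \<in> {J. J \<subseteq> {..<s} \<and> card J = s - k + 1}. convex hull (\<Union>j\<in>J. E j))"
    if "1 \<le> k" "k \<le> s" for k
    using rank[of _ k] cb.rank_range_iff_hulls[OF that] unfolding E by blast
  have num: "numerical_range A = convex hull (\<Union>j<s. E j)"
  proof -
    have "{J. J \<subseteq> {..<s} \<and> card J = s - 1 + 1} = {{..<s}}" using s0 by (auto dest: card_subset_eq[rotated])
    then show ?thesis unfolding numerical_range_eq[OF A] using hulls[of 1] s0 by simp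
  qed
  have mid: "rank_numerical_range k A = {\<alpha>}" if "s < k" "k \<le> r" for k
    using rank cb.rank_range_large(1)[OF _ that(1)] cb.alpha_in_rank_range[OF that(2)] by blast
  \<comment> \<open>A rank above r also exceeds s, so a member would equal both \<alpha> and
    \<beta>. What remains is \<alpha> = \<beta>, where the number of j with h j = 0 decides.\<close>
  have empty: "rank_numerical_range k A = {}"
    if k: "r < k" and card: "\<alpha> = \<beta> \<longrightarrow> card {j. j < s \<and> h j = 0} < k - r" for k
  proof -
    have False if R: "in_rank_range (r + s) k cb.M w" for w
    proof -
      have "w = \<alpha>" "w = \<beta>" using cb.rank_range_large[OF R] k sr by auto
      then have ab: "\<alpha> = \<beta>" by simp
      then have "card {j. j < s \<and> h j = 0} < k - r" using card by blast
      then have "r + card {j. j < s \<and> h j = 0} < k" by linarith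
      then show False using cb.rank_range_too_large[OF R _ ab] by blast
    qed
    then show ?thesis using rank by blast
  qed
  show ?thesis using kipp num hulls mid empty unfolding s_def[symmetric] using n by auto
qed

end
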